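(* Let $A$ be a $C^*$-algebra. Then the following are equivalent: (1) $\operatorname{gr}(A)=0$; (2) $\operatorname{gr}_0(A)=0$; (3) $A$ is a commutative $C^*$-algebra with totally disconnected spectrum.
   Context: Notation: for a $C^*$-algebra $A$, $A_{\mathrm{sa}}$ is the set of self-adjoint elements; $C^*(b_0,\dots,b_n)$ is the (not necessarily unital) sub-$C^*$-algebra generated by $b_0,\dots,b_n$; $\widetilde{A}$ is the minimal unitization ($\widetilde A=A$ if $A$ is unital). For $G\subseteq A$, $c\in_\varepsilon G$ means that there is $g\in G$ with $\|c-g\|<\varepsilon$. $\operatorname{gr}_0(A)$ is the smallest integer $n\ge 0$ such that for all $a_0,\dots,a_n\in A_{\mathrm{sa}}$, $\varepsilon>0$ and $c\in A$ there exist $b_0,\dots,b_n\in A_{\mathrm{sa}}$ with $\|b_j-a_j\|<\varepsilon$ for $j=0,\dots,n$ and $c\in_\varepsilon C^*(b_0,\dots,b_n)$; $\operatorname{gr}_0(A)=\infty$ if no such $n$ exists. The generator rank of $A$ is $\operatorname{gr}(A):=\operatorname{gr}_0(\widetilde A)$. The spectrum of a commutative $C^*$-algebra $A$ is the locally compact, Hausdorff space $X$ with $A\cong C_0(X)$. *)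

theory Defs
  imports "HOL-Analysis.Analysis" "HOL-Library.Extended_Nat"
begin

section \<open>\<open>C\<^sup>*\<close>-algebras\<close>

text \<open>Algebras need not be unital, and the zero algebra is allowed.\<close>

class cstar_algebra = banach + real_normed_algebra +
  fixes scaleC :: "complex \<Rightarrow> 'a \<Rightarrow> 'a"  (infixr \<open>*\<^sub>C\<close> 75)
    and star :: "'a \<Rightarrow> 'a"
  assumes scaleR_scaleC: "r *\<^sub>R x = complex_of_real r *\<^sub>C x"
    and scaleC_add_right: "\<alpha> *\<^sub>C (x + y) = \<alpha> *\<^sub>C x + \<alpha> *\<^sub>C y"
    and scaleC_add_left: "(\<alpha> + \<beta>) *\<^sub>C x = \<alpha> *\<^sub>C x + \<beta> *\<^sub>C x"
    and scaleC_scaleC: "\<alpha> *\<^sub>C \<beta> *\<^sub>C x = (\<alpha> * \<beta>) *\<^sub>C x"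
    and mult_scaleC_left: "(\<alpha> *\<^sub>C x) * y = \<alpha> *\<^sub>C (x * y)"
    and mult_scaleC_right: "x * (\<alpha> *\<^sub>C y) = \<alpha> *\<^sub>C (x * y)"
    and norm_scaleC: "norm (\<alpha> *\<^sub>C x) = cmod \<alpha> * norm x"
    and star_star: "star (star x) = x"
    and star_add: "star (x + y) = star x + star y"
    and star_scaleC: "star (\<alpha> *\<^sub>C x) = cnj \<alpha> *\<^sub>C star x"
    and star_mult: "star (x * y) = star y * star x"
    and cstar_identity: "norm (star x * x) = (norm x)\<^sup>2"
begin

lemma scaleC_one: "1 *\<^sub>C x = x"
  using scaleR_scaleC[of 1 x] by (simp add: scaleR_one)

lemma scaleC_zero_left: "0 *\<^sub>C x = 0"
  using scaleC_add_left[of 0 0 x] by simp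

lemma scaleC_minus_left: "(- \<alpha>) *\<^sub>C x = - (\<alpha> *\<^sub>C x)"
  using scaleC_add_left[of \<alpha> "- \<alpha>" x]
  by (simp add: scaleC_zero_left eq_neg_iff_add_eq_0 add.commute)

lemma star_zero: "star 0 = 0"
  using star_add[of 0 0] by simp

lemma norm_star: "norm (star x) = norm x"
proof -
  have le: "norm y \<le> norm (star y)" for y
  proof (cases "norm y = 0")
    case False
    have "norm y * norm y \<le> norm (star y) * norm y"
      using cstar_identity[of y] norm_mult_ineq[of "star y" y] by (simp add: power2_eq_square)
    moreover have "norm y > 0" using False norm_ge_zero[of y] by linarith
    ultimately show ?thesis by (rule mult_right_le_imp_le)
  qed simp
  show ?thesis using le[of x] le[of "star x"] by (simp add: star_star)
qed

end

definition self_adjoint :: "'a::cstar_algebra \<Rightarrow> bool" where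
  "self_adjoint a \<longleftrightarrow> star a = a"

definition unital :: "'a::cstar_algebra itself \<Rightarrow> bool" where
  "unital A \<longleftrightarrow> (\<exists>e::'a. \<forall>a. e * a = a \<and> a * e = a)"

definition commutative :: "'a::cstar_algebra itself \<Rightarrow> bool" where
  "commutative A \<longleftrightarrow> (\<forall>a b :: 'a. a * b = b * a)"

definition cstar_subalgebra :: "'a::cstar_algebra set \<Rightarrow> bool" where
  "cstar_subalgebra B \<longleftrightarrow> closed B \<and> 0 \<in> B \<and> (\<forall>x\<in>B. \<forall>y\<in>B. x + y \<in> B \<and> x * y \<in> B) \<and>
     (\<forall>\<alpha>. \<forall>x\<in>B. \<alpha> *\<^sub>C x \<in> B) \<and> (\<forall>x\<in>B. star x \<in> B)"

definition cstar_generated :: "'a::cstar_algebra set \<Rightarrow> 'a set" where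
  "cstar_generated S = cstar_subalgebra hull S"

section \<open>The minimal unitization\<close>

text \<open>
  \<open>Unitize a \<lambda>\<close> stands for \<open>a + \<lambda>1\<close>, with a new unit adjoined. The minimal unitization of a
  non-unital algebra carries the norm of the operator \<open>b \<mapsto> ab + \<lambda>b\<close>. The maximum with
  \<open>\<bar>\<lambda>\<bar>\<close> in the definition of the norm changes nothing in that case
  (\<open>norm_Unitize_not_unital\<close>), but makes the type a \<open>C\<^sup>*\<close>-algebra for
  unital algebras as well, as the class instance requires.
\<close>

datatype 'a unitization = Unitize (alg_part: 'a) (scalar_part: complex)

definition unit_act :: "'a::cstar_algebra unitization \<Rightarrow> 'a \<Rightarrow> 'a" where
  "unit_act x b = alg_part x * b + scalar_part x *\<^sub>C b"

instantiation unitization :: (cstar_algebra)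
  "{zero, plus, minus, uminus, times, scaleR}"
begin

definition "0 = Unitize 0 0"
definition "x + y = Unitize (alg_part x + alg_part y) (scalar_part x + scalar_part y)"
definition "x - y = Unitize (alg_part x - alg_part y) (scalar_part x - scalar_part y)"
definition "- x = Unitize (- alg_part x) (- scalar_part x)"
definition "x * y = Unitize
  (alg_part x * alg_part y + scalar_part x *\<^sub>C alg_part y + scalar_part y *\<^sub>C alg_part x)
  (scalar_part x * scalar_part y)"
definition "r *\<^sub>R x = Unitize (r *\<^sub>R alg_part x) (r *\<^sub>R scalar_part x)"

instance ..

end

lemmas unitization_ops = zero_unitization_def plus_unitization_def minus_unitization_def
  uminus_unitization_def times_unitization_def scaleR_unitization_def

lemma bounded_linear_scaleC: "bounded_linear (\<lambda>b::'a::cstar_algebra. \<alpha> *\<^sub>C b)"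
  by (rule bounded_linear_intro[where K = "cmod \<alpha>"])
    (simp_all add: scaleC_add_right scaleR_scaleC scaleC_scaleC mult.commute norm_scaleC)

lemma bounded_linear_unit_act: "bounded_linear (unit_act x)"
  unfolding unit_act_def[abs_def]
  by (intro bounded_linear_add bounded_linear_mult_right bounded_linear_scaleC)

lemma unit_act_add: "unit_act (x + y) = (\<lambda>b. unit_act x b + unit_act y b)"
  by (simp add: fun_eq_iff unit_act_def plus_unitization_def scaleC_add_left algebra_simps)

lemma unit_act_mult: "unit_act (x * y) = unit_act x \<circ> unit_act y"
  by (simp add: fun_eq_iff unit_act_def times_unitization_def scaleC_add_left scaleC_add_right
      mult_scaleC_left mult_scaleC_right scaleC_scaleC algebra_simps)

lemma unit_act_scaleR: "unit_act (r *\<^sub>R x) = (\<lambda>b. r *\<^sub>R unit_act x b)"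
  by (simp add: fun_eq_iff unit_act_def scaleR_unitization_def scaleR_add_right)
    (simp add: scaleR_scaleC scaleC_scaleC scaleR_conv_of_real)

lemma norm_alg_part_onorm: "norm a = onorm (unit_act (Unitize a 0))"
proof (rule antisym)
  have "(norm a)\<^sup>2 = norm (a * star a)"
    using cstar_identity[of "star a"] by (simp add: star_star norm_star)
  also have "\<dots> = norm (unit_act (Unitize a 0) (star a))"
    by (simp add: unit_act_def scaleC_zero_left)
  also have "\<dots> \<le> onorm (unit_act (Unitize a 0)) * norm a"
    using onorm[OF bounded_linear_unit_act, of "Unitize a 0" "star a"] by (simp add: norm_star)
  finally have *: "norm a * norm a \<le> onorm (unit_act (Unitize a 0)) * norm a"
    by (simp add: power2_eq_square)
  show "norm a \<le> onorm (unit_act (Unitize a 0))"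
  proof (cases "a = 0")
    case False
    then show ?thesis using * by simp
  qed (simp add: onorm_pos_le[OF bounded_linear_unit_act])
  show "onorm (unit_act (Unitize a 0)) \<le> norm a"
    by (rule onorm_bound) (simp_all add: unit_act_def scaleC_zero_left norm_mult_ineq)
qed

lemma onorm_unit_act_scalar: "onorm (unit_act (Unitize (0::'a::cstar_algebra) \<alpha>)) \<le> cmod \<alpha>"
  by (rule onorm_bound) (simp_all add: unit_act_def norm_scaleC)

instantiation unitization :: (cstar_algebra) real_normed_algebra
begin

definition "norm x = max (cmod (scalar_part x)) (onorm (unit_act x))"
definition "dist x y = norm (x - y)" for x y :: "'a unitization"
definition "sgn x = x /\<^sub>R norm x" for x :: "'a unitization"
definition [code del]: "(uniformity :: ('a unitization \<times> 'a unitization) filter) =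
  (INF e\<in>{0<..}. principal {(x, y). dist x y < e})"
definition [code del]: "open (U :: 'a unitization set) \<longleftrightarrow>
  (\<forall>x\<in>U. eventually (\<lambda>(x', y). x' = x \<longrightarrow> y \<in> U) uniformity)"

instance
proof
  fix x y z :: "'a unitization" and r s :: real
  show "x + y + z = x + (y + z)" "x + y = y + x" "0 + x = x" "- x + x = 0" "x - y = x + - y"
    by (simp_all add: unitization_ops algebra_simps)
  show "r *\<^sub>R (x + y) = r *\<^sub>R x + r *\<^sub>R y" "(r + s) *\<^sub>R x = r *\<^sub>R x + s *\<^sub>R x"
    "r *\<^sub>R s *\<^sub>R x = (r * s) *\<^sub>R x" "1 *\<^sub>R x = x"
    by (simp_all add: unitization_ops algebra_simps)
  show "x * y * z = x * (y * z)" "(x + y) * z = x * z + y * z" "x * (y + z) = x * y + x * z"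
    "r *\<^sub>R x * y = r *\<^sub>R (x * y)" "x * r *\<^sub>R y = r *\<^sub>R (x * y)"
    by (simp_all add: unitization_ops scaleC_add_left scaleC_add_right scaleC_scaleC
        mult_scaleC_left mult_scaleC_right scaleR_scaleC scaleR_conv_of_real algebra_simps)
  show "sgn x = x /\<^sub>R norm x" "dist x y = norm (x - y)"
    by (simp_all add: sgn_unitization_def dist_unitization_def)
  show "(uniformity :: ('a unitization \<times> 'a unitization) filter) =
      (INF e\<in>{0<..}. principal {(x, y). dist x y < e})"
    by (rule uniformity_unitization_def)
  show "open U \<longleftrightarrow> (\<forall>x\<in>U. eventually (\<lambda>(x', y). x' = x \<longrightarrow> y \<in> U) uniformity)"
    for U :: "'a unitization set"
    by (rule open_unitization_def)
  show "norm x = 0 \<longleftrightarrow> x = 0"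
  proof
    assume n: "norm x = 0"
    then have s: "scalar_part x = 0" "onorm (unit_act x) \<le> 0"
      unfolding norm_unitization_def by (auto simp: max_def split: if_splits)
    then have "x = Unitize (alg_part x) 0" by (metis unitization.collapse)
    with s have "norm (alg_part x) \<le> 0" by (metis norm_alg_part_onorm)
    with s show "x = 0" by (simp add: unitization.expand zero_unitization_def)
  next
    assume "x = 0"
    then show "norm x = 0"
      using norm_alg_part_onorm[of "0::'a"]
      by (simp add: norm_unitization_def zero_unitization_def)
  qed
  have "onorm (unit_act (x + y)) \<le> onorm (unit_act x) + onorm (unit_act y)"
    unfolding unit_act_add by (rule onorm_triangle) (rule bounded_linear_unit_act)+
  moreover have "cmod (scalar_part (x + y)) \<le> cmod (scalar_part x) + cmod (scalar_part y)"
    by (simp add: plus_unitization_def norm_triangle_ineq)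
  ultimately show "norm (x + y) \<le> norm x + norm y"
    unfolding norm_unitization_def by linarith
  show "norm (r *\<^sub>R x) = \<bar>r\<bar> * norm x"
    by (simp add: norm_unitization_def unit_act_scaleR onorm_scaleR[OF bounded_linear_unit_act]
        max_mult_distrib_left)
      (simp add: scaleR_unitization_def)
  have "onorm (unit_act (x * y)) \<le> onorm (unit_act x) * onorm (unit_act y)"
    unfolding unit_act_mult by (rule onorm_compose) (rule bounded_linear_unit_act)+
  also have "\<dots> \<le> norm x * norm y"
    by (intro mult_mono) (auto simp: norm_unitization_def le_max_iff_disj
        onorm_pos_le[OF bounded_linear_unit_act])
  finally have "onorm (unit_act (x * y)) \<le> norm x * norm y" .
  moreover have "cmod (scalar_part (x * y)) \<le> norm x * norm y"
    by (auto simp: norm_mult times_unitization_def norm_unitization_def le_max_iff_disj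
        intro!: mult_mono)
  ultimately show "norm (x * y) \<le> norm x * norm y"
    by (simp add: norm_unitization_def)
qed

end

lemma scalar_part_diff: "scalar_part (x - y) = scalar_part x - scalar_part y"
  by (simp add: minus_unitization_def)

lemma alg_part_diff: "alg_part (x - y) = alg_part x - alg_part y"
  by (simp add: minus_unitization_def)

lemma norm_scalar_part_le: "cmod (scalar_part x) \<le> norm x"
  by (simp add: norm_unitization_def)

lemma norm_alg_part_le: "norm (alg_part x) \<le> 2 * norm x"
proof -
  have x: "Unitize (alg_part x) 0 = x + Unitize 0 (- scalar_part x)"
    by (simp add: plus_unitization_def)
  have "norm (alg_part x) = onorm (unit_act (x + Unitize 0 (- scalar_part x)))"
    unfolding norm_alg_part_onorm x ..
  also have "\<dots> \<le> norm (x + Unitize 0 (- scalar_part x))"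
    by (simp add: norm_unitization_def)
  also have "\<dots> \<le> norm x + norm (Unitize (0::'a) (- scalar_part x))"
    by (rule norm_triangle_ineq)
  also have "norm (Unitize (0::'a) (- scalar_part x)) \<le> cmod (scalar_part x)"
    using onorm_unit_act_scalar[of "- scalar_part x", where 'a = 'a]
    by (simp add: norm_unitization_def)
  finally show ?thesis using norm_scalar_part_le[of x] by linarith
qed

lemma norm_Unitize_le: "norm (Unitize a \<alpha>) \<le> norm a + cmod \<alpha>"
proof -
  have "Unitize a \<alpha> = Unitize a 0 + Unitize 0 \<alpha>" by (simp add: plus_unitization_def)
  moreover have "norm (Unitize a 0) = norm a"
    by (simp add: norm_unitization_def norm_alg_part_onorm[of a]
        onorm_pos_le[OF bounded_linear_unit_act])
  moreover have "norm (Unitize (0::'a) \<alpha>) \<le> cmod \<alpha>"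
    using onorm_unit_act_scalar[of \<alpha>, where 'a = 'a] by (simp add: norm_unitization_def)
  ultimately show ?thesis
    using norm_triangle_ineq[of "Unitize a 0" "Unitize 0 \<alpha>"] by simp
qed

instance unitization :: (cstar_algebra) banach
proof
  fix X :: "nat \<Rightarrow> 'a unitization"
  assume X: "Cauchy X"
  have "Cauchy (\<lambda>n. alg_part (X n))"
  proof (rule CauchyI)
    fix e :: real assume "0 < e"
    then obtain M where "\<forall>m\<ge>M. \<forall>n\<ge>M. norm (X m - X n) < e / 2"
      using CauchyD[OF X, of "e / 2"] by auto
    then show "\<exists>M. \<forall>m\<ge>M. \<forall>n\<ge>M. norm (alg_part (X m) - alg_part (X n)) < e"
      using norm_alg_part_le[of "X _ - X _"] unfolding alg_part_diff
      by (intro exI[of _ M]) (smt (verit) field_sum_of_halves)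
  qed
  then obtain a where a: "(\<lambda>n. alg_part (X n)) \<longlonglongrightarrow> a"
    using Cauchy_convergent convergent_def by blast
  have "Cauchy (\<lambda>n. scalar_part (X n))"
  proof (rule CauchyI)
    fix e :: real assume "0 < e"
    then obtain M where "\<forall>m\<ge>M. \<forall>n\<ge>M. norm (X m - X n) < e"
      using CauchyD[OF X, of e] by auto
    then show "\<exists>M. \<forall>m\<ge>M. \<forall>n\<ge>M. norm (scalar_part (X m) - scalar_part (X n)) < e"
      using norm_scalar_part_le[of "X _ - X _"] unfolding scalar_part_diff
      by (intro exI[of _ M]) (meson order_le_less_trans)
  qed
  then obtain \<alpha> where \<alpha>: "(\<lambda>n. scalar_part (X n)) \<longlonglongrightarrow> \<alpha>"
    using Cauchy_convergent convergent_def by blast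
  have lim: "(\<lambda>n. norm (alg_part (X n) - a) + cmod (scalar_part (X n) - \<alpha>)) \<longlonglongrightarrow> 0"
    using tendsto_add[OF tendsto_norm_zero[OF LIM_zero[OF a]] tendsto_norm_zero[OF LIM_zero[OF \<alpha>]]]
    by simp
  have "(\<lambda>n. X n - Unitize a \<alpha>) \<longlonglongrightarrow> 0"
    by (rule Lim_null_comparison[OF always_eventually lim])
      (use norm_Unitize_le in \<open>auto simp: minus_unitization_def\<close>)
  then show "convergent X"
    unfolding convergent_def using LIM_zero_iff by blast
qed

instantiation unitization :: (cstar_algebra) cstar_algebra
begin

definition "\<alpha> *\<^sub>C x = Unitize (\<alpha> *\<^sub>C alg_part x) (\<alpha> * scalar_part x)"
definition "star x = Unitize (star (alg_part x)) (cnj (scalar_part x))"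

instance
proof
  fix x y :: "'a unitization" and r :: real and \<alpha> \<beta> :: complex
  show "r *\<^sub>R x = complex_of_real r *\<^sub>C x"
    by (simp add: scaleR_unitization_def scaleC_unitization_def scaleR_scaleC scaleR_conv_of_real)
  show "\<alpha> *\<^sub>C (x + y) = \<alpha> *\<^sub>C x + \<alpha> *\<^sub>C y" "(\<alpha> + \<beta>) *\<^sub>C x = \<alpha> *\<^sub>C x + \<beta> *\<^sub>C x"
    "\<alpha> *\<^sub>C \<beta> *\<^sub>C x = (\<alpha> * \<beta>) *\<^sub>C x" "(\<alpha> *\<^sub>C x) * y = \<alpha> *\<^sub>C (x * y)"
    "x * (\<alpha> *\<^sub>C y) = \<alpha> *\<^sub>C (x * y)"
    by (simp_all add: scaleC_unitization_def unitization_ops scaleC_add_left scaleC_add_right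
        scaleC_scaleC mult_scaleC_left mult_scaleC_right algebra_simps)
  show "star (star x) = x" "star (x + y) = star x + star y"
    "star (\<alpha> *\<^sub>C x) = cnj \<alpha> *\<^sub>C star x" "star (x * y) = star y * star x"
    by (simp_all add: star_unitization_def scaleC_unitization_def unitization_ops star_star
        star_add star_scaleC star_mult add.commute add.left_commute mult.commute)
  have act: "unit_act (\<gamma> *\<^sub>C z) = (\<lambda>b. \<gamma> *\<^sub>C unit_act z b)" for \<gamma> and z :: "'a unitization"
    by (simp add: fun_eq_iff unit_act_def scaleC_unitization_def scaleC_add_right scaleC_scaleC
        mult_scaleC_left)
  have "onorm (unit_act (\<alpha> *\<^sub>C x)) = cmod \<alpha> * onorm (unit_act x)"
    using onorm_scaleR[OF bounded_linear_unit_act[of x], of "cmod \<alpha>"]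
    by (simp add: onorm_def act norm_scaleC)
  then show "norm (\<alpha> *\<^sub>C x) = cmod \<alpha> * norm x"
    by (simp add: norm_unitization_def max_mult_distrib_left)
      (simp add: scaleC_unitization_def norm_mult)
  have nn: "0 \<le> onorm (unit_act z)" for z :: "'a unitization"
    by (rule onorm_pos_le[OF bounded_linear_unit_act])
  have sub: "onorm (unit_act (star z * z)) \<le> onorm (unit_act (star z)) * onorm (unit_act z)"
    for z :: "'a unitization"
    unfolding unit_act_mult by (rule onorm_compose) (rule bounded_linear_unit_act)+
  have sq: "(onorm (unit_act z))\<^sup>2 \<le> onorm (unit_act (star z * z))" for z :: "'a unitization"
  proof -
    let ?s = "onorm (unit_act (star z * z))"
    have "onorm (unit_act z) \<le> sqrt ?s"
    proof (rule onorm_bound)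
      fix b :: 'a
      have st: "star (unit_act z b) * c = star b * unit_act (star z) c" for c
        by (simp add: unit_act_def star_unitization_def star_add star_mult star_scaleC
            mult_scaleC_left mult_scaleC_right algebra_simps)
      have "(norm (unit_act z b))\<^sup>2 = norm (star b * unit_act (star z * z) b)"
        by (simp add: cstar_identity[symmetric] st unit_act_mult)
      also have "\<dots> \<le> norm (star b) * norm (unit_act (star z * z) b)"
        by (rule norm_mult_ineq)
      also have "\<dots> \<le> norm b * (?s * norm b)"
        unfolding norm_star by (intro mult_left_mono onorm bounded_linear_unit_act) simp
      also have "\<dots> = (sqrt ?s * norm b)\<^sup>2"
        by (simp add: power_mult_distrib nn power2_eq_square mult_ac)
      finally show "norm (unit_act z b) \<le> sqrt ?s * norm b"
        by (rule power2_le_imp_le) (simp add: nn)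
    qed (simp add: nn)
    then show ?thesis
      using power_mono[OF _ nn, of z "sqrt ?s" 2] by (simp add: nn)
  qed
  have le: "onorm (unit_act z) \<le> onorm (unit_act (star z))" for z :: "'a unitization"
  proof (cases "onorm (unit_act z) = 0")
    case False
    have "onorm (unit_act z) * onorm (unit_act z) \<le> onorm (unit_act (star z)) * onorm (unit_act z)"
      using sq[of z] sub[of z] unfolding power2_eq_square by linarith
    moreover have "onorm (unit_act z) > 0" using False nn[of z] by linarith
    ultimately show ?thesis by (rule mult_right_le_imp_le)
  qed (simp add: nn)
  have "star (star x) = x" by (simp add: star_unitization_def star_star)
  then have eq: "onorm (unit_act (star x)) = onorm (unit_act x)"
    using le[of x] le[of "star x"] by simp
  have "onorm (unit_act (star x * x)) = (onorm (unit_act x))\<^sup>2"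
    using sq[of x] sub[of x] by (simp add: eq power2_eq_square)
  moreover have "cmod (scalar_part (star x * x)) = (cmod (scalar_part x))\<^sup>2"
    by (simp add: times_unitization_def star_unitization_def norm_mult power2_eq_square)
  ultimately show "norm (star x * x) = (norm x)\<^sup>2"
    using nn[of x] by (simp add: norm_unitization_def max_def power_mono_iff)
qed

end

text \<open>If \<open>A\<close> has no unit, the norm is the one of the minimal unitization: \<open>x \<mapsto> \<lambda>\<close> is then
  contractive for the operator norm, since \<open>\<parallel>1 - t\<parallel> < 1\<close> with \<open>t \<in> A\<close> makes
  \<open>1 - (1 - t)\<^sup>n\<close> converge in \<open>A\<close> to a unit.\<close>

lemma left_unit_imp_unital:
  assumes "\<And>b::'a::cstar_algebra. e * b = b"
  shows "unital TYPE('a)"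
proof -
  have r: "b * star e = b" for b
    by (metis assms star_mult star_star)
  then have "star e = e" using assms[of "star e"] r[of e] by simp
  then show ?thesis using assms r unfolding unital_def by metis
qed

lemma unit_act_contraction_imp_unital:
  fixes t :: "'a::cstar_algebra"
  assumes "onorm (unit_act (Unitize t (- 1))) < 1"
  shows "unital TYPE('a)"
proof -
  define q where "q = onorm (unit_act (Unitize t (- 1)))"
  define u where "u b = b - t * b" for b
  have q: "0 \<le> q" "q < 1"
    using assms onorm_pos_le[OF bounded_linear_unit_act] by (auto simp: q_def)
  have u: "norm (u b) \<le> q * norm b" for b
    using onorm[OF bounded_linear_unit_act, of "Unitize t (- 1)" b]
    by (simp add: unit_act_def u_def q_def scaleC_minus_left scaleC_one norm_minus_commute)
  have un: "norm ((u ^^ n) b) \<le> q ^ n * norm b" for n b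
  proof (induction n)
    case (Suc n)
    have "norm ((u ^^ Suc n) b) \<le> q * norm ((u ^^ n) b)" using u by simp
    also have "\<dots> \<le> q * (q ^ n * norm b)" using Suc q by (intro mult_left_mono) auto
    finally show ?case by (simp add: mult.assoc)
  qed simp
  define d where "d n = (u ^^ n) t" for n
  define e where "e n = (\<Sum>k<n. d k)" for n
  have umult: "u (a * b) = u a * b" for a b by (simp add: u_def algebra_simps)
  have "(u ^^ n) (a * b) = (u ^^ n) a * b" for n a b
    by (induction n) (simp_all add: umult)
  then have dmult: "d n * b = (u ^^ n) (t * b)" for n b by (simp add: d_def)
  have uminus: "u (a - b) = u a - u b" for a b by (simp add: u_def algebra_simps)
  have unminus: "(u ^^ n) (a - b) = (u ^^ n) a - (u ^^ n) b" for n a b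
    by (induction n) (simp_all add: uminus)
  have eb: "b - e n * b = (u ^^ n) b" for n b
  proof (induction n)
    case (Suc n)
    have "b - e (Suc n) * b = (u ^^ n) b - (u ^^ n) (t * b)"
      using Suc by (simp add: e_def distrib_right dmult algebra_simps)
    also have "\<dots> = (u ^^ n) (u b)" by (simp add: u_def[of b] unminus)
    finally show ?case by (simp add: funpow_swap1)
  qed (simp add: e_def)
  have "summable d"
    by (rule summable_comparison_test'[where g = "\<lambda>n. q ^ n * norm t"])
      (use q un in \<open>auto simp: d_def intro!: summable_mult2 summable_geometric\<close>)
  then obtain l where l: "e \<longlonglongrightarrow> l"
    unfolding e_def by (metis summable_LIMSEQ)
  have "l * b = b" for b
  proof -
    have "(\<lambda>n. b - e n * b) \<longlonglongrightarrow> b - l * b" by (intro tendsto_intros l)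
    moreover have "(\<lambda>n. b - e n * b) \<longlonglongrightarrow> 0"
      unfolding eb
    proof (rule Lim_null_comparison)
      show "\<forall>\<^sub>F n in sequentially. norm ((u ^^ n) b) \<le> q ^ n * norm b" using un by simp
      show "(\<lambda>n. q ^ n * norm b) \<longlonglongrightarrow> 0"
        using tendsto_mult_right[OF LIMSEQ_power_zero[of q], of "norm b"] q by simp
    qed
    ultimately show ?thesis using LIMSEQ_unique by fastforce
  qed
  then show ?thesis by (rule left_unit_imp_unital)
qed

lemma norm_Unitize_not_unital:
  assumes "\<not> unital TYPE('a::cstar_algebra)"
  shows "norm (Unitize (a::'a) \<alpha>) = onorm (\<lambda>b. a * b + \<alpha> *\<^sub>C b)"
proof -
  let ?x = "Unitize a \<alpha>"
  have "cmod \<alpha> \<le> onorm (unit_act ?x)"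
  proof (rule ccontr)
    assume c: "\<not> ?thesis"
    with onorm_pos_le[OF bounded_linear_unit_act, of ?x] have "\<alpha> \<noteq> 0" by auto
    define t where "t = (- 1 / \<alpha>) *\<^sub>C a"
    have "unit_act (Unitize t (- 1)) = (\<lambda>b. (- 1 / \<alpha>) *\<^sub>C unit_act ?x b)"
      using \<open>\<alpha> \<noteq> 0\<close> by (simp add: fun_eq_iff unit_act_def t_def mult_scaleC_left scaleC_add_right
          scaleC_scaleC)
    then have "onorm (unit_act (Unitize t (- 1))) = onorm (unit_act ?x) / cmod \<alpha>"
      using onorm_scaleR[OF bounded_linear_unit_act[of ?x], of "1 / cmod \<alpha>"]
      by (simp add: onorm_def norm_scaleC norm_divide)
    also have "\<dots> < 1" using c \<open>\<alpha> \<noteq> 0\<close> by simp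
    finally show False using unit_act_contraction_imp_unital assms by blast
  qed
  then show ?thesis by (simp add: norm_unitization_def unit_act_def[abs_def])
qed

section \<open>The generator rank\<close>

text \<open>The infimum of the empty set of \<open>enat\<close> is \<open>\<infinity>\<close>.\<close>

definition gr0 :: "'a::cstar_algebra itself \<Rightarrow> enat" where
  "gr0 A = Inf {enat n | n. \<forall>(a::nat \<Rightarrow> 'a) (\<epsilon>::real) (c::'a).
     (\<forall>j\<le>n. self_adjoint (a j)) \<longrightarrow> \<epsilon> > 0 \<longrightarrow>
     (\<exists>b. (\<forall>j\<le>n. self_adjoint (b j) \<and> norm (b j - a j) < \<epsilon>) \<and>
          (\<exists>g\<in>cstar_generated (b ` {..n}). norm (c - g) < \<epsilon>))}"

definition gr :: "'a::cstar_algebra itself \<Rightarrow> enat" where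
  "gr A = (if unital A then gr0 A else gr0 TYPE('a unitization))"

section \<open>The spectrum of a commutative \<open>C\<^sup>*\<close>-algebra\<close>

text \<open>Functions on \<open>X\<close> are extended by \<open>0\<close> outside of the carrier of the topology.\<close>

definition C0 :: "'x topology \<Rightarrow> ('x \<Rightarrow> complex) set" where
  "C0 X = {f. continuous_map X euclidean f \<and> (\<forall>x. x \<notin> topspace X \<longrightarrow> f x = 0) \<and>
     (\<forall>\<epsilon>>0. compactin X {x \<in> topspace X. \<epsilon> \<le> cmod (f x)})}"

text \<open>The norm on \<open>C0 X\<close> is the supremum norm; inserting \<open>0\<close> only matters for empty \<open>X\<close>.\<close>

definition iso_C0 :: "('a::cstar_algebra \<Rightarrow> 'x \<Rightarrow> complex) \<Rightarrow> 'x topology \<Rightarrow> bool" where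
  "iso_C0 \<Phi> X \<longleftrightarrow> bij_betw \<Phi> UNIV (C0 X) \<and>
     (\<forall>a b x. \<Phi> (a + b) x = \<Phi> a x + \<Phi> b x) \<and>
     (\<forall>\<alpha> a x. \<Phi> (\<alpha> *\<^sub>C a) x = \<alpha> * \<Phi> a x) \<and>
     (\<forall>a b x. \<Phi> (a * b) x = \<Phi> a x * \<Phi> b x) \<and>
     (\<forall>a x. \<Phi> (star a) x = cnj (\<Phi> a x)) \<and>
     (\<forall>a. norm a = Sup (insert 0 ((\<lambda>x. cmod (\<Phi> a x)) ` topspace X)))"

definition is_spectrum :: "'a::cstar_algebra itself \<Rightarrow> 'x topology \<Rightarrow> bool" where
  "is_spectrum A X \<longleftrightarrow> locally_compact_space X \<and> Hausdorff_space X \<and>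
     (\<exists>\<Phi> :: 'a \<Rightarrow> 'x \<Rightarrow> complex. iso_C0 \<Phi> X)"

text \<open>A spectrum over an arbitrary type of points is homeomorphic to one whose points are functions
  \<open>'a \<Rightarrow> complex\<close> (evaluations), so nothing is lost by restricting to that type.\<close>

definition transport :: "'y topology \<Rightarrow> ('y \<Rightarrow> 'x) \<Rightarrow> ('x \<Rightarrow> complex) \<Rightarrow> 'y \<Rightarrow> complex" where
  "transport Y g h y = (if y \<in> topspace Y then h (g y) else 0)"

lemma transport_C0:
  assumes hom: "homeomorphic_maps X Y f g" and h: "h \<in> C0 X"
  shows "transport Y g h \<in> C0 Y"
proof -
  have f: "continuous_map X Y f" and g: "continuous_map Y X g"
    and gf: "\<And>x. x \<in> topspace X \<Longrightarrow> g (f x) = x" and fg: "\<And>y. y \<in> topspace Y \<Longrightarrow> f (g y) = y"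
    using hom by (auto simp: homeomorphic_maps_def)
  have fX: "f x \<in> topspace Y" if "x \<in> topspace X" for x
    using f that by (meson continuous_map_image_subset_topspace image_subset_iff)
  have gY: "g y \<in> topspace X" if "y \<in> topspace Y" for y
    using g that by (meson continuous_map_image_subset_topspace image_subset_iff)
  have "continuous_map Y euclidean (h \<circ> g)"
    using g h by (intro continuous_map_compose[of Y X]) (auto simp: C0_def)
  then have "continuous_map Y euclidean (transport Y g h)"
    by (rule continuous_map_eq) (simp add: transport_def)
  moreover have "compactin Y {y \<in> topspace Y. \<epsilon> \<le> cmod (transport Y g h y)}" if "\<epsilon> > 0" for \<epsilon>
  proof -
    have "{y \<in> topspace Y. \<epsilon> \<le> cmod (transport Y g h y)} = f ` {x \<in> topspace X. \<epsilon> \<le> cmod (h x)}"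
    proof (intro set_eqI iffI)
      fix y assume "y \<in> {y \<in> topspace Y. \<epsilon> \<le> cmod (transport Y g h y)}"
      then have "g y \<in> {x \<in> topspace X. \<epsilon> \<le> cmod (h x)}" "y = f (g y)"
        using gY fg by (auto simp: transport_def)
      then show "y \<in> f ` {x \<in> topspace X. \<epsilon> \<le> cmod (h x)}" by blast
    next
      fix y assume "y \<in> f ` {x \<in> topspace X. \<epsilon> \<le> cmod (h x)}"
      then show "y \<in> {y \<in> topspace Y. \<epsilon> \<le> cmod (transport Y g h y)}"
        using fX gf by (auto simp: transport_def)
    qed
    then show ?thesis using h that f by (auto simp: C0_def intro: image_compactin)
  qed
  ultimately show ?thesis by (auto simp: C0_def transport_def)
qed

lemma is_spectrum_homeomorphic:
  fixes A :: "'a::cstar_algebra itself" and X :: "'x topology"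
  assumes sp: "is_spectrum A X" and hom: "homeomorphic_maps X Y f g"
  shows "is_spectrum A Y"
proof -
  obtain \<Phi> :: "'a \<Rightarrow> 'x \<Rightarrow> complex" where \<Phi>: "iso_C0 \<Phi> X" using sp by (auto simp: is_spectrum_def)
  have XY: "X homeomorphic_space Y" using hom homeomorphic_space_def by blast
  have hom': "homeomorphic_maps Y X g f" using hom homeomorphic_maps_sym by blast
  have f: "continuous_map X Y f" and g: "continuous_map Y X g"
    and gf: "\<And>x. x \<in> topspace X \<Longrightarrow> g (f x) = x" and fg: "\<And>y. y \<in> topspace Y \<Longrightarrow> f (g y) = y"
    using hom by (auto simp: homeomorphic_maps_def)
  have fX: "f x \<in> topspace Y" if "x \<in> topspace X" for x
    using f that by (meson continuous_map_image_subset_topspace image_subset_iff)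
  have gY: "g y \<in> topspace X" if "y \<in> topspace Y" for y
    using g that by (meson continuous_map_image_subset_topspace image_subset_iff)
  have zero: "h x = 0" if "h \<in> C0 X" "x \<notin> topspace X" for h x using that by (simp add: C0_def)
  have zero': "h x = 0" if "h \<in> C0 Y" "x \<notin> topspace Y" for h x using that by (simp add: C0_def)
  have "bij_betw (transport Y g) (C0 X) (C0 Y)"
    by (rule bij_betw_byWitness[where f' = "transport X f"])
      (auto simp: transport_def fun_eq_iff gf fg fX gY zero zero'
        intro: transport_C0[OF hom] transport_C0[OF hom'])
  then have "bij_betw (transport Y g \<circ> \<Phi>) UNIV (C0 Y)"
    using \<Phi> bij_betw_trans unfolding iso_C0_def by blast
  moreover have "(\<lambda>y. cmod (transport Y g (\<Phi> a) y)) ` topspace Y = (\<lambda>x. cmod (\<Phi> a x)) ` topspace X" for a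
  proof (intro equalityI subsetI)
    fix r assume "r \<in> (\<lambda>y. cmod (transport Y g (\<Phi> a) y)) ` topspace Y"
    then obtain y where "y \<in> topspace Y" "r = cmod (\<Phi> a (g y))" by (auto simp: transport_def)
    then show "r \<in> (\<lambda>x. cmod (\<Phi> a x)) ` topspace X" using gY by blast
  next
    fix r assume "r \<in> (\<lambda>x. cmod (\<Phi> a x)) ` topspace X"
    then obtain x where "x \<in> topspace X" "r = cmod (\<Phi> a x)" by blast
    then have "f x \<in> topspace Y" "r = cmod (transport Y g (\<Phi> a) (f x))"
      using fX gf by (auto simp: transport_def)
    then show "r \<in> (\<lambda>y. cmod (transport Y g (\<Phi> a) y)) ` topspace Y" by blast
  qed
  ultimately have "iso_C0 (transport Y g \<circ> \<Phi>) Y"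
    using \<Phi> by (simp add: iso_C0_def) (simp add: transport_def)
  then show ?thesis
    using sp XY homeomorphic_locally_compact_space homeomorphic_Hausdorff_space
    unfolding is_spectrum_def by blast
qed

lemma C0_separates_points:
  assumes X: "locally_compact_space X" "Hausdorff_space X"
    and x: "x \<in> topspace X" and y: "y \<in> topspace X" and "x \<noteq> y"
  shows "\<exists>h\<in>C0 X. h x \<noteq> h y"
proof -
  obtain U K where UK: "openin X U" "compactin X K" "x \<in> U" "U \<subseteq> K"
    using X x unfolding locally_compact_space_def by blast
  have "closedin X {y}" using X y by (simp add: closedin_Hausdorff_singleton)
  then have cl: "closedin X (topspace X - (U - {y}))"
    using UK by (intro closedin_diff closedin_topspace openin_diff) auto
  have "completely_regular_space X"
    using X locally_compact_regular_imp_completely_regular_space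
      locally_compact_Hausdorff_imp_regular_space by blast
  then obtain k where k: "continuous_map X (top_of_set {0..1::real}) k" "k x = 0"
      "k ` (topspace X - (U - {y})) \<subseteq> {1}"
  proof -
    have "x \<in> topspace X - (topspace X - (U - {y}))" using x UK \<open>x \<noteq> y\<close> by blast
    then show ?thesis
      using \<open>completely_regular_space X\<close> cl that unfolding completely_regular_space_def by metis
  qed
  have kr: "continuous_map X euclideanreal k"
    using k(1) continuous_map_into_fulltopology by blast
  define h where "h z = (if z \<in> topspace X then complex_of_real (1 - k z) else 0)" for z
  have "continuous_map X euclidean (\<lambda>z. complex_of_real (1 - k z))"
    using continuous_map_compose[OF continuous_map_diff[OF continuous_map_const[THEN iffD2] kr],
        of 1 euclidean complex_of_real]
    by (simp add: o_def)
  then have ch: "continuous_map X euclidean h"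
    by (rule continuous_map_eq) (simp add: h_def)
  have "compactin X {z \<in> topspace X. \<epsilon> \<le> cmod (h z)}" if "\<epsilon> > 0" for \<epsilon>
  proof (rule closed_compactin[OF UK(2)])
    show "{z \<in> topspace X. \<epsilon> \<le> cmod (h z)} \<subseteq> K"
    proof clarify
      fix z assume z: "z \<in> topspace X" "\<epsilon> \<le> cmod (h z)"
      then have "k z \<noteq> 1" using that by (auto simp: h_def)
      then show "z \<in> K" using k(3) z UK by blast
    qed
    have "closedin X {z \<in> topspace X. h z \<in> {w. \<epsilon> \<le> cmod w}}"
    proof (rule closedin_continuous_map_preimage[OF ch])
      have "closed {w :: complex. \<epsilon> \<le> cmod w}"
        by (intro closed_Collect_le continuous_intros)
      then show "closedin euclidean {w :: complex. \<epsilon> \<le> cmod w}" by (simp only: closed_closedin)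
    qed
    then show "closedin X {z \<in> topspace X. \<epsilon> \<le> cmod (h z)}" by simp
  qed
  then have "h \<in> C0 X" using ch by (simp add: C0_def h_def)
  moreover have "h x = 1" "h y = 0" using k x y by (auto simp: h_def)
  ultimately show ?thesis by (intro bexI[of _ h]) auto
qed

lemma is_spectrum_small_type:
  fixes X :: "'x topology"
  assumes sp: "is_spectrum TYPE('a::cstar_algebra) X"
  shows "\<exists>Y :: ('a \<Rightarrow> complex) topology. is_spectrum TYPE('a) Y \<and> X homeomorphic_space Y"
proof -
  obtain \<Phi> :: "'a \<Rightarrow> 'x \<Rightarrow> complex" where \<Phi>: "iso_C0 \<Phi> X" using sp by (auto simp: is_spectrum_def)
  define f where "f x = (\<lambda>a. \<Phi> a x)" for x
  have inj: "inj_on f (topspace X)"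
  proof (rule inj_onI, rule ccontr)
    fix x y assume "x \<in> topspace X" "y \<in> topspace X" "f x = f y" "x \<noteq> y"
    moreover obtain h where "h \<in> C0 X" "h x \<noteq> h y"
      using C0_separates_points sp calculation unfolding is_spectrum_def by metis
    moreover obtain a where "h = \<Phi> a"
      using \<Phi> calculation unfolding iso_C0_def bij_betw_def by blast
    ultimately show False by (auto simp: f_def fun_eq_iff)
  qed
  define g where "g = inv_into (topspace X) f"
  define Y where "Y = pullback_topology (f ` topspace X) g X"
  have gf: "g (f x) = x" if "x \<in> topspace X" for x using inj that by (simp add: g_def)
  have top: "topspace Y = f ` topspace X"
    using gf by (auto simp: Y_def topspace_pullback_topology)
  have cg: "continuous_map Y X g"
    unfolding Y_def using continuous_map_pullback[OF continuous_map_id] by simp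
  have cf: "continuous_map X Y f"
    unfolding Y_def
  proof (rule continuous_map_pullback')
    show "continuous_map X X (g \<circ> f)"
      using continuous_map_id by (rule continuous_map_eq) (simp add: gf)
  qed auto
  have "homeomorphic_maps X Y f g"
    unfolding homeomorphic_maps_def using cf cg gf top by auto
  then show ?thesis using is_spectrum_homeomorphic[OF sp] homeomorphic_space_def by blast
qed

definition totally_disconnected_space :: "'x topology \<Rightarrow> bool" where
  "totally_disconnected_space X \<longleftrightarrow> (\<forall>S. connectedin X S \<longrightarrow> (\<exists>x. S \<subseteq> {x}))"

end

theory Submission
  imports Defs
begin

text \<open>
  Every self-adjoint \<open>b\<close> generates a commutative algebra, so if \<open>gr\<^sub>0(A) = 0\<close> then every element of
  \<open>A\<close> is a limit of normal elements; hence all elements are normal and \<open>A\<close> is commutative. By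
  Gelfand duality \<open>A = C\<^sub>0(X)\<close>. Given a real \<open>h\<close>, a perturbation \<open>b\<close> of \<open>h / 2 - h\<^sup>2\<close> whose
  algebra almost contains \<open>h\<close> has a gap in its values, which produces a clopen set separating the
  points where \<open>h = 1\<close> from those where \<open>h = 0\<close>; so \<open>X\<close> is totally disconnected.

  For totally disconnected \<open>X\<close> the compact open sets form a basis, hence the span of the projections
  is dense in the self-adjoint part. Conversely, in a commutative algebra with this density finitely
  many projections are combinations of orthogonal ones, and an orthogonal combination with distinct
  nonzero coefficients generates each of its projections; this gives \<open>gr\<^sub>0(A) = 0\<close>. The density of
  the span of the projections passes between \<open>A\<close> and its unitization, because the projections of the
  unitization are \<open>p\<close> and \<open>1 - p\<close> for projections \<open>p\<close> of \<open>A\<close>.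

  The characters needed for Gelfand duality are obtained as in the Kadison--Dubois representation
  theorem, from maximal modules over the cone of sums of squares.
\<close>

section \<open>Sums of squares in a commutative algebra\<close>

text \<open>Order replaces spectral theory here. The analytic input is the square root of
  \<open>e - z\<close> for \<open>norm z < 1\<close> and the identity
  \<open>norm (star z * z) = (norm z)\<^sup>2\<close>, which keeps squares of self-adjoint elements
  from cancelling. Together they make the norm the order norm of the cone \<open>sos\<close>, so the
  cone is Archimedean and a maximal module over it pins every self-adjoint element to one real
  number. The missing unit shapes the rest. Elements of \<open>cstar_generated {b}\<close> vanish at
  every character at which \<open>b\<close> vanishes, so zeros of a generator lose information.
  Total disconnectedness comes from this: if a real \<open>h\<close> took all values between 0 and 1
  on a connected set, then \<open>h / 2 - h\<^sup>2\<close> would change sign between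
  \<open>h = 1/4\<close> and \<open>h = 1\<close>, and so would every small perturbation
  \<open>b\<close>. It would vanish at a point where \<open>h\<close> is at least 1/4, and no
  element generated by \<open>b\<close> could be close to \<open>h\<close> there. For the same
  reason all polynomials below have zero constant term, and coefficients of generators are kept away
  from 0.\<close>

lemma star_minus: "star (- x) = - star (x::'a::cstar_algebra)"
  using star_add[of x "- x"] by (simp add: star_zero eq_neg_iff_add_eq_0 add.commute)

lemma star_diff: "star (x - y) = star x - star (y::'a::cstar_algebra)"
  using star_add[of x "- y"] by (simp add: star_minus)

lemma star_scaleR: "star (r *\<^sub>R x) = r *\<^sub>R star (x::'a::cstar_algebra)"
  by (simp add: scaleR_scaleC star_scaleC)

lemma bounded_linear_star: "bounded_linear (star :: 'a::cstar_algebra \<Rightarrow> 'a)"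
  by (rule bounded_linear_intro[where K = 1]) (simp_all add: star_add star_scaleR norm_star)

lemmas continuous_on_star [continuous_intros] = bounded_linear.continuous_on[OF bounded_linear_star]

lemma self_adjoint_intros:
  fixes x y :: "'a::cstar_algebra"
  shows "self_adjoint (0::'a)" "self_adjoint x \<Longrightarrow> self_adjoint (- x)"
    "self_adjoint x \<Longrightarrow> self_adjoint y \<Longrightarrow> self_adjoint (x + y)"
    "self_adjoint x \<Longrightarrow> self_adjoint y \<Longrightarrow> self_adjoint (x - y)"
    "self_adjoint x \<Longrightarrow> self_adjoint (r *\<^sub>R x)"
    "self_adjoint x \<Longrightarrow> self_adjoint y \<Longrightarrow> x * y = y * x \<Longrightarrow> self_adjoint (x * y)"
  by (simp_all add: self_adjoint_def star_zero star_minus star_add star_diff star_scaleR star_mult)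

lemma scaleC_diff_right: "\<alpha> *\<^sub>C (x - y) = \<alpha> *\<^sub>C x - \<alpha> *\<^sub>C (y::'a::cstar_algebra)"
  by (rule linear_diff[OF bounded_linear.linear[OF bounded_linear_scaleC]])

lemma scaleC_zero_right: "\<alpha> *\<^sub>C 0 = (0::'a::cstar_algebra)"
  by (rule linear_0[OF bounded_linear.linear[OF bounded_linear_scaleC]])

definition re_part :: "'a::cstar_algebra \<Rightarrow> 'a" where
  "re_part a = (1/2) *\<^sub>R (a + star a)"

definition im_part :: "'a::cstar_algebra \<Rightarrow> 'a" where
  "im_part a = (- \<i> / 2) *\<^sub>C (a - star a)"

lemma self_adjoint_parts: "self_adjoint (re_part a)" "self_adjoint (im_part a)"
proof -
  have "star ((- \<i> / 2) *\<^sub>C (a - star a)) = (\<i> / 2) *\<^sub>C (- (a - star a))"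
    by (simp add: star_scaleC star_diff star_star)
  also have "\<dots> = (- \<i> / 2) *\<^sub>C (a - star a)"
    using scaleC_minus_left[of "\<i>/2" "a - star a"] scaleC_scaleC[of "\<i>/2" "-1" "a - star a"]
    by (simp add: scaleC_minus_left scaleC_one)
  finally show "self_adjoint (im_part a)" by (simp add: self_adjoint_def im_part_def)
qed (simp_all add: self_adjoint_def re_part_def star_scaleR star_add star_star add.commute)

lemma parts_decomp: "a = re_part a + \<i> *\<^sub>C im_part a"
proof -
  have "\<i> *\<^sub>C im_part a = (1/2) *\<^sub>R (a - star a)"
    by (simp add: im_part_def scaleC_scaleC scaleR_scaleC)
  then show ?thesis
    by (simp add: re_part_def scaleR_add_right scaleR_diff_right flip: scaleR_add_left)
qed

lemma norm_self_adjoint_square: "self_adjoint x \<Longrightarrow> norm (x * x) = (norm x)\<^sup>2"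
  using cstar_identity[of x] by (simp add: self_adjoint_def)

text \<open>Positivity without spectra: closure under sums is built in, and the work goes into
  showing that the norm controls such sums (\<open>norm_le_add_sos\<close>).\<close>

inductive_set sos :: "'a::cstar_algebra set" where
  square: "self_adjoint x \<Longrightarrow> x * x \<in> sos"
| add: "p \<in> sos \<Longrightarrow> q \<in> sos \<Longrightarrow> p + q \<in> sos"

lemma sos_scaleR: "p \<in> sos \<Longrightarrow> r \<ge> 0 \<Longrightarrow> r *\<^sub>R p \<in> sos"
proof (induction rule: sos.induct)
  case (square x)
  then have "(sqrt r *\<^sub>R x) * (sqrt r *\<^sub>R x) \<in> sos"
    by (intro sos.square self_adjoint_intros)
  then show ?case using square by simp
qed (simp add: scaleR_add_right sos.add)

lemma self_adjoint_sos: "p \<in> sos \<Longrightarrow> self_adjoint p"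
  by (induction rule: sos.induct) (auto intro: self_adjoint_intros)

lemma zero_in_sos: "0 \<in> sos"
  using sos.square[OF self_adjoint_intros(1)] by simp

text \<open>The unit is a parameter because the type class provides none; the locale is interpreted
  at the adjoined unit of a unitization.\<close>

locale commutative_unital =
  fixes e :: "'a::cstar_algebra"
  assumes comm: "\<And>a b::'a. a * b = b * a"
    and unit: "\<And>a. e * a = a"
    and nonzero: "e \<noteq> 0"
begin

lemma unit_right: "a * e = a"
  using unit comm by metis

lemma left_comm: "a * (b * c) = b * (a * c)" for a b c :: 'a
  by (metis comm mult.assoc)

lemmas mult_ac' = mult.assoc comm left_comm

lemma self_adjoint_mult: "self_adjoint x \<Longrightarrow> self_adjoint y \<Longrightarrow> self_adjoint (x * y)" for x y :: 'a
  by (simp add: self_adjoint_intros comm)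

lemma self_adjoint_unit: "self_adjoint e"
  by (metis self_adjoint_def star_mult star_star unit unit_right)

lemma norm_unit: "norm e = 1"
  using norm_self_adjoint_square[OF self_adjoint_unit] nonzero
  by (simp add: unit power2_eq_square)

lemma unit_in_sos: "e \<in> sos"
  using sos.square[OF self_adjoint_unit] by (simp add: unit)

lemma sos_mult: "p \<in> sos \<Longrightarrow> q \<in> sos \<Longrightarrow> p * q \<in> sos" for p q :: 'a
proof (induction rule: sos.induct)
  case (square x)
  note x = square(1)
  from square(2) show ?case
  proof (induction rule: sos.induct)
    case (square y)
    have "(x * y) * (x * y) \<in> sos" by (intro sos.square self_adjoint_mult x square)
    then show ?case by (simp add: mult_ac')
  qed (simp add: distrib_left sos.add)
qed (simp add: distrib_right sos.add)

text \<open>With \<open>y = e - w\<close> the equation \<open>y\<^sup>2 = e - z\<close> reads \<open>w = (z + w\<^sup>2) / 2\<close>, a contraction on the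
  ball of radius \<open>norm z\<close>.\<close>

lemma sqrt_exists:
  assumes z: "self_adjoint z" "norm z < 1"
  obtains y where "self_adjoint y" "y * y = e - z"
proof -
  define S where "S = {w::'a. self_adjoint w \<and> norm w \<le> norm z}"
  define f where "f w = (1/2) *\<^sub>R (z + w * w)" for w
  have "\<exists>!w\<in>S. f w = w"
  proof (rule Banach_fix)
    have "closed {w::'a. star w = w}"
      by (intro closed_Collect_eq continuous_intros)
    moreover have "closed {w::'a. norm w \<le> norm z}"
      by (intro closed_Collect_le continuous_intros)
    ultimately have "closed S"
      unfolding S_def self_adjoint_def by (rule closed_Collect_conj)
    then show "complete S" by (simp add: complete_eq_closed)
    show "S \<noteq> {}" using z by (auto simp: S_def)
    show "0 \<le> norm z" "norm z < 1" using z by auto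
    show "f ` S \<subseteq> S"
    proof
      fix v assume "v \<in> f ` S"
      then obtain w where w: "self_adjoint w" "norm w \<le> norm z" "v = f w" by (auto simp: S_def)
      have "norm (z + w * w) \<le> norm z + norm w * norm w"
        by (meson add_left_mono norm_mult_ineq norm_triangle_le)
      also have "norm w * norm w \<le> norm z * 1" using w z by (intro mult_mono) auto
      finally have "norm (f w) \<le> norm z" by (simp add: f_def)
      moreover have "self_adjoint (f w)"
        unfolding f_def by (intro self_adjoint_intros self_adjoint_mult w z)
      ultimately show "v \<in> S" using w by (simp add: S_def)
    qed
    fix v w assume "v \<in> S" "w \<in> S"
    then have n: "norm v \<le> norm z" "norm w \<le> norm z" by (auto simp: S_def)
    have "f v - f w = (1/2) *\<^sub>R ((v + w) * (v - w))"
      by (simp add: f_def algebra_simps comm)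
    then have "norm (f v - f w) \<le> (1/2) * (norm (v + w) * norm (v - w))"
      using norm_mult_ineq[of "v + w" "v - w"] by simp
    also have "\<dots> \<le> (1/2) * ((2 * norm z) * norm (v - w))"
      using n norm_triangle_ineq[of v w] by (intro mult_left_mono mult_right_mono) auto
    finally show "dist (f v) (f w) \<le> norm z * dist v w" by (simp add: dist_norm)
  qed
  then obtain w where w: "w \<in> S" "f w = w" by blast
  have "w + w = f w + f w" using w by simp
  also have "\<dots> = z + w * w"
    by (simp add: f_def flip: scaleR_add_left)
  finally have ww: "w + w = z + w * w" .
  have "(e - w) * (e - w) = e - (w + w) + w * w"
    by (simp add: left_diff_distrib right_diff_distrib unit unit_right)
  then have "(e - w) * (e - w) = e - z" by (simp add: ww)
  moreover have "self_adjoint (e - w)"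
    using w by (intro self_adjoint_intros self_adjoint_unit) (simp add: S_def)
  ultimately show ?thesis using that by blast
qed

text \<open>The sum of the two squares is \<open>star z * z\<close> for
  \<open>z = x + \<i> *\<^sub>C y\<close>, and \<open>x\<close> is the real part of
  \<open>z\<close>, hence no larger in norm.\<close>

lemma norm_le_add_square:
  fixes x y :: 'a
  assumes x: "self_adjoint x" and y: "self_adjoint y"
  shows "(norm x)\<^sup>2 \<le> norm (x * x + y * y)"
proof -
  define z where "z = x + \<i> *\<^sub>C y"
  have sz: "star z = x - \<i> *\<^sub>C y"
    using x y by (simp add: z_def star_add star_scaleC self_adjoint_def scaleC_minus_left)
  have "star z * z = x * x + y * y"
    unfolding sz by (simp add: z_def left_diff_distrib distrib_left mult_scaleC_left
        mult_scaleC_right scaleC_scaleC scaleC_minus_left scaleC_one comm[of y x]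
        scaleC_diff_right)
  then have nz: "(norm z)\<^sup>2 = norm (x * x + y * y)" using cstar_identity[of z] by simp
  have "z + star z = 2 *\<^sub>R x" unfolding sz by (simp add: z_def scaleR_2)
  then have "2 * norm x \<le> norm z + norm (star z)"
    using norm_triangle_ineq[of z "star z"] by simp
  then have "norm x \<le> norm z" by (simp add: norm_star)
  then show ?thesis using nz by (metis norm_ge_zero power_mono)
qed

text \<open>This norm description of positivity is additive by the triangle inequality, so only one
  square needs work. After scaling it to \<open>v * v\<close> of norm below 1,
  \<open>e - v * v\<close> is itself a square \<open>y * y\<close>. The two squares add up to
  \<open>e\<close>, so \<open>norm_le_add_square\<close> bounds \<open>y * y\<close> by 1.\<close>

lemma sos_near_multiple_of_unit: "p \<in> sos \<Longrightarrow> \<exists>t\<ge>0. norm (t *\<^sub>R e - p) \<le> t" for p :: 'a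
proof (induction rule: sos.induct)
  case (square x)
  define t where "t = (norm x)\<^sup>2 + 1"
  have t: "t > 0" by (simp add: t_def add_nonneg_pos)
  define v where "v = (1 / sqrt t) *\<^sub>R x"
  have v: "self_adjoint v" unfolding v_def by (intro self_adjoint_intros square)
  have vv: "v * v = (1 / t) *\<^sub>R (x * x)" using t by (simp add: v_def)
  have "norm (v * v) < 1"
    using square t by (simp add: vv norm_self_adjoint_square) (simp add: t_def)
  then obtain y where y: "self_adjoint y" "y * y = e - v * v"
    using sqrt_exists[of "v * v"] v self_adjoint_mult by blast
  have "norm (y * y) \<le> norm (y * y + v * v)"
    using norm_le_add_square[OF y(1) v] norm_self_adjoint_square[OF y(1)] by simp
  then have "norm (e - v * v) \<le> 1" using y norm_unit by simp
  then have "t * norm (e - v * v) \<le> t" using t by simp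
  moreover have "t *\<^sub>R e - x * x = t *\<^sub>R (e - v * v)"
    using t by (simp add: vv scaleR_diff_right)
  ultimately show ?case using t by (intro exI[of _ t]) simp
next
  case (add p q)
  then obtain s t where "s \<ge> 0" "norm (s *\<^sub>R e - p) \<le> s" "t \<ge> 0" "norm (t *\<^sub>R e - q) \<le> t"
    by blast
  moreover have "(s + t) *\<^sub>R e - (p + q) = (s *\<^sub>R e - p) + (t *\<^sub>R e - q)"
    by (simp add: algebra_simps)
  ultimately show ?case
    by (intro exI[of _ "s + t"]) (metis add_mono add_nonneg_nonneg norm_triangle_le)
qed

lemma sqrt_near_multiple_of_unit:
  assumes x: "self_adjoint x" and t: "norm (t *\<^sub>R e - x) < t"
  obtains y where "self_adjoint y" "y * y = x"
proof -
  have t0: "t > 0" using t norm_ge_zero order_le_less_trans by blast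
  define z where "z = (1 / t) *\<^sub>R (t *\<^sub>R e - x)"
  have "norm z < 1" using t t0 by (simp add: z_def)
  moreover have "self_adjoint z"
    unfolding z_def by (intro self_adjoint_intros self_adjoint_unit x)
  ultimately obtain w where w: "self_adjoint w" "w * w = e - z" using sqrt_exists by blast
  have "(sqrt t *\<^sub>R w) * (sqrt t *\<^sub>R w) = t *\<^sub>R (e - z)" using t0 w by simp
  also have "\<dots> = x" using t0 by (simp add: z_def scaleR_diff_right)
  finally show ?thesis using that[of "sqrt t *\<^sub>R w"] w by (simp add: self_adjoint_intros)
qed

text \<open>The bound known for two squares extends to sums: \<open>p\<close> becomes a single
  square once \<open>d *\<^sub>R e\<close> is added, because the extra \<open>d\<close> makes the
  inequality of \<open>sos_near_multiple_of_unit\<close> strict. Then \<open>d\<close> tends to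
  0.\<close>

lemma norm_le_add_sos:
  fixes x p :: 'a
  assumes x: "self_adjoint x" and p: "p \<in> sos"
  shows "(norm x)\<^sup>2 \<le> norm (x * x + p)"
proof (rule field_le_epsilon)
  fix d :: real assume d: "d > 0"
  obtain t where t: "t \<ge> 0" "norm (t *\<^sub>R e - p) \<le> t" using sos_near_multiple_of_unit p by blast
  have eq: "(t + d) *\<^sub>R e - (p + d *\<^sub>R e) = t *\<^sub>R e - p" by (simp add: algebra_simps)
  have "norm ((t + d) *\<^sub>R e - (p + d *\<^sub>R e)) < t + d" unfolding eq using t d by linarith
  moreover have "self_adjoint (p + d *\<^sub>R e)"
    by (intro self_adjoint_intros self_adjoint_unit self_adjoint_sos p)
  ultimately obtain y where y: "self_adjoint y" "y * y = p + d *\<^sub>R e"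
    using sqrt_near_multiple_of_unit by blast
  have "(norm x)\<^sup>2 \<le> norm (x * x + p + d *\<^sub>R e)"
    using norm_le_add_square[OF x y(1)] y by (simp add: add.assoc)
  also have "\<dots> \<le> norm (x * x + p) + d"
    using norm_triangle_ineq[of "x * x + p" "d *\<^sub>R e"] d by (simp add: norm_unit)
  finally show "(norm x)\<^sup>2 \<le> norm (x * x + p) + d" .
qed

lemma minus_unit_notin_sos: "- e \<notin> sos"
  using norm_le_add_sos[OF self_adjoint_unit, of "- e"] by (auto simp: norm_unit unit)

text \<open>The Archimedean property of the cone: \<open>r *\<^sub>R e + x\<close> lies within
  distance less than \<open>r\<close> of \<open>r *\<^sub>R e\<close>, hence has a square
  root.\<close>

lemma bounded_in_sos:
  assumes x: "self_adjoint x" and r: "norm x < r"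
  shows "r *\<^sub>R e + x \<in> sos" "r *\<^sub>R e - x \<in> sos"
proof -
  have *: "r *\<^sub>R e + x \<in> sos" if x: "self_adjoint x" and r: "norm x < r" for x
  proof -
    have "self_adjoint (r *\<^sub>R e + x)" by (intro self_adjoint_intros self_adjoint_unit x)
    then obtain y where "self_adjoint y" "y * y = r *\<^sub>R e + x"
      using sqrt_near_multiple_of_unit[of "r *\<^sub>R e + x" r] r by auto
    then show ?thesis using sos.square by metis
  qed
  show "r *\<^sub>R e + x \<in> sos" "r *\<^sub>R e - x \<in> sos"
    using *[OF x r] *[of "- x"] x r by (simp_all add: self_adjoint_intros)
qed

text \<open>The product of the two given elements is \<open>r\<^sup>2 - x\<^sup>2\<close>, again a
  sum of squares; adding it to \<open>x * x\<close> leaves a multiple of the unit of norm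
  \<open>r\<^sup>2\<close>.\<close>

lemma norm_le_if_sos:
  assumes x: "self_adjoint x" and r: "r *\<^sub>R e + x \<in> sos" "r *\<^sub>R e - x \<in> sos"
  shows "norm x \<le> r"
proof -
  have r0: "r \<ge> 0"
  proof (rule ccontr)
    assume "\<not> r \<ge> 0"
    \<comment> \<open>For negative \<open>r\<close> the two elements add up to \<open>2 * r\<close>
      times the unit, which scales to \<open>- e\<close>.\<close>
    then have "(1 / (- 2 * r)) *\<^sub>R ((r *\<^sub>R e + x) + (r *\<^sub>R e - x)) \<in> sos"
      by (intro sos_scaleR sos.add r) simp
    then show False
      using \<open>\<not> r \<ge> 0\<close> minus_unit_notin_sos by (simp flip: scaleR_add_left)
  qed
  have "(norm x)\<^sup>2 \<le> norm (x * x + (r *\<^sub>R e + x) * (r *\<^sub>R e - x))"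
    by (intro norm_le_add_sos x sos_mult r)
  also have "x * x + (r *\<^sub>R e + x) * (r *\<^sub>R e - x) = (r * r) *\<^sub>R e"
    by (simp add: distrib_left distrib_right left_diff_distrib right_diff_distrib unit unit_right
        scaleR_add_right)
  also have "norm \<dots> = r\<^sup>2" by (simp add: norm_unit power2_eq_square)
  finally show ?thesis using r0 by (rule power2_le_imp_le)
qed

end

section \<open>Characters\<close>

text \<open>The zero functional counts as a character: it plays the role of the point at infinity.\<close>

definition character :: "('a::cstar_algebra \<Rightarrow> complex) \<Rightarrow> bool" where
  "character \<phi> \<longleftrightarrow> (\<forall>a b. \<phi> (a + b) = \<phi> a + \<phi> b) \<and> (\<forall>\<alpha> a. \<phi> (\<alpha> *\<^sub>C a) = \<alpha> * \<phi> a) \<and>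
     (\<forall>a b. \<phi> (a * b) = \<phi> a * \<phi> b) \<and> (\<forall>a. \<phi> (star a) = cnj (\<phi> a)) \<and>
     (\<forall>a. cmod (\<phi> a) \<le> norm a)"

section \<open>Maximal modules over the cone and the characters they define\<close>

context commutative_unital
begin

definition sos_module :: "'a set \<Rightarrow> bool" where
  "sos_module Q \<longleftrightarrow> sos \<subseteq> Q \<and> (\<forall>x\<in>Q. self_adjoint x) \<and> (\<forall>x\<in>Q. \<forall>y\<in>Q. x + y \<in> Q) \<and>
     (\<forall>p\<in>sos. \<forall>x\<in>Q. p * x \<in> Q) \<and> - e \<notin> Q"

lemma sos_moduleD:
  assumes "sos_module Q"
  shows "p \<in> sos \<Longrightarrow> p \<in> Q" "x \<in> Q \<Longrightarrow> self_adjoint x" "x \<in> Q \<Longrightarrow> y \<in> Q \<Longrightarrow> x + y \<in> Q"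
    "p \<in> sos \<Longrightarrow> x \<in> Q \<Longrightarrow> p * x \<in> Q" "- e \<notin> Q"
  using assms by (auto simp: sos_module_def)

lemma scaleR_unit_in_sos: "r \<ge> 0 \<Longrightarrow> r *\<^sub>R e \<in> sos"
  by (rule sos_scaleR[OF unit_in_sos])

lemma sos_module_scaleR:
  assumes "sos_module Q" "x \<in> Q" "r \<ge> 0"
  shows "r *\<^sub>R x \<in> Q"
  using sos_moduleD(4)[OF assms(1) scaleR_unit_in_sos[OF assms(3)] assms(2)]
  by (simp add: unit)

lemma negative_notin_sos_module:
  assumes "sos_module Q" "r < 0"
  shows "r *\<^sub>R e \<notin> Q"
  using sos_module_scaleR[OF assms(1), of "r *\<^sub>R e" "- 1 / r"] sos_moduleD(5)[OF assms(1)] assms(2)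
  by auto

lemma maximal_sos_module_exists:
  assumes "sos_module Q0"
  obtains Q where "sos_module Q" "Q0 \<subseteq> Q" "\<And>Q'. sos_module Q' \<Longrightarrow> Q \<subseteq> Q' \<Longrightarrow> Q' = Q"
proof -
  define \<A> where "\<A> = {Q. sos_module Q \<and> Q0 \<subseteq> Q}"
  have "\<exists>M\<in>\<A>. \<forall>X\<in>\<A>. M \<subseteq> X \<longrightarrow> X = M"
  proof (rule subset_Zorn_nonempty)
    show "\<A> \<noteq> {}" using assms by (auto simp: \<A>_def)
    fix C assume C: "C \<noteq> {}" "subset.chain \<A> C"
    then have mem: "sos_module Q" "Q0 \<subseteq> Q" if "Q \<in> C" for Q
      using that by (auto simp: \<A>_def subset.chain_def)
    have plus: "x + y \<in> \<Union>C" if xy: "x \<in> \<Union>C" "y \<in> \<Union>C" for x y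
    proof -
      obtain Q R where QR: "Q \<in> C" "x \<in> Q" "R \<in> C" "y \<in> R" using xy by blast
      then have "Q \<subseteq> R \<or> R \<subseteq> Q" using C by (auto simp: subset.chain_def)
      then show ?thesis
      proof
        assume "Q \<subseteq> R"
        then have "x + y \<in> R" using QR sos_moduleD(3)[OF mem(1)[of R]] by blast
        then show ?thesis using QR by blast
      next
        assume "R \<subseteq> Q"
        then have "x + y \<in> Q" using QR sos_moduleD(3)[OF mem(1)[of Q]] by blast
        then show ?thesis using QR by blast
      qed
    qed
    obtain Q where "Q \<in> C" using C by blast
    then have sub: "sos \<subseteq> \<Union>C" "Q0 \<subseteq> \<Union>C"
      using mem sos_moduleD(1) by blast+
    have self_adjoint: "self_adjoint x" if "x \<in> \<Union>C" for x
      using that mem(1) sos_moduleD(2) by blast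
    have times: "p * x \<in> \<Union>C" if "p \<in> sos" "x \<in> \<Union>C" for x p
      using that mem(1) sos_moduleD(4) by blast
    have "- e \<notin> \<Union>C" using mem(1) sos_moduleD(5) by blast
    then have "sos_module (\<Union>C)"
      unfolding sos_module_def by (intro conjI ballI sub plus self_adjoint times)
    then show "\<Union>C \<in> \<A>" using sub by (simp add: \<A>_def)
  qed
  then obtain M where M: "M \<in> \<A>" "\<forall>X\<in>\<A>. M \<subseteq> X \<longrightarrow> X = M" by blast
  show ?thesis
  proof (rule that)
    show "sos_module M" "Q0 \<subseteq> M" using M(1) by (simp_all add: \<A>_def)
    fix Q' assume "sos_module Q'" "M \<subseteq> Q'"
    then have "Q' \<in> \<A>" using M(1) by (auto simp: \<A>_def)
    then show "Q' = M" using M(2) \<open>M \<subseteq> Q'\<close> by simp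
  qed
qed

lemma adjoin_to_sos_module:
  assumes Q: "sos_module Q" and x: "self_adjoint x"
    and nonneg: "\<And>q p. q \<in> Q \<Longrightarrow> p \<in> sos \<Longrightarrow> - e \<noteq> q + p * x"
  obtains Q' where "sos_module Q'" "Q \<subseteq> Q'" "x \<in> Q'"
proof
  let ?Q = "{q + p * x | q p. q \<in> Q \<and> p \<in> sos}"
  show sub: "Q \<subseteq> ?Q" using zero_in_sos by force
  have "0 \<in> Q" using sos_moduleD(1)[OF Q zero_in_sos] .
  then show "x \<in> ?Q" using unit_in_sos unit[of x] by force
  show "sos_module ?Q"
    unfolding sos_module_def
  proof (intro conjI ballI)
    show "sos \<subseteq> ?Q" using sub Q sos_moduleD(1) by blast
    show "- e \<notin> ?Q" using nonneg by auto
    show "self_adjoint y" if "y \<in> ?Q" for y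
      using that x sos_moduleD(2)[OF Q] self_adjoint_sos
      by (auto intro!: self_adjoint_intros(3) self_adjoint_mult)
  next
    fix y z assume "y \<in> ?Q" "z \<in> ?Q"
    then obtain q p q' p' where yz: "y = q + p * x" "q \<in> Q" "p \<in> sos" "z = q' + p' * x" "q' \<in> Q" "p' \<in> sos"
      by blast
    then have "y + z = (q + q') + (p + p') * x" by (simp add: algebra_simps)
    moreover have "q + q' \<in> Q" using yz sos_moduleD(3)[OF Q] by blast
    ultimately show "y + z \<in> ?Q" using yz sos.add by blast
  next
    fix r y :: 'a assume "r \<in> sos" "y \<in> ?Q"
    then obtain q p where y: "y = q + p * x" "q \<in> Q" "p \<in> sos" "r \<in> sos" by blast
    then have "r * y = r * q + (r * p) * x" by (simp add: distrib_left mult.assoc)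
    moreover have "r * q \<in> Q" using y sos_moduleD(4)[OF Q] by blast
    ultimately show "r * y \<in> ?Q" using y sos_mult by blast
  qed
qed

lemma self_adjoint_diff_sos:
  fixes y :: 'a
  assumes "self_adjoint y"
  obtains p q where "p \<in> sos" "q \<in> sos" "y = p - q"
  using that[of "(norm y + 1) *\<^sub>R e + y" "(norm y + 1) *\<^sub>R e"]
    bounded_in_sos(1)[OF assms, of "norm y + 1"] scaleR_unit_in_sos[of "norm y + 1"]
  by auto

text \<open>If neither sign of \<open>x\<close> can be adjoined, there are two representations of
  \<open>- e\<close>. Computing \<open>p' * (p * x)\<close> in two ways eliminates \<open>x\<close>
  and shows \<open>- p \<in> Q\<close>. Writing \<open>x = u - v\<close> with sums of squares turns
  \<open>p * x\<close> into \<open>u * p + v * (- p)\<close>, a member of \<open>Q\<close>, so the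
  first representation puts \<open>- e\<close> into \<open>Q\<close>.\<close>

lemma maximal_sos_module_total:
  assumes Q: "sos_module Q" and max: "\<And>Q'. sos_module Q' \<Longrightarrow> Q \<subseteq> Q' \<Longrightarrow> Q' = Q"
    and x: "self_adjoint x"
  shows "x \<in> Q \<or> - x \<in> Q"
proof (rule ccontr)
  assume no: "\<not> ?thesis"
  obtain q p where 1: "q \<in> Q" "p \<in> sos" "- e = q + p * x"
    using adjoin_to_sos_module[OF Q x] max no by metis
  obtain q' p' where 2: "q' \<in> Q" "p' \<in> sos" "- e = q' + p' * (- x)"
    using adjoin_to_sos_module[OF Q self_adjoint_intros(2)[OF x]] max no by metis
  have px: "p * x = - e - q" using 1(3) by (simp add: algebra_simps)
  have p'x: "p' * x = e + q'" using 2(3) by (simp add: algebra_simps)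
  have "p' * (p * x) = p * (p' * x)" by (rule left_comm)
  then have "- p = p' + p' * q + p * q'"
    unfolding px p'x by (simp add: distrib_left right_diff_distrib unit_right)
      (simp add: neg_eq_iff_add_eq_0 add_ac diff_eq_eq eq_diff_eq)
  then have mp: "- p \<in> Q"
    using 1 2 sos_moduleD[OF Q] by metis
  obtain u v where uv: "u \<in> sos" "v \<in> sos" "x = u - v" using self_adjoint_diff_sos[OF x] .
  have "- e = q + (u * p + v * (- p))" using 1(3) by (simp add: uv algebra_simps comm)
  moreover have "q + (u * p + v * (- p)) \<in> Q" using 1 mp uv sos_moduleD[OF Q] by metis
  ultimately show False using sos_moduleD(5)[OF Q] by metis
qed


text \<open>The self-adjoint part of the kernel of the future character. The slack
  \<open>\<epsilon>\<close> stands in for closedness of \<open>Q\<close> and lets a supremum be used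
  that need not be attained.\<close>

definition kernel_part :: "'a set \<Rightarrow> 'a set" where
  "kernel_part Q = {x. self_adjoint x \<and> (\<forall>\<epsilon>>0. \<epsilon> *\<^sub>R e + x \<in> Q \<and> \<epsilon> *\<^sub>R e - x \<in> Q)}"

lemma kernel_part_minus: "x \<in> kernel_part Q \<Longrightarrow> - x \<in> kernel_part Q"
  by (auto simp: kernel_part_def self_adjoint_intros)

lemma kernel_part_add:
  assumes Q: "sos_module Q" and "x \<in> kernel_part Q" "y \<in> kernel_part Q"
  shows "x + y \<in> kernel_part Q"
proof -
  have "\<epsilon> *\<^sub>R e + (x + y) \<in> Q \<and> \<epsilon> *\<^sub>R e - (x + y) \<in> Q" if "\<epsilon> > 0" for \<epsilon>
  proof -
    have h: "(\<epsilon>/2) *\<^sub>R e + x \<in> Q" "(\<epsilon>/2) *\<^sub>R e - x \<in> Q" "(\<epsilon>/2) *\<^sub>R e + y \<in> Q" "(\<epsilon>/2) *\<^sub>R e - y \<in> Q"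
      using assms(2,3) that half_gt_zero[of \<epsilon>] unfolding kernel_part_def by blast+
    have ee: "\<epsilon> *\<^sub>R e = (\<epsilon>/2) *\<^sub>R e + (\<epsilon>/2) *\<^sub>R e" by (simp flip: scaleR_add_left)
    show ?thesis
      using sos_moduleD(3)[OF Q h(1,3)] sos_moduleD(3)[OF Q h(2,4)]
      unfolding ee by (simp add: algebra_simps)
  qed
  then show ?thesis using assms(2,3) by (auto simp: kernel_part_def intro: self_adjoint_intros)
qed

text \<open>Multiplying \<open>(\<epsilon>/C) *\<^sub>R e + x\<close> by \<open>p\<close> replaces
  the slack by a multiple of \<open>p\<close>; the sum of squares \<open>C *\<^sub>R e - p\<close>
  restores a multiple of the unit.\<close>

lemma kernel_part_mult_sos:
  assumes Q: "sos_module Q" and x: "x \<in> kernel_part Q" and p: "p \<in> sos"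
  shows "p * x \<in> kernel_part Q"
proof -
  define C where "C = norm p + 1"
  have C: "C > 0" by (simp add: C_def add_nonneg_pos)
  have Cp: "C *\<^sub>R e - p \<in> sos"
    by (rule bounded_in_sos) (simp_all add: C_def self_adjoint_sos p)
  have "\<epsilon> *\<^sub>R e + p * x \<in> Q \<and> \<epsilon> *\<^sub>R e - p * x \<in> Q" if \<epsilon>: "\<epsilon> > 0" for \<epsilon>
  proof -
    have "(\<epsilon>/C) *\<^sub>R e + x \<in> Q" "(\<epsilon>/C) *\<^sub>R e - x \<in> Q"
      using x C \<epsilon> by (auto simp: kernel_part_def)
    then have h: "p * ((\<epsilon>/C) *\<^sub>R e + x) \<in> Q" "p * ((\<epsilon>/C) *\<^sub>R e - x) \<in> Q"
      using sos_moduleD(4)[OF Q p] by blast+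
    have k: "(\<epsilon>/C) *\<^sub>R (C *\<^sub>R e - p) \<in> Q"
      using C \<epsilon> by (intro sos_moduleD(1)[OF Q] sos_scaleR Cp) simp
    have "(\<epsilon>/C) *\<^sub>R (C *\<^sub>R e - p) + p * ((\<epsilon>/C) *\<^sub>R e + x) = \<epsilon> *\<^sub>R e + p * x"
      "(\<epsilon>/C) *\<^sub>R (C *\<^sub>R e - p) + p * ((\<epsilon>/C) *\<^sub>R e - x) = \<epsilon> *\<^sub>R e - p * x"
      using C by (simp_all add: scaleR_diff_right distrib_left right_diff_distrib unit_right)
    then show ?thesis using sos_moduleD(3)[OF Q k h(1)] sos_moduleD(3)[OF Q k h(2)] by simp
  qed
  then show ?thesis
    using x p by (auto simp: kernel_part_def intro: self_adjoint_mult self_adjoint_sos)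
qed

lemma kernel_part_mult:
  assumes Q: "sos_module Q" and x: "x \<in> kernel_part Q" and y: "self_adjoint y"
  shows "x * y \<in> kernel_part Q"
proof -
  obtain p q where pq: "p \<in> sos" "q \<in> sos" "y = p - q" using self_adjoint_diff_sos[OF y] .
  have "x * y = p * x + - (q * x)" by (simp add: pq right_diff_distrib comm)
  then show ?thesis
    using kernel_part_add[OF Q kernel_part_mult_sos[OF Q x pq(1)]
        kernel_part_minus[OF kernel_part_mult_sos[OF Q x pq(2)]]] by simp
qed

lemma unit_notin_kernel_part:
  assumes Q: "sos_module Q" shows "e \<notin> kernel_part Q"
proof
  assume "e \<in> kernel_part Q"
  then have "(1/2) *\<^sub>R e - e \<in> Q" unfolding kernel_part_def by force
  moreover have "(1/2) *\<^sub>R e - e = (-1/2) *\<^sub>R e"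
    using scaleR_diff_left[of "1/2" 1 e] by simp
  ultimately show False using negative_notin_sos_module[OF Q, of "-1/2"] by simp
qed

text \<open>A Dedekind cut: the reals \<open>r\<close> with \<open>x - r *\<^sub>R e \<in> Q\<close>
  are nonempty and bounded because the cone is Archimedean. Their supremum is the required value;
  totality of \<open>Q\<close> supplies the membership above the cut.\<close>

lemma scalar_mod_kernel_part:
  assumes Q: "sos_module Q" and total: "\<And>x. self_adjoint x \<Longrightarrow> x \<in> Q \<or> - x \<in> Q"
    and x: "self_adjoint x"
  shows "\<exists>r. x - r *\<^sub>R e \<in> kernel_part Q"
proof -
  define A where "A = {r. x - r *\<^sub>R e \<in> Q}"
  have b: "(norm x + 1) *\<^sub>R e + x \<in> Q" "(norm x + 1) *\<^sub>R e - x \<in> Q"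
    using bounded_in_sos[OF x, of "norm x + 1"] sos_moduleD(1)[OF Q] by auto
  have "- (norm x + 1) \<in> A" using b(1) by (simp add: A_def algebra_simps)
  then have ne: "A \<noteq> {}" by blast
  have "r \<le> norm x + 1" if "r \<in> A" for r
  proof (rule ccontr)
    assume "\<not> ?thesis"
    moreover have "(norm x + 1) *\<^sub>R e - x + (x - r *\<^sub>R e) \<in> Q"
      using that by (intro sos_moduleD(3)[OF Q b(2)]) (simp add: A_def)
    then have "(norm x + 1 - r) *\<^sub>R e \<in> Q" by (simp add: scaleR_diff_left)
    ultimately show False using negative_notin_sos_module[OF Q, of "norm x + 1 - r"] by simp
  qed
  then have bdd: "bdd_above A" by (meson bdd_aboveI)
  define s where "s = Sup A"
  have "\<epsilon> *\<^sub>R e + (x - s *\<^sub>R e) \<in> Q \<and> \<epsilon> *\<^sub>R e - (x - s *\<^sub>R e) \<in> Q" if \<epsilon>: "\<epsilon> > 0" for \<epsilon>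
  proof
    obtain r where r: "r \<in> A" "s - \<epsilon> < r"
      using less_cSup_iff[OF ne bdd, of "s - \<epsilon>"] \<epsilon> by (auto simp: s_def)
    have "(\<epsilon> + r - s) *\<^sub>R e + (x - r *\<^sub>R e) \<in> Q"
      using r by (intro sos_moduleD(3)[OF Q sos_moduleD(1)[OF Q scaleR_unit_in_sos]])
        (auto simp: A_def)
    then show "\<epsilon> *\<^sub>R e + (x - s *\<^sub>R e) \<in> Q" by (simp add: algebra_simps)
    have "s + \<epsilon> \<notin> A" using cSup_upper[OF _ bdd, of "s + \<epsilon>"] \<epsilon> by (auto simp: s_def)
    moreover have "self_adjoint (x - (s + \<epsilon>) *\<^sub>R e)"
      by (intro self_adjoint_intros x self_adjoint_unit)
    ultimately have "- (x - (s + \<epsilon>) *\<^sub>R e) \<in> Q" using total unfolding A_def by blast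
    then show "\<epsilon> *\<^sub>R e - (x - s *\<^sub>R e) \<in> Q" by (simp add: algebra_simps)
  qed
  moreover have "self_adjoint (x - s *\<^sub>R e)" by (intro self_adjoint_intros x self_adjoint_unit)
  ultimately show ?thesis by (auto simp: kernel_part_def)
qed

text \<open>The complexified \<open>kernel_part\<close> is a star-closed ideal that contains no
  nonzero multiple of \<open>e\<close>, and every element is a scalar modulo it. That unique scalar
  is therefore linear and multiplicative. Contractivity holds on self-adjoint elements because
  \<open>Q\<close> contains \<open>(norm x + d) *\<^sub>R e\<close> plus and minus \<open>x\<close>,
  and in general by applying this to \<open>star a * a\<close>.\<close>

lemma character_of_maximal_sos_module:
  assumes Q: "sos_module Q" and max: "\<And>Q'. sos_module Q' \<Longrightarrow> Q \<subseteq> Q' \<Longrightarrow> Q' = Q"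
  obtains \<phi> where "character \<phi>" "\<phi> e = 1" "\<And>x. x \<in> Q \<Longrightarrow> 0 \<le> Re (\<phi> x)"
proof -
  let ?J = "kernel_part Q"
  define I where "I = {x + \<i> *\<^sub>C y | x y. x \<in> ?J \<and> y \<in> ?J}"
  have I_add: "a + b \<in> I" if "a \<in> I" "b \<in> I" for a b
  proof -
    from that obtain x y u v where "x \<in> ?J" "y \<in> ?J" "u \<in> ?J" "v \<in> ?J"
      and ab: "a = x + \<i> *\<^sub>C y" "b = u + \<i> *\<^sub>C v" unfolding I_def by blast
    then have "x + u \<in> ?J" "y + v \<in> ?J" using kernel_part_add[OF Q] by blast+
    moreover have "a + b = (x + u) + \<i> *\<^sub>C (y + v)"
      by (simp add: ab scaleC_add_right algebra_simps)
    ultimately show ?thesis unfolding I_def by blast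
  qed
  have I_mult: "a * b \<in> I" if "a \<in> I" for a b
  proof -
    from that obtain x y where xy: "x \<in> ?J" "y \<in> ?J" and a: "a = x + \<i> *\<^sub>C y" unfolding I_def by blast
    let ?u = "re_part b" and ?v = "im_part b"
    have "x * ?u + - (y * ?v) \<in> ?J" "x * ?v + y * ?u \<in> ?J"
      by (intro kernel_part_add[OF Q] kernel_part_minus kernel_part_mult[OF Q]
          self_adjoint_parts xy)+
    moreover have "a * (?u + \<i> *\<^sub>C ?v) = (x * ?u + - (y * ?v)) + \<i> *\<^sub>C (x * ?v + y * ?u)"
      by (simp add: a distrib_left distrib_right mult_scaleC_left mult_scaleC_right scaleC_scaleC
          scaleC_add_right scaleC_minus_left scaleC_one algebra_simps)
    ultimately show ?thesis unfolding I_def parts_decomp[of b, symmetric] by blast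
  qed
  have I_self_adjoint: "a \<in> ?J" if "a \<in> I" "self_adjoint a" for a
  proof -
    from that obtain x y where xy: "x \<in> ?J" "y \<in> ?J" and a: "a = x + \<i> *\<^sub>C y" unfolding I_def by blast
    then have "star a = x - \<i> *\<^sub>C y"
      by (auto simp: kernel_part_def self_adjoint_def star_add star_scaleC scaleC_minus_left)
    then have "a = x - \<i> *\<^sub>C y" using that by (simp add: self_adjoint_def)
    then have "a + a = x + x" by (metis a add.commute add.left_commute diff_add_cancel)
    then have "2 *\<^sub>R a = 2 *\<^sub>R x" by (simp add: scaleR_2)
    then show ?thesis using xy by simp
  qed
  have I_scaleC: "\<alpha> *\<^sub>C a \<in> I" if "a \<in> I" for \<alpha> a
    using I_mult[OF that, of "\<alpha> *\<^sub>C e"] by (simp add: mult_scaleC_right unit_right)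
  have I_diff: "a - b \<in> I" if "a \<in> I" "b \<in> I" for a b
    using I_add[OF that(1) I_scaleC[OF that(2), of "- 1"]] by (simp add: scaleC_minus_left scaleC_one)
  have I_star: "star a \<in> I" if "a \<in> I" for a
  proof -
    from that obtain x y where xy: "x \<in> ?J" "y \<in> ?J" and a: "a = x + \<i> *\<^sub>C y" unfolding I_def by blast
    then have "star a = x + (- \<i>) *\<^sub>C y"
      by (auto simp: kernel_part_def self_adjoint_def star_add star_scaleC)
    also have "\<dots> = x + \<i> *\<^sub>C (- y)"
      using scaleC_diff_right[of \<i> 0 y] scaleC_diff_right[of \<i> 0 0] by (simp add: scaleC_minus_left)
    finally show ?thesis unfolding I_def using xy kernel_part_minus by blast
  qed
  have I_scalar: "\<alpha> = 0" if "\<alpha> *\<^sub>C e \<in> I" for \<alpha>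
  proof (rule ccontr)
    assume "\<alpha> \<noteq> 0"
    then have "e \<in> I" using I_scaleC[OF that, of "1 / \<alpha>"] by (simp add: scaleC_scaleC scaleC_one)
    then show False using I_self_adjoint self_adjoint_unit unit_notin_kernel_part[OF Q] by blast
  qed
  have total: "\<And>x. self_adjoint x \<Longrightarrow> x \<in> Q \<or> - x \<in> Q"
    using maximal_sos_module_total[OF Q max] by blast
  have "\<exists>\<mu>. a - \<mu> *\<^sub>C e \<in> I" for a
  proof -
    obtain r s where "re_part a - r *\<^sub>R e \<in> ?J" "im_part a - s *\<^sub>R e \<in> ?J"
      using scalar_mod_kernel_part[OF Q total] self_adjoint_parts by metis
    moreover have "(re_part a + \<i> *\<^sub>C im_part a) - Complex r s *\<^sub>C e
        = (re_part a - r *\<^sub>R e) + \<i> *\<^sub>C (im_part a - s *\<^sub>R e)"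
      by (simp add: Complex_eq scaleC_add_left scaleC_diff_right scaleR_scaleC scaleC_scaleC)
    ultimately show ?thesis unfolding I_def parts_decomp[of a, symmetric] by blast
  qed
  then obtain \<phi> where \<phi>: "\<And>a. a - \<phi> a *\<^sub>C e \<in> I" by metis
  have \<phi>_eq: "\<phi> a = \<mu>" if "a - \<mu> *\<^sub>C e \<in> I" for a \<mu>
  proof -
    have "(\<mu> - \<phi> a) *\<^sub>C e = (a - \<phi> a *\<^sub>C e) - (a - \<mu> *\<^sub>C e)"
      using scaleC_add_left[of "\<mu> - \<phi> a" "\<phi> a" e] by (simp add: algebra_simps)
    also have "\<dots> \<in> I" by (rule I_diff[OF \<phi> that])
    finally have "\<mu> - \<phi> a = 0" by (rule I_scalar)
    then show ?thesis by simp
  qed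
  have add: "\<phi> (a + b) = \<phi> a + \<phi> b" for a b
  proof (rule \<phi>_eq)
    have eq: "a + b - (\<phi> a + \<phi> b) *\<^sub>C e = (a - \<phi> a *\<^sub>C e) + (b - \<phi> b *\<^sub>C e)"
      by (simp add: scaleC_add_left algebra_simps)
    show "a + b - (\<phi> a + \<phi> b) *\<^sub>C e \<in> I"
      unfolding eq by (rule I_add[OF \<phi> \<phi>])
  qed
  have scaleC: "\<phi> (\<alpha> *\<^sub>C a) = \<alpha> * \<phi> a" for \<alpha> a
    by (rule \<phi>_eq)
      (use I_scaleC[OF \<phi>[of a], of \<alpha>] in \<open>simp add: scaleC_diff_right scaleC_scaleC\<close>)
  have mult: "\<phi> (a * b) = \<phi> a * \<phi> b" for a b
  proof (rule \<phi>_eq)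
    have "a * b - (\<phi> a * \<phi> b) *\<^sub>C e = (a - \<phi> a *\<^sub>C e) * b + \<phi> a *\<^sub>C (b - \<phi> b *\<^sub>C e)"
      by (simp add: left_diff_distrib mult_scaleC_left unit scaleC_diff_right scaleC_scaleC)
    then show "a * b - (\<phi> a * \<phi> b) *\<^sub>C e \<in> I"
      using I_add[OF I_mult[OF \<phi>[of a], of b] I_scaleC[OF \<phi>[of b], of "\<phi> a"]] by simp
  qed
  have star: "\<phi> (star a) = cnj (\<phi> a)" for a
    by (rule \<phi>_eq)
      (use I_star[OF \<phi>[of a]] self_adjoint_unit in \<open>simp add: star_diff star_scaleC self_adjoint_def\<close>)
  have unit1: "\<phi> e = 1"
    by (rule \<phi>_eq) (use I_diff[OF \<phi>[of e] \<phi>[of e]] in \<open>simp add: scaleC_one\<close>)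
  have real: "\<phi> x = complex_of_real (Re (\<phi> x))" if "self_adjoint x" for x
    using star[of x] that by (simp add: self_adjoint_def complex_eq_iff)
  have pos: "0 \<le> Re (\<phi> x)" if x: "x \<in> Q" for x
  proof (rule ccontr)
    assume neg: "\<not> ?thesis"
    let ?r = "Re (\<phi> x)"
    have sx: "self_adjoint x" using x sos_moduleD(2)[OF Q] by blast
    have "x - ?r *\<^sub>R e \<in> I"
      using \<phi>[of x] real[OF sx] by (metis scaleR_scaleC)
    then have "x - ?r *\<^sub>R e \<in> ?J"
      using I_self_adjoint by (simp add: self_adjoint_intros self_adjoint_unit sx)
    \<comment> \<open>The slack is positive since \<open>?r\<close> is negative, and half of
      \<open>- ?r\<close> is small enough that adding \<open>x\<close> leaves a negative multiple of
      the unit.\<close>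
    then have "(- ?r / 2) *\<^sub>R e - (x - ?r *\<^sub>R e) \<in> Q"
      using neg unfolding kernel_part_def by (simp only: mem_Collect_eq)
    then have "(- ?r / 2) *\<^sub>R e - (x - ?r *\<^sub>R e) + x \<in> Q" using x sos_moduleD(3)[OF Q] by blast
    moreover have "(- ?r / 2) *\<^sub>R e - (x - ?r *\<^sub>R e) + x = (?r / 2) *\<^sub>R e"
      using scaleR_add_left[of "- ?r / 2" ?r e] by (simp add: algebra_simps)
    ultimately show False using negative_notin_sos_module[OF Q, of "?r / 2"] neg by simp
  qed
  have scaleR: "\<phi> (r *\<^sub>R x) = r * \<phi> x" for r x by (simp add: scaleR_scaleC scaleC)
  have diff: "\<phi> (a - b) = \<phi> a - \<phi> b" for a b using add[of "a - b" b] by simp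
  have bound_self_adjoint: "\<bar>Re (\<phi> x)\<bar> \<le> norm x" if x: "self_adjoint x" for x
  proof (rule field_le_epsilon)
    fix d :: real assume "d > 0"
    then have "(norm x + d) *\<^sub>R e + x \<in> Q" "(norm x + d) *\<^sub>R e - x \<in> Q"
      using bounded_in_sos[OF x, of "norm x + d"] sos_moduleD(1)[OF Q] by auto
    from pos[OF this(1)] pos[OF this(2)] show "\<bar>Re (\<phi> x)\<bar> \<le> norm x + d"
      by (simp add: add scaleR unit1 diff)
  qed
  have "cmod (\<phi> a) \<le> norm a" for a
  proof -
    have "\<phi> (star a * a) = complex_of_real ((cmod (\<phi> a))\<^sup>2)"
      unfolding mult star by (metis complex_norm_square mult.commute)
    then have "(cmod (\<phi> a))\<^sup>2 \<le> norm (star a * a)"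
      using bound_self_adjoint[of "star a * a"] by (simp add: self_adjoint_def star_mult star_star)
    then show ?thesis unfolding cstar_identity by (rule power2_le_imp_le) simp
  qed
  then have "character \<phi>" unfolding character_def using add scaleC mult star by blast
  then show ?thesis using unit1 pos by (rule that)
qed

text \<open>If the bound \<open>norm a\<close> cannot be lowered in the order from one side, then
  \<open>a - norm a *\<^sub>R e\<close> or its counterpart for \<open>- a\<close> can be adjoined to
  \<open>sos\<close>, and the resulting character takes the value \<open>norm a\<close> at
  \<open>a\<close> or at \<open>- a\<close>. If it can be lowered from both sides,
  \<open>norm_le_if_sos\<close> gives a norm below \<open>norm a\<close>.\<close>

lemma character_attains_norm:
  assumes a: "self_adjoint a"
  obtains \<phi> where "character \<phi>" "\<phi> e = 1" "cmod (\<phi> a) = norm a"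
proof -
  have *: thesis
    if a: "self_adjoint a" and no: "\<And>\<epsilon>. \<epsilon> > 0 \<Longrightarrow> (norm a - \<epsilon>) *\<^sub>R e - a \<notin> sos"
      and thesis: "\<And>\<phi>. character \<phi> \<Longrightarrow> \<phi> e = 1 \<Longrightarrow> Re (\<phi> a) = norm a \<Longrightarrow> thesis" for a thesis
  proof -
    define y where "y = norm a *\<^sub>R e - a"
    have y: "self_adjoint y" unfolding y_def by (intro self_adjoint_intros self_adjoint_unit a)
    have yd: "y + d *\<^sub>R e \<in> sos" if "d > 0" for d
      using bounded_in_sos(2)[OF a, of "norm a + d"] that by (simp add: y_def algebra_simps)
    have sos: "sos_module sos"
      using minus_unit_notin_sos
      by (auto simp: sos_module_def intro: sos.add sos_mult self_adjoint_sos)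
    have "- e \<noteq> p + p' * (- y)" if p: "p \<in> sos" "p' \<in> sos" for p p'
    proof
      assume "- e = p + p' * (- y)"
      then have p'y: "p' * y = e + p" by (simp add: algebra_simps)
      \<comment> \<open>Here \<open>C *\<^sub>R e - p'\<close> is a sum of squares. Its product with
        \<open>y\<close> plus slack \<open>1 / (2 * C)\<close> contains
        \<open>- p' * y = - e - p\<close>. The slack contributes only half a unit, so
        \<open>C *\<^sub>R y\<close> minus half a unit is a sum of squares and the bound
        \<open>norm a\<close> drops by \<open>1 / (2 * C)\<close>.\<close>
      define C where "C = norm p' + 1"
      have C: "C > 0" by (simp add: C_def add_nonneg_pos)
      have "(C *\<^sub>R e - p') * (y + (1 / (2 * C)) *\<^sub>R e) \<in> sos"
        using C by (intro sos_mult yd bounded_in_sos self_adjoint_sos p) (simp_all add: C_def)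
      then have "(C *\<^sub>R e - p') * (y + (1 / (2 * C)) *\<^sub>R e) + p + (1 / (2 * C)) *\<^sub>R p' \<in> sos"
        using C p by (intro sos.add sos_scaleR) auto
      moreover have "(C *\<^sub>R e - p') * (y + (1 / (2 * C)) *\<^sub>R e) + p + (1 / (2 * C)) *\<^sub>R p'
        = C *\<^sub>R y + (1/2) *\<^sub>R e - e"
        using C by (simp add: distrib_left left_diff_distrib p'y unit unit_right scaleR_diff_right)
      ultimately have "(1 / C) *\<^sub>R (C *\<^sub>R y + (1/2) *\<^sub>R e - e) \<in> sos"
        using C by (intro sos_scaleR) auto
      moreover have "(1 / C) *\<^sub>R (C *\<^sub>R y + (1/2) *\<^sub>R e - e) = (norm a - 1 / (2 * C)) *\<^sub>R e - a"
        using C scaleR_left_diff_distrib[of "1 / (2 * C)" "1 / C" e]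
        by (simp add: y_def scaleR_diff_right scaleR_add_right algebra_simps)
      ultimately show False using no[of "1 / (2 * C)"] C by simp
    qed
    then obtain Q0 where Q0: "sos_module Q0" "- y \<in> Q0"
      using adjoin_to_sos_module[OF sos self_adjoint_intros(2)[OF y]] by metis
    then obtain Q where Q: "sos_module Q" "Q0 \<subseteq> Q" "\<And>Q'. sos_module Q' \<Longrightarrow> Q \<subseteq> Q' \<Longrightarrow> Q' = Q"
      using maximal_sos_module_exists by metis
    obtain \<phi> where \<phi>: "character \<phi>" "\<phi> e = 1" "\<And>x. x \<in> Q \<Longrightarrow> 0 \<le> Re (\<phi> x)"
      using character_of_maximal_sos_module[OF Q(1,3)] by metis
    have "- y = a + complex_of_real (- norm a) *\<^sub>C e"
      by (simp add: y_def scaleR_scaleC scaleC_minus_left)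
    then have "\<phi> (- y) = \<phi> a - norm a" using \<phi>(1,2) by (simp add: character_def)
    then have "norm a \<le> Re (\<phi> a)" using \<phi>(3)[of "- y"] Q Q0 by auto
    moreover have "cmod (\<phi> a) \<le> norm a" using \<phi>(1) by (simp add: character_def)
    ultimately show thesis using thesis[OF \<phi>(1,2)] complex_Re_le_cmod[of "\<phi> a"] by simp
  qed
  have up: "(norm a - \<epsilon>) *\<^sub>R e + x \<in> sos" if "(norm a - \<delta>) *\<^sub>R e + x \<in> sos" "\<epsilon> \<le> \<delta>" for \<epsilon> \<delta> x
  proof -
    have eq: "(norm a - \<epsilon>) *\<^sub>R e + x = ((norm a - \<delta>) *\<^sub>R e + x) + (\<delta> - \<epsilon>) *\<^sub>R e"
      by (simp add: algebra_simps)
    show ?thesis unfolding eq using that by (intro sos.add[OF that(1)] scaleR_unit_in_sos) auto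
  qed
  consider "\<forall>\<epsilon>>0. (norm a - \<epsilon>) *\<^sub>R e - a \<notin> sos" | "\<forall>\<epsilon>>0. (norm a - \<epsilon>) *\<^sub>R e + a \<notin> sos"
    | \<epsilon> \<delta> where "\<epsilon> > 0" "(norm a - \<epsilon>) *\<^sub>R e - a \<in> sos" "\<delta> > 0" "(norm a - \<delta>) *\<^sub>R e + a \<in> sos"
    by blast
  then show ?thesis
  proof cases
    case 1
    show ?thesis
    proof (rule *[OF a])
      fix \<phi> assume h: "character \<phi>" "\<phi> e = 1" "Re (\<phi> a) = norm a"
      have "cmod (\<phi> a) = norm a"
        using h complex_Re_le_cmod[of "\<phi> a"] by (intro antisym) (auto simp: character_def)
      then show ?thesis using that[of \<phi>] h by blast
    qed (use 1 in blast)
  next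
    case 2
    show ?thesis
    proof (rule *[OF self_adjoint_intros(2)[OF a]])
      fix \<phi> assume h: "character \<phi>" "\<phi> e = 1" "Re (\<phi> (- a)) = norm (- a)"
      have "\<phi> (- a) = - \<phi> a"
        using h(1) scaleC_minus_left[of 1 a] unfolding character_def by (metis scaleC_one mult_minus1)
      then have "cmod (\<phi> a) = norm a"
        using h complex_Re_le_cmod[of "- \<phi> a"] by (intro antisym) (auto simp: character_def)
      then show ?thesis using that[of \<phi>] h by blast
    qed (use 2 in auto)
  next
    case 3
    have "norm a \<le> norm a - min \<epsilon> \<delta>"
      using up[of \<epsilon> "- a" "min \<epsilon> \<delta>"] up[of \<delta> a "min \<epsilon> \<delta>"] 3 by (intro norm_le_if_sos a) auto
    then show ?thesis using 3 by simp
  qed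
qed

end

section \<open>Gelfand duality\<close>

text \<open>The adjoined unit is new even if the algebra is unital or zero, so it is never 0 and no
  case distinction arises.\<close>

lemma commutative_unital_unitization:
  assumes "commutative TYPE('a::cstar_algebra)"
  shows "commutative_unital (Unitize (0::'a) 1)"
  using assms
  by unfold_locales
    (auto simp: commutative_def times_unitization_def zero_unitization_def scaleC_one scaleC_zero_left
      scaleC_zero_right algebra_simps split: unitization.split intro: unitization.expand)

lemma norm_Unitize_zero: "norm (Unitize (a::'a::cstar_algebra) 0) = norm a"
  using onorm_pos_le[OF bounded_linear_unit_act, of "Unitize a 0"]
  by (simp add: norm_unitization_def norm_alg_part_onorm)

text \<open>A character of the unitization is restricted to the algebra, whose embedding is
  isometric. Passing to \<open>star a * a\<close> gives a self-adjoint element and squares both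
  sides. The restriction may be the zero functional, but then \<open>a = 0\<close>.\<close>

lemma exists_character_norm:
  assumes "commutative TYPE('a::cstar_algebra)"
  obtains \<phi> where "character \<phi>" "cmod (\<phi> (a::'a)) = norm a"
proof -
  interpret commutative_unital "Unitize (0::'a) 1"
    by (rule commutative_unital_unitization[OF assms])
  have "self_adjoint (Unitize (star a * a) 0)"
    by (simp add: self_adjoint_def star_unitization_def star_mult star_star)
  then obtain \<psi> where \<psi>: "character \<psi>" "cmod (\<psi> (Unitize (star a * a) 0)) = norm (star a * a)"
    using character_attains_norm norm_Unitize_zero by metis
  define \<phi> where "\<phi> b = \<psi> (Unitize b 0)" for b :: 'a
  have ops: "Unitize (x + y) 0 = Unitize x 0 + Unitize y 0"
    "Unitize (\<alpha> *\<^sub>C x) 0 = \<alpha> *\<^sub>C Unitize x 0" "Unitize (x * y) 0 = Unitize x 0 * Unitize y 0"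
    "Unitize (star x) 0 = star (Unitize x 0)" for x y :: 'a and \<alpha>
    by (simp_all add: unitization_ops scaleC_unitization_def star_unitization_def scaleC_zero_left)
  have \<phi>: "character \<phi>"
    using \<psi>(1) unfolding character_def \<phi>_def ops by (metis norm_Unitize_zero)
  moreover have "(cmod (\<phi> a))\<^sup>2 = (norm a)\<^sup>2"
    using \<psi>(2) \<phi> unfolding \<phi>_def[of "star a * a", symmetric]
    by (simp add: character_def norm_mult cstar_identity power2_eq_square)
  then have "cmod (\<phi> a) = norm a" by simp
  ultimately show ?thesis by (rule that)
qed

lemma Hausdorff_space_fun: "Hausdorff_space (euclidean :: ('a \<Rightarrow> 'b::metric_space) topology)"
  by (simp add: Hausdorff_space_product_topology flip: euclidean_product_topology)

lemma compact_imp_closed_fun: "compact K \<Longrightarrow> closed (K :: ('a \<Rightarrow> 'b::metric_space) set)"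
  using compactin_imp_closedin[OF Hausdorff_space_fun, of K] by simp

text \<open>The library makes function types Hausdorff only for countable domains, and Stone--Weierstrass
  is stated for Hausdorff types; this copy of the function type carries the product topology.\<close>

datatype 'a functional = Functional (apply_functional: "'a \<Rightarrow> complex")

instantiation functional :: (type) t2_space
begin

definition open_functional :: "'a functional set \<Rightarrow> bool" where
  "open_functional U \<longleftrightarrow> open (Functional -` U)"

instance
proof
  show "open (UNIV :: 'a functional set)" by (simp add: open_functional_def)
  show "open (S \<inter> T)" if "open S" "open T" for S T :: "'a functional set"
    using that by (simp add: open_functional_def vimage_Int open_Int)
  show "open (\<Union>K)" if "\<forall>S\<in>K. open S" for K :: "'a functional set set"
    using that by (simp add: open_functional_def vimage_Union open_UN)
  fix f g :: "'a functional" assume "f \<noteq> g"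
  then have "apply_functional f \<noteq> apply_functional g" by (metis functional.expand)
  then obtain U V where UV: "open U" "open V" "apply_functional f \<in> U" "apply_functional g \<in> V" "disjnt U V"
    using Hausdorff_space_fun unfolding Hausdorff_space_def by force
  have vim: "Functional -` (apply_functional -` W) = W" for W :: "('a \<Rightarrow> complex) set" by auto
  show "\<exists>U V. open U \<and> open V \<and> f \<in> U \<and> g \<in> V \<and> U \<inter> V = {}"
    using UV by (intro exI[of _ "apply_functional -` U"] exI[of _ "apply_functional -` V"])
      (auto simp: open_functional_def vim disjnt_def)
qed

end

lemma continuous_on_Functional: "continuous_on S Functional"
proof -
  have "continuous_on UNIV Functional"
    unfolding continuous_on_open_vimage[OF open_UNIV] by (simp add: open_functional_def)
  then show ?thesis by (rule continuous_on_subset) simp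
qed

lemma continuous_on_apply_functional: "continuous_on S apply_functional"
proof -
  have "Functional -` (apply_functional -` W) = W" for W :: "('a \<Rightarrow> complex) set" by auto
  then have "continuous_on UNIV (apply_functional :: 'a functional \<Rightarrow> _)"
    unfolding continuous_on_open_vimage[OF open_UNIV] by (simp add: open_functional_def)
  then show ?thesis by (rule continuous_on_subset) simp
qed

lemma continuous_on_apply: "continuous_on S (\<lambda>\<phi>::'a \<Rightarrow> 'b::topological_space. \<phi> a)"
  by (rule continuous_on_subset[OF continuous_on_product_coordinates subset_UNIV])

text \<open>Banach-Alaoglu: a closed subset of a product of discs, compact by Tychonoff. The zero
  functional has to stay in the set, since nonzero characters can converge to it.\<close>

lemma compact_characters: "compact {\<phi>::'a::cstar_algebra \<Rightarrow> complex. character \<phi>}"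
proof -
  have "compactin (product_topology (\<lambda>_::'a. euclidean) UNIV) (PiE UNIV (\<lambda>a. cball (0::complex) (norm a)))"
    by (simp add: compactin_PiE)
  then have "compact (PiE UNIV (\<lambda>a::'a. cball (0::complex) (norm a)))"
    by (simp add: euclidean_product_topology)
  moreover have "closed {\<phi>::'a \<Rightarrow> complex. character \<phi>}"
    unfolding character_def
    by (intro closed_Collect_conj closed_Collect_all closed_Collect_eq closed_Collect_le
        continuous_intros continuous_on_apply)
  ultimately have "compact (PiE UNIV (\<lambda>a::'a. cball (0::complex) (norm a)) \<inter> {\<phi>. character \<phi>})"
    by (rule compact_Int_closed)
  moreover have "{\<phi>::'a \<Rightarrow> complex. character \<phi>} \<subseteq> PiE UNIV (\<lambda>a. cball 0 (norm a))"
    by (auto simp: character_def)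
  ultimately show ?thesis by (simp add: Int_absorb1)
qed

lemma character_zero: "character (\<lambda>_. 0)"
  by (simp add: character_def)

lemma character_diff: "character \<phi> \<Longrightarrow> \<phi> (a - b) = \<phi> a - \<phi> b"
  unfolding character_def by (metis add_diff_cancel diff_add_cancel)

lemma character_zero_right: "character \<phi> \<Longrightarrow> \<phi> 0 = 0"
  using character_diff[of \<phi> 0 0] by simp

lemma character_self_adjoint:
  "character \<phi> \<Longrightarrow> self_adjoint a \<Longrightarrow> \<phi> a = complex_of_real (Re (\<phi> a))"
  unfolding character_def self_adjoint_def by (metis Reals_cnj_iff complex_is_Real_iff of_real_Re)

lemma character_scaleR: "character \<phi> \<Longrightarrow> \<phi> (r *\<^sub>R a) = complex_of_real r * \<phi> a"
  by (simp add: character_def scaleR_scaleC)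

section \<open>The character space and the Gelfand transform\<close>

definition character_space :: "('a::cstar_algebra \<Rightarrow> complex) topology" where
  "character_space = top_of_set ({\<phi>. character \<phi>} - {\<lambda>_. 0})"

text \<open>The value 0 away from characters follows the convention of \<open>C0\<close>; at the
  zero functional it is automatic.\<close>

definition gelfand :: "'a::cstar_algebra \<Rightarrow> ('a \<Rightarrow> complex) \<Rightarrow> complex" where
  "gelfand a \<phi> = (if character \<phi> then \<phi> a else 0)"

lemma topspace_character_space:
  "topspace character_space = {\<phi>::'a::cstar_algebra \<Rightarrow> complex. character \<phi>} - {\<lambda>_. 0}"
  by (simp add: character_space_def)

lemma Hausdorff_character_space: "Hausdorff_space character_space"
  unfolding character_space_def by (intro Hausdorff_space_subtopology Hausdorff_space_fun)

lemma locally_compact_character_space: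
  "locally_compact_space (character_space :: ('a::cstar_algebra \<Rightarrow> complex) topology)"
proof -
  let ?K = "{\<phi>::'a \<Rightarrow> complex. character \<phi>}"
  have "locally_compact_space (subtopology (top_of_set ?K) (?K - {\<lambda>_. 0}))"
  proof (rule locally_compact_space_open_subset)
    show "Hausdorff_space (top_of_set ?K) \<or> regular_space (top_of_set ?K)"
      by (simp add: Hausdorff_space_fun Hausdorff_space_subtopology)
    show "locally_compact_space (top_of_set ?K)"
      by (intro compact_imp_locally_compact_space compact_space_subtopology) (simp add: compact_characters)
    show "openin (top_of_set ?K) (?K - {\<lambda>_. 0})"
      by (intro openin_diff openin_subtopology_refl[THEN iffD2] closedin_Hausdorff_singleton)
        (auto simp: character_zero Hausdorff_space_fun Hausdorff_space_subtopology)
  qed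
  then show ?thesis by (simp add: character_space_def subtopology_subtopology Int_absorb1)
qed

lemma gelfand_C0: "gelfand a \<in> C0 character_space"
proof -
  let ?S = "{\<phi>. character \<phi>} - {\<lambda>_. 0}"
  have "continuous_on ?S (gelfand a)"
    using continuous_on_apply[of ?S a] by (rule continuous_on_eq) (simp add: gelfand_def)
  moreover have "compactin character_space {\<phi> \<in> topspace character_space. \<epsilon> \<le> cmod (gelfand a \<phi>)}"
    if "\<epsilon> > 0" for \<epsilon>
  proof -
    have "closed {\<phi>. \<epsilon> \<le> cmod (\<phi> a)}"
      by (intro closed_Collect_le continuous_intros continuous_on_apply)
    then have "compact ({\<phi>. character \<phi>} \<inter> {\<phi>. \<epsilon> \<le> cmod (\<phi> a)})"
      by (intro compact_Int_closed compact_characters)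
    moreover have "{\<phi> \<in> topspace character_space. \<epsilon> \<le> cmod (gelfand a \<phi>)}
        = {\<phi>. character \<phi>} \<inter> {\<phi>. \<epsilon> \<le> cmod (\<phi> a)}"
      using that by (auto simp: topspace_character_space gelfand_def)
    ultimately show ?thesis
      using that by (auto simp: character_space_def compactin_subtopology)
  qed
  ultimately show ?thesis
    by (auto simp: C0_def character_space_def gelfand_def)
qed

lemma norm_eq_Sup_gelfand:
  assumes "commutative TYPE('a::cstar_algebra)"
  shows "norm (a::'a) = Sup (insert 0 ((\<lambda>\<phi>. cmod (gelfand a \<phi>)) ` topspace character_space))"
proof (rule sym, rule cSup_eq_maximum)
  obtain \<phi> where \<phi>: "character \<phi>" "cmod (\<phi> a) = norm a" using exists_character_norm[OF assms] .
  show "norm a \<in> insert 0 ((\<lambda>\<phi>. cmod (gelfand a \<phi>)) ` topspace character_space)"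
  proof (cases "\<phi> = (\<lambda>_. 0)")
    case False
    then have "\<phi> \<in> topspace character_space" using \<phi> by (simp add: topspace_character_space)
    moreover have "norm a = cmod (gelfand a \<phi>)" using \<phi> by (simp add: gelfand_def)
    ultimately show ?thesis by blast
  qed (use \<phi> in auto)
qed (auto simp: gelfand_def character_def)

text \<open>The characters including zero form a compactification by a point at infinity, where the
  extended function is 0. Continuity there holds because the sets
  \<open>\<epsilon> \<le> cmod (f \<phi>)\<close> are compact, hence closed, and omit the zero
  functional.\<close>

lemma C0_character_space_continuous_on:
  assumes f: "f \<in> C0 (character_space :: ('a::cstar_algebra \<Rightarrow> complex) topology)"
  shows "continuous_on {\<phi>. character \<phi>} f"
proof -
  let ?K = "{\<phi>::'a \<Rightarrow> complex. character \<phi>}" and ?z = "(\<lambda>_. 0) :: 'a \<Rightarrow> complex"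
  have c: "continuous_on (?K - {?z}) f" and z: "f ?z = 0"
    and cp: "\<And>\<epsilon>. \<epsilon> > 0 \<Longrightarrow> compact {\<phi> \<in> ?K - {?z}. \<epsilon> \<le> cmod (f \<phi>)}"
    using f by (auto simp: C0_def character_space_def compactin_subtopology)
  show ?thesis
    unfolding continuous_on_def
  proof
    fix \<phi> assume \<phi>: "\<phi> \<in> ?K"
    show "(f \<longlongrightarrow> f \<phi>) (at \<phi> within ?K)"
    proof (cases "\<phi> = ?z")
      case True
      show ?thesis
        unfolding True z tendsto_iff
      proof (intro allI impI)
        fix \<epsilon> :: real assume "\<epsilon> > 0"
        let ?U = "- {\<phi> \<in> ?K - {?z}. \<epsilon> \<le> cmod (f \<phi>)}"
        have "open ?U" using compact_imp_closed_fun[OF cp[OF \<open>\<epsilon> > 0\<close>]] by (simp add: open_Compl)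
        moreover have "?z \<in> ?U" by simp
        ultimately show "\<forall>\<^sub>F \<psi> in at ?z within ?K. dist (f \<psi>) 0 < \<epsilon>"
          unfolding eventually_at_topological by (intro exI[of _ ?U]) auto
      qed
    next
      case False
      have "at \<phi> within ?K = at \<phi> within (?K - {?z})"
        by (rule at_within_nhd[of _ "- {?z}"])
          (use False compact_imp_closed_fun[of "{?z}"] in \<open>auto simp: open_Compl\<close>)
      then show ?thesis using c \<phi> False by (simp add: continuous_on_def)
    qed
  qed
qed

section \<open>Surjectivity of the Gelfand transform by Stone-Weierstrass\<close>

lemma characters_separated:
  assumes ch: "character \<phi>" "character \<psi>" and "\<phi> \<noteq> \<psi>"
  obtains b where "self_adjoint b" "\<phi> b \<noteq> \<psi> b"
proof -
  obtain a where "\<phi> a \<noteq> \<psi> a" using \<open>\<phi> \<noteq> \<psi>\<close> by auto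
  moreover have "\<zeta> a = \<zeta> (re_part a) + \<i> * \<zeta> (im_part a)" if "character \<zeta>" for \<zeta>
    using that parts_decomp[of a] unfolding character_def by metis
  ultimately show ?thesis using that ch self_adjoint_parts by metis
qed

lemma real_approximation_by_characters:
  fixes f :: "('a::cstar_algebra \<Rightarrow> complex) \<Rightarrow> real"
  assumes comm: "commutative TYPE('a)" and f: "continuous_on {\<phi>. character \<phi>} f" and z: "f (\<lambda>_. 0) = 0"
    and "\<epsilon> > 0"
  shows "\<exists>a. \<forall>\<phi>. character \<phi> \<longrightarrow> cmod (complex_of_real (f \<phi>) - \<phi> a) < \<epsilon>"
proof -
  let ?K = "{\<phi>::'a \<Rightarrow> complex. character \<phi>}"
  let ?app = "apply_functional :: 'a functional \<Rightarrow> 'a \<Rightarrow> complex"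
  \<comment> \<open>The constant \<open>c\<close> makes this an algebra containing the constants, as
    Stone-Weierstrass demands; it is removed at the end. Only values on characters are
    prescribed.\<close>
  define P where "P h \<longleftrightarrow> (\<exists>a c. self_adjoint a \<and>
    (\<forall>\<phi>\<in>?K. h (Functional \<phi>) = Re (\<phi> a) + c))" for h
  have "\<exists>g. P g \<and> (\<forall>\<theta>\<in>Functional ` ?K. \<bar>f (?app \<theta>) - g \<theta>\<bar> < \<epsilon> / 2)"
  proof (rule Stone_Weierstrass_HOL)
    show "compact (Functional ` ?K)"
      by (rule compact_continuous_image[OF continuous_on_Functional compact_characters])
    show "continuous_on (Functional ` ?K) (\<lambda>\<theta>. f (?app \<theta>))"
      by (rule continuous_on_compose2[OF f continuous_on_apply_functional]) auto
    show "P (\<lambda>_. c)" for c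
      unfolding P_def by (intro exI[of _ 0] exI[of _ c]) (simp add: self_adjoint_intros character_zero_right)
    show "continuous_on (Functional ` ?K) h" if "P h" for h
    proof -
      obtain a c where h: "\<forall>\<phi>\<in>?K. h (Functional \<phi>) = Re (\<phi> a) + c"
        using \<open>P h\<close> unfolding P_def by blast
      have "continuous_on (Functional ` ?K) (\<lambda>\<theta>. ?app \<theta> a)"
        by (rule continuous_on_product_then_coordinatewise[OF continuous_on_apply_functional])
      then have "continuous_on (Functional ` ?K) (\<lambda>\<theta>. Re (?app \<theta> a) + c)"
        by (intro continuous_on_add continuous_on_Re continuous_on_const)
      then show ?thesis by (rule continuous_on_eq) (use h in auto)
    qed
    show "P (\<lambda>\<theta>. h \<theta> + k \<theta>)" "P (\<lambda>\<theta>. h \<theta> * k \<theta>)" if hk: "P h \<and> P k" for h k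
    proof -
      obtain a c where a: "self_adjoint a"
        and h: "\<And>\<phi>. \<phi> \<in> ?K \<Longrightarrow> h (Functional \<phi>) = Re (\<phi> a) + c"
        using hk unfolding P_def by blast
      obtain b d where b: "self_adjoint b"
        and k: "\<And>\<phi>. \<phi> \<in> ?K \<Longrightarrow> k (Functional \<phi>) = Re (\<phi> b) + d"
        using hk unfolding P_def by blast
      note ab = a b
      show "P (\<lambda>\<theta>. h \<theta> + k \<theta>)"
        unfolding P_def using ab
        by (intro exI[of _ "a + b"] exI[of _ "c + d"]) (auto simp: h k character_def self_adjoint_intros)
      have "h (Functional \<phi>) * k (Functional \<phi>) = Re (\<phi> (a * b + d *\<^sub>R a + c *\<^sub>R b)) + c * d" if "\<phi> \<in> ?K" for \<phi>
      proof -
        have \<phi>: "character \<phi>" using that by simp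
        have "Re (\<phi> (a * b)) = Re (\<phi> a) * Re (\<phi> b)"
          using character_self_adjoint[OF \<phi> ab(1)] character_self_adjoint[OF \<phi> ab(2)] \<phi>
          by (simp add: character_def complex_eq_iff)
        moreover have "\<phi> (a * b + d *\<^sub>R a + c *\<^sub>R b) = \<phi> (a * b) + d * \<phi> a + c * \<phi> b"
          using \<phi> character_scaleR[OF \<phi>] by (simp add: character_def)
        ultimately show ?thesis using that by (simp add: h k algebra_simps)
      qed
      moreover have "self_adjoint (a * b + d *\<^sub>R a + c *\<^sub>R b)"
        using comm by (intro self_adjoint_intros ab) (simp add: commutative_def)
      ultimately show "P (\<lambda>\<theta>. h \<theta> * k \<theta>)" unfolding P_def by blast
    qed
    show "\<exists>h. P h \<and> h \<theta> \<noteq> h \<eta>"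
      if th: "\<theta> \<in> Functional ` ?K \<and> \<eta> \<in> Functional ` ?K \<and> \<theta> \<noteq> \<eta>" for \<theta> \<eta>
    proof -
      obtain \<phi> \<psi> where ch: "character \<phi>" "character \<psi>"
        and eqs: "\<theta> = Functional \<phi>" "\<eta> = Functional \<psi>" "\<phi> \<noteq> \<psi>" using th by blast
      obtain b where b: "self_adjoint b" "\<phi> b \<noteq> \<psi> b" using characters_separated[OF ch eqs(3)] .
      then have "Re (\<phi> b) \<noteq> Re (\<psi> b)"
        using character_self_adjoint[OF ch(1) b(1)] character_self_adjoint[OF ch(2) b(1)] by metis
      moreover have "P (\<lambda>\<theta>. Re (?app \<theta> b))" unfolding P_def using b by (intro exI[of _ b] exI[of _ 0]) auto
      ultimately show ?thesis unfolding eqs by (intro exI[of _ "\<lambda>\<theta>. Re (?app \<theta> b)"]) simp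
    qed
  qed (use \<open>\<epsilon> > 0\<close> in auto)
  then obtain a c where a: "self_adjoint a" and c: "\<And>\<phi>. \<phi> \<in> ?K \<Longrightarrow> \<bar>f \<phi> - (Re (\<phi> a) + c)\<bar> < \<epsilon> / 2"
    unfolding P_def by force
  \<comment> \<open>At the zero functional both \<open>f\<close> and the contribution of
    \<open>a\<close> vanish, so \<open>c\<close> is itself the error there and dropping it costs at
    most another \<open>\<epsilon> / 2\<close>.\<close>
  have "\<bar>c\<bar> < \<epsilon> / 2" using c[of "\<lambda>_. 0"] z by (simp add: character_zero)
  then have "cmod (complex_of_real (f \<phi>) - \<phi> a) < \<epsilon>" if "character \<phi>" for \<phi>
  proof -
    have "cmod (complex_of_real (f \<phi>) - \<phi> a) = cmod (complex_of_real (f \<phi> - Re (\<phi> a)))"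
      using character_self_adjoint[OF that a] by simp
    also have "\<dots> = \<bar>f \<phi> - Re (\<phi> a)\<bar>" by (rule norm_of_real)
    finally show ?thesis using c[of \<phi>] that \<open>\<bar>c\<bar> < \<epsilon> / 2\<close> by (simp add: abs_if split: if_splits)
  qed
  then show ?thesis by blast
qed

lemma approximation_by_gelfand:
  fixes f :: "('a::cstar_algebra \<Rightarrow> complex) \<Rightarrow> complex"
  assumes comm: "commutative TYPE('a)" and f: "f \<in> C0 character_space" and "\<epsilon> > 0"
  shows "\<exists>a. \<forall>\<phi>. character \<phi> \<longrightarrow> cmod (f \<phi> - \<phi> a) < \<epsilon>"
proof -
  have c: "continuous_on {\<phi>. character \<phi>} f" by (rule C0_character_space_continuous_on[OF f])
  have z: "f (\<lambda>_. 0) = 0" using f by (simp add: C0_def topspace_character_space)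
  obtain a where a: "\<And>\<phi>. character \<phi> \<Longrightarrow> cmod (complex_of_real (Re (f \<phi>)) - \<phi> a) < \<epsilon> / 2"
    using real_approximation_by_characters[OF comm, of "\<lambda>\<phi>. Re (f \<phi>)" "\<epsilon> / 2"] c z \<open>\<epsilon> > 0\<close>
    by (auto intro: continuous_on_Re)
  obtain b where b: "\<And>\<phi>. character \<phi> \<Longrightarrow> cmod (complex_of_real (Im (f \<phi>)) - \<phi> b) < \<epsilon> / 2"
    using real_approximation_by_characters[OF comm, of "\<lambda>\<phi>. Im (f \<phi>)" "\<epsilon> / 2"] c z \<open>\<epsilon> > 0\<close>
    by (auto intro: continuous_on_Im)
  have "cmod (f \<phi> - \<phi> (a + \<i> *\<^sub>C b)) < \<epsilon>" if "character \<phi>" for \<phi>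
  proof -
    have "f \<phi> - \<phi> (a + \<i> *\<^sub>C b) = (Re (f \<phi>) - \<phi> a) + \<i> * (Im (f \<phi>) - \<phi> b)"
      using that complex_eq[of "f \<phi>"] by (simp add: character_def algebra_simps)
    then have "cmod (f \<phi> - \<phi> (a + \<i> *\<^sub>C b)) \<le> cmod (Re (f \<phi>) - \<phi> a) + cmod (Im (f \<phi>) - \<phi> b)"
      using norm_triangle_ineq[of "Re (f \<phi>) - \<phi> a" "\<i> * (Im (f \<phi>) - \<phi> b)"] by (simp add: norm_mult)
    then show ?thesis using a[OF that] b[OF that] by linarith
  qed
  then show ?thesis by blast
qed

text \<open>Uniform approximants of \<open>f\<close> form a Cauchy sequence in the algebra, because
  the norm of a difference is attained at some character.\<close>

lemma gelfand_surj:
  fixes f :: "('a::cstar_algebra \<Rightarrow> complex) \<Rightarrow> complex"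
  assumes comm: "commutative TYPE('a)" and f: "f \<in> C0 character_space"
  shows "\<exists>a. f = gelfand a"
proof -
  have "\<exists>a. \<forall>\<phi>. character \<phi> \<longrightarrow> cmod (f \<phi> - \<phi> a) < inverse (real (Suc n))" for n
    by (intro approximation_by_gelfand comm f) simp
  then obtain X where X: "\<And>n \<phi>. character \<phi> \<Longrightarrow> cmod (f \<phi> - \<phi> (X n)) < inverse (real (Suc n))"
    by metis
  have "Cauchy X"
  proof (rule CauchyI)
    fix e :: real assume "e > 0"
    then obtain N where N: "inverse (real (Suc N)) < e / 2" using reals_Archimedean[of "e / 2"] by auto
    have "norm (X m - X n) < e" if mn: "m \<ge> N" "n \<ge> N" for m n
    proof -
      obtain \<phi> where \<phi>: "character \<phi>" "cmod (\<phi> (X m - X n)) = norm (X m - X n)"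
        using exists_character_norm[OF comm] .
      have le: "inverse (real (Suc k)) \<le> inverse (real (Suc N))" if "k \<ge> N" for k
        using that by (simp add: field_simps)
      have "\<phi> (X m - X n) = (f \<phi> - \<phi> (X n)) - (f \<phi> - \<phi> (X m))"
        by (simp add: character_diff[OF \<phi>(1)])
      then have "norm (X m - X n) \<le> cmod (f \<phi> - \<phi> (X n)) + cmod (f \<phi> - \<phi> (X m))"
        using norm_triangle_ineq4 \<phi>(2) by metis
      then show ?thesis using X[OF \<phi>(1), of n] X[OF \<phi>(1), of m] le[OF mn(1)] le[OF mn(2)] N by linarith
    qed
    then show "\<exists>M. \<forall>m\<ge>M. \<forall>n\<ge>M. norm (X m - X n) < e" by blast
  qed
  then obtain a where a: "X \<longlonglongrightarrow> a" using Cauchy_convergent convergent_def by blast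
  have "f \<phi> = \<phi> a" if \<phi>: "character \<phi>" for \<phi>
  proof -
    have 1: "(\<lambda>n. \<phi> (X n) - f \<phi>) \<longlonglongrightarrow> 0"
    proof (rule Lim_null_comparison[OF always_eventually LIMSEQ_inverse_real_of_nat])
      show "\<forall>n. cmod (\<phi> (X n) - f \<phi>) \<le> inverse (real (Suc n))"
        using X[OF \<phi>] by (metis less_eq_real_def norm_minus_commute)
    qed
    have 2: "(\<lambda>n. \<phi> (X n) - \<phi> a) \<longlonglongrightarrow> 0"
    proof (rule Lim_null_comparison[OF always_eventually])
      show "\<forall>n. cmod (\<phi> (X n) - \<phi> a) \<le> norm (X n - a)"
        using \<phi> character_diff[OF \<phi>] unfolding character_def by metis
      show "(\<lambda>n. norm (X n - a)) \<longlonglongrightarrow> 0" using a by (simp add: LIM_zero tendsto_norm_zero)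
    qed
    show ?thesis by (rule LIMSEQ_unique[OF LIM_zero_cancel[OF 1] LIM_zero_cancel[OF 2]])
  qed
  moreover have "f \<phi> = 0" if "\<not> character \<phi>" for \<phi>
    using f that by (simp add: C0_def topspace_character_space)
  ultimately have "f = gelfand a" by (auto simp: gelfand_def)
  then show ?thesis ..
qed

theorem iso_C0_gelfand:
  assumes comm: "commutative TYPE('a::cstar_algebra)"
  shows "iso_C0 (gelfand :: 'a \<Rightarrow> _) character_space"
proof -
  have "inj (gelfand :: 'a \<Rightarrow> _)"
  proof (rule injI)
    fix a b :: 'a assume ab: "gelfand a = gelfand b"
    obtain \<phi> where \<phi>: "character \<phi>" "cmod (\<phi> (a - b)) = norm (a - b)"
      using exists_character_norm[OF comm] .
    have "\<phi> a = \<phi> b" using fun_cong[OF ab, of \<phi>] \<phi> by (simp add: gelfand_def)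
    then show "a = b" using \<phi> by (simp add: character_diff)
  qed
  moreover have "range (gelfand :: 'a \<Rightarrow> _) = C0 character_space"
    using gelfand_C0 gelfand_surj[OF comm] by blast
  ultimately have "bij_betw (gelfand :: 'a \<Rightarrow> _) UNIV (C0 character_space)"
    by (simp add: bij_betw_def)
  then show ?thesis
    unfolding iso_C0_def
    by (intro conjI allI norm_eq_Sup_gelfand[OF comm]) (auto simp: gelfand_def character_def)
qed

corollary is_spectrum_character_space:
  "commutative TYPE('a::cstar_algebra) \<Longrightarrow> is_spectrum TYPE('a) (character_space :: ('a \<Rightarrow> complex) topology)"
  using iso_C0_gelfand[where 'a = 'a] unfolding is_spectrum_def
  by (auto simp: locally_compact_character_space Hausdorff_character_space)

section \<open>Generator rank zero\<close>

text \<open>The infimum 0 is attained, since the empty set would give infinity; for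
  \<open>n = 0\<close> the families consist of one element.\<close>

lemma gr0_eq_0_iff:
  "gr0 TYPE('a::cstar_algebra) = 0 \<longleftrightarrow> (\<forall>(a::'a) \<epsilon> c. self_adjoint a \<longrightarrow> \<epsilon> > 0 \<longrightarrow>
     (\<exists>b. self_adjoint b \<and> norm (b - a) < \<epsilon> \<and> (\<exists>g\<in>cstar_generated {b}. norm (c - g) < \<epsilon>)))"
    (is "_ \<longleftrightarrow> ?rhs")
proof -
  define P :: "nat \<Rightarrow> bool" where "P n \<longleftrightarrow> (\<forall>(a::nat \<Rightarrow> 'a) (\<epsilon>::real) (c::'a).
     (\<forall>j\<le>n. self_adjoint (a j)) \<longrightarrow> \<epsilon> > 0 \<longrightarrow>
     (\<exists>b. (\<forall>j\<le>n. self_adjoint (b j) \<and> norm (b j - a j) < \<epsilon>) \<and>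
          (\<exists>g\<in>cstar_generated (b ` {..n}). norm (c - g) < \<epsilon>)))" for n
  have gr0: "gr0 TYPE('a) = Inf {enat n | n. P n}" by (simp add: gr0_def P_def)
  have "gr0 TYPE('a) = 0 \<longleftrightarrow> P 0"
  proof
    assume 0: "gr0 TYPE('a) = 0"
    then have ne: "{enat n | n. P n} \<noteq> {}" unfolding gr0 by (metis Inf_enat_def infinity_ne_i0)
    then have "Inf {enat n | n. P n} \<in> {enat n | n. P n}"
      unfolding Inf_enat_def by (simp only: if_False) (meson LeastI ex_in_conv)
    then show "P 0" using 0 unfolding gr0 by (auto simp: zero_enat_def)
  next
    assume "P 0"
    then have "Inf {enat n | n. P n} \<le> enat 0" by (intro Inf_lower) blast
    then show "gr0 TYPE('a) = 0" unfolding gr0 by (simp add: zero_enat_def[symmetric])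
  qed
  also have "P 0 \<longleftrightarrow> ?rhs"
  proof
    assume P: "P 0"
    show ?rhs
    proof (intro allI impI)
      fix a :: 'a and \<epsilon> :: real and c :: 'a assume "self_adjoint a" "\<epsilon> > 0"
      then obtain b where "self_adjoint (b 0) \<and> norm (b 0 - a) < \<epsilon>"
        "\<exists>g\<in>cstar_generated (b ` {..0::nat}). norm (c - g) < \<epsilon>"
        using P[unfolded P_def, rule_format, of "\<lambda>_. a" \<epsilon> c] by auto
      then show "\<exists>b. self_adjoint b \<and> norm (b - a) < \<epsilon> \<and> (\<exists>g\<in>cstar_generated {b}. norm (c - g) < \<epsilon>)"
        by (intro exI[of _ "b 0"]) simp
    qed
  next
    assume R: ?rhs
    show "P 0"
      unfolding P_def
    proof (intro allI impI)
      fix a :: "nat \<Rightarrow> 'a" and \<epsilon> :: real and c :: 'a assume "\<forall>j\<le>0. self_adjoint (a j)" "\<epsilon> > 0"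
      then obtain b where "self_adjoint b" "norm (b - a 0) < \<epsilon>" "\<exists>g\<in>cstar_generated {b}. norm (c - g) < \<epsilon>"
        using R[rule_format, of "a 0" \<epsilon> c] by auto
      then show "\<exists>b. (\<forall>j\<le>0. self_adjoint (b j) \<and> norm (b j - a j) < \<epsilon>) \<and>
          (\<exists>g\<in>cstar_generated (b ` {..0::nat}). norm (c - g) < \<epsilon>)"
        by (intro exI[of _ "\<lambda>_. b"]) simp
    qed
  qed
  finally show ?thesis .
qed

section \<open>Commutativity from normality\<close>

lemma cstar_generated_subset: "S \<subseteq> B \<Longrightarrow> cstar_subalgebra B \<Longrightarrow> cstar_generated S \<subseteq> B"
  unfolding cstar_generated_def by (rule hull_minimal)

lemma subset_cstar_generated: "S \<subseteq> cstar_generated S"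
  unfolding cstar_generated_def by (rule hull_subset)

lemma cstar_subalgebra_generated: "cstar_subalgebra (cstar_generated S)"
  unfolding cstar_generated_def
proof (rule hull_in)
  fix T :: "'a set set" assume T: "Ball T cstar_subalgebra"
  then have "closed (\<Inter>T)" by (intro closed_Inter) (auto simp: cstar_subalgebra_def)
  then show "cstar_subalgebra (\<Inter>T)" using T by (auto simp: cstar_subalgebra_def)
qed

lemma cstar_subalgebraD:
  assumes "cstar_subalgebra B"
  shows "0 \<in> B" "x \<in> B \<Longrightarrow> y \<in> B \<Longrightarrow> x + y \<in> B" "x \<in> B \<Longrightarrow> y \<in> B \<Longrightarrow> x * y \<in> B"
    "x \<in> B \<Longrightarrow> \<alpha> *\<^sub>C x \<in> B" "x \<in> B \<Longrightarrow> r *\<^sub>R x \<in> B" "x \<in> B \<Longrightarrow> y \<in> B \<Longrightarrow> x - y \<in> B"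
proof -
  show *: "0 \<in> B" "x \<in> B \<Longrightarrow> y \<in> B \<Longrightarrow> x + y \<in> B" "x \<in> B \<Longrightarrow> y \<in> B \<Longrightarrow> x * y \<in> B"
    "x \<in> B \<Longrightarrow> \<alpha> *\<^sub>C x \<in> B" "x \<in> B \<Longrightarrow> r *\<^sub>R x \<in> B" for x y \<alpha> r
    using assms by (auto simp: cstar_subalgebra_def scaleR_scaleC)
  show "x \<in> B \<Longrightarrow> y \<in> B \<Longrightarrow> x - y \<in> B"
    using *(2)[of x "(-1) *\<^sub>R y"] *(5)[of y "-1"] by simp
qed

text \<open>Commuting with both \<open>g\<close> and \<open>star g\<close> is what makes the
  commutant closed under \<open>star\<close>.\<close>

lemma cstar_subalgebra_commutant: "cstar_subalgebra {x::'a::cstar_algebra. x * g = g * x \<and> x * star g = star g * x}"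
proof -
  have "closed {x. x * g = g * x \<and> x * star g = star g * x}"
    by (intro closed_Collect_conj closed_Collect_eq continuous_on_mult continuous_on_const
        continuous_on_id)
  moreover have "star x * g = g * star x \<and> star x * star g = star g * star x"
    if "x * g = g * x" "x * star g = star g * x" for x
    using that by (metis star_mult star_star)
  moreover have "x * y * z = z * (x * y)" if "x * z = z * x" "y * z = z * y" for x y z :: 'a
    using that by (metis mult.assoc)
  ultimately show ?thesis
    unfolding cstar_subalgebra_def
    by (simp add: distrib_left distrib_right mult_scaleC_left mult_scaleC_right)
qed

text \<open>A double commutant argument: the generated algebra commutes with \<open>b\<close>, so
  \<open>b\<close> lies in the commutant of \<open>g\<close> and \<open>star g\<close>. That
  commutant then contains the generated algebra, in particular \<open>g\<close>.\<close>

lemma normal_if_generated_by_self_adjoint: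
  assumes b: "self_adjoint b" and g: "g \<in> cstar_generated {b}"
  shows "g * star g = star g * g"
proof -
  have "cstar_generated {b} \<subseteq> {x. x * b = b * x \<and> x * star b = star b * x}"
    using b by (intro cstar_generated_subset cstar_subalgebra_commutant) (auto simp: self_adjoint_def)
  then have bg: "g * b = b * g" using g by auto
  then have "star g * b = b * star g" using b by (metis self_adjoint_def star_mult)
  then have "cstar_generated {b} \<subseteq> {x. x * g = g * x \<and> x * star g = star g * x}"
    using bg by (intro cstar_generated_subset cstar_subalgebra_commutant) auto
  then show ?thesis using g by auto
qed

lemma gr0_zero_imp_commutative:
  assumes "gr0 TYPE('a::cstar_algebra) = 0"
  shows "commutative TYPE('a)"
proof -
  have normal: "c * star c = star c * c" for c :: 'a
  proof -
    have "closed {c::'a. c * star c = star c * c}"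
      by (intro closed_Collect_eq continuous_intros)
    moreover have "c \<in> closure {c::'a. c * star c = star c * c}"
      unfolding closure_approachable
    proof (intro allI impI)
      fix e :: real assume "e > 0"
      then obtain b g where "self_adjoint b" "g \<in> cstar_generated {b}" "norm (c - g) < e"
        using assms[unfolded gr0_eq_0_iff, rule_format, of 0 e c] self_adjoint_intros(1) by blast
      then show "\<exists>y\<in>{c. c * star c = star c * c}. dist y c < e"
        using normal_if_generated_by_self_adjoint
        by (intro bexI[of _ g]) (auto simp: dist_norm norm_minus_commute)
    qed
    ultimately show ?thesis by (simp add: closure_closed)
  qed
  have sa: "x * y = y * x" if "self_adjoint x" "self_adjoint y" for x y :: 'a
  proof -
    \<comment> \<open>Normality of \<open>x + \<i> *\<^sub>C y\<close> is equivalent to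
      \<open>x\<close> and \<open>y\<close> commuting: the commutator of \<open>c\<close> and
      \<open>star c\<close> is a nonzero multiple of theirs.\<close>
    define c where "c = x + \<i> *\<^sub>C y"
    have sc: "star c = x - \<i> *\<^sub>C y"
      using that by (simp add: c_def star_add star_scaleC self_adjoint_def scaleC_minus_left)
    have "c * star c - star c * c = (2 * \<i>) *\<^sub>C (y * x - x * y)"
      unfolding sc scaleC_add_left[of \<i> \<i>, folded mult_2]
      by (simp add: c_def distrib_left distrib_right left_diff_distrib right_diff_distrib
          mult_scaleC_left mult_scaleC_right scaleC_diff_right
          scaleC_add_right)
    then have "norm ((2 * \<i>) *\<^sub>C (y * x - x * y)) = 0" using normal[of c] by simp
    then show ?thesis by (simp add: norm_scaleC)
  qed
  have "a * b = b * a" for a b :: 'a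
  proof -
    let ?x = "re_part a" and ?y = "im_part a" and ?u = "re_part b" and ?v = "im_part b"
    have "(?x + \<i> *\<^sub>C ?y) * (?u + \<i> *\<^sub>C ?v) = (?u + \<i> *\<^sub>C ?v) * (?x + \<i> *\<^sub>C ?y)"
      by (simp add: distrib_left distrib_right mult_scaleC_left mult_scaleC_right scaleC_add_right
          sa[OF self_adjoint_parts(1) self_adjoint_parts(1)] sa[OF self_adjoint_parts(2) self_adjoint_parts(2)]
          sa[OF self_adjoint_parts(1) self_adjoint_parts(2)] add_ac)
    then show ?thesis by (simp flip: parts_decomp)
  qed
  then show ?thesis by (simp add: commutative_def)
qed

section \<open>Point evaluations and total disconnectedness\<close>

lemma bounded_linear_character: "character \<phi> \<Longrightarrow> bounded_linear \<phi>"
  by (rule bounded_linear_intro[where K = 1])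
    (simp_all add: character_def scaleR_scaleC scaleR_conv_of_real)

lemma cstar_subalgebra_kernel:
  assumes "character \<phi>" shows "cstar_subalgebra {g. \<phi> g = 0}"
proof -
  have "closed {g. \<phi> g = 0}"
    by (intro closed_Collect_eq continuous_on_const
        bounded_linear.continuous_on[OF bounded_linear_character[OF assms] continuous_on_id])
  then show ?thesis
    using assms by (auto simp: cstar_subalgebra_def character_zero_right) (auto simp: character_def)
qed

lemma C0_bounded:
  assumes "f \<in> C0 X" shows "bdd_above ((\<lambda>x. cmod (f x)) ` topspace X)"
proof -
  have "compactin X {x \<in> topspace X. 1 \<le> cmod (f x)}" "continuous_map X euclidean f"
    using assms by (auto simp: C0_def)
  then have "compact (f ` {x \<in> topspace X. 1 \<le> cmod (f x)})"
    by (metis compactin_euclidean_iff image_compactin)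
  then obtain B where B: "\<And>x. x \<in> topspace X \<Longrightarrow> 1 \<le> cmod (f x) \<Longrightarrow> cmod (f x) \<le> B"
    using compact_imp_bounded bounded_iff by (metis (mono_tags, lifting) image_eqI mem_Collect_eq)
  show ?thesis
  proof (rule bdd_aboveI2)
    show "cmod (f x) \<le> max 1 B" if "x \<in> topspace X" for x
      using B[OF that] by linarith
  qed
qed

text \<open>Points of any spectrum act as characters, so the facts about characters apply to an
  arbitrary isomorphism and not just to the Gelfand transform.\<close>

lemma iso_C0_character:
  fixes \<Phi> :: "'a::cstar_algebra \<Rightarrow> 'x \<Rightarrow> complex"
  assumes \<Phi>: "iso_C0 \<Phi> X" and x: "x \<in> topspace X"
  shows "character (\<lambda>a. \<Phi> a x)"
proof -
  have "cmod (\<Phi> a x) \<le> norm a" for a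
  proof -
    have "\<Phi> a \<in> C0 X" using \<Phi> by (auto simp: iso_C0_def bij_betw_def)
    then have "bdd_above (insert 0 ((\<lambda>x. cmod (\<Phi> a x)) ` topspace X))"
      using C0_bounded by (metis bdd_above_insert)
    then have "cmod (\<Phi> a x) \<le> Sup (insert 0 ((\<lambda>x. cmod (\<Phi> a x)) ` topspace X))"
      using x by (intro cSup_upper) auto
    also have "\<dots> = norm a" using \<Phi> unfolding iso_C0_def by metis
    finally show ?thesis .
  qed
  then show ?thesis using \<Phi> by (simp add: iso_C0_def character_def)
qed

lemma iso_C0_norm_le:
  fixes \<Phi> :: "'a::cstar_algebra \<Rightarrow> 'x \<Rightarrow> complex"
  assumes \<Phi>: "iso_C0 \<Phi> X" and "\<And>x. x \<in> topspace X \<Longrightarrow> cmod (\<Phi> a x) \<le> r" "0 \<le> r"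
  shows "norm a \<le> r"
proof -
  have "norm a = Sup (insert 0 ((\<lambda>x. cmod (\<Phi> a x)) ` topspace X))"
    using \<Phi> unfolding iso_C0_def by blast
  also have "\<dots> \<le> r" using assms(2,3) by (intro cSup_least) auto
  finally show ?thesis .
qed

lemma iso_C0_eqI:
  fixes \<Phi> :: "'a::cstar_algebra \<Rightarrow> 'x \<Rightarrow> complex"
  assumes \<Phi>: "iso_C0 \<Phi> X" and eq: "\<And>x. x \<in> topspace X \<Longrightarrow> \<Phi> a x = \<Phi> b x"
  shows "a = b"
proof -
  have "norm (a - b) \<le> 0"
    using eq by (intro iso_C0_norm_le[OF \<Phi>]) (auto simp: character_diff[OF iso_C0_character[OF \<Phi>]])
  then show ?thesis by simp
qed

lemma iso_C0_continuous:
  "iso_C0 \<Phi> X \<Longrightarrow> continuous_map X euclidean (\<Phi> a)"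
  "iso_C0 \<Phi> X \<Longrightarrow> \<epsilon> > 0 \<Longrightarrow> compactin X {x \<in> topspace X. \<epsilon> \<le> cmod (\<Phi> a x)}"
  by (auto simp: iso_C0_def bij_betw_def C0_def)

text \<open>Perturb \<open>h / 2 - h\<^sup>2\<close>, which is \<open>1/16\<close> where \<open>h = 1/4\<close> and negative where \<open>h = 1\<close>, to a
  generator \<open>b\<close>. Then \<open>b\<close> has no zero where \<open>h \<ge> 1/4\<close>, since \<open>h\<close> is close to an element of the
  algebra generated by \<open>b\<close>, so the part of \<open>h \<ge> 1/4\<close> on which \<open>b\<close> is negative is clopen.\<close>

lemma clopen_separation:
  fixes \<Phi> :: "'a::cstar_algebra \<Rightarrow> 'x \<Rightarrow> complex"
  assumes gr: "gr0 TYPE('a) = 0" and \<Phi>: "iso_C0 \<Phi> X" and h: "self_adjoint h"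
    and x: "x \<in> topspace X" "\<Phi> h x = 1" and y: "\<Phi> h y = 0"
  shows "\<exists>U. openin X U \<and> closedin X U \<and> x \<in> U \<and> y \<notin> U"
proof -
  define a where "a = (1/2) *\<^sub>R h - h * h"
  have "self_adjoint a" unfolding a_def by (intro self_adjoint_intros h) simp
  then obtain b g where b: "self_adjoint b" "norm (b - a) < 1/32" and g: "g \<in> cstar_generated {b}" "norm (h - g) < 1/32"
    using gr[unfolded gr0_eq_0_iff, rule_format, of a "1/32" h] by auto
  have ab: "\<bar>Re (\<Phi> b p) - (Re (\<Phi> h p) / 2 - Re (\<Phi> h p) * Re (\<Phi> h p))\<bar> < 1/32" if "p \<in> topspace X" for p
  proof -
    note ch = iso_C0_character[OF \<Phi> that]
    have "Re (\<Phi> (b - a) p) = Re (\<Phi> b p) - Re (\<Phi> a p)" by (simp add: character_diff[OF ch])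
    moreover have "Im (\<Phi> h p) = 0" using character_self_adjoint[OF ch h] by (metis Im_complex_of_real)
    then have "Re (\<Phi> a p) = Re (\<Phi> h p) / 2 - Re (\<Phi> h p) * Re (\<Phi> h p)"
      using ch unfolding a_def
      by (simp add: character_diff[OF ch] character_scaleR[OF ch]) (simp add: character_def)
    moreover have "cmod (\<Phi> (b - a) p) \<le> norm (b - a)" using ch by (simp add: character_def)
    ultimately show ?thesis using b(2) abs_Re_le_cmod[of "\<Phi> (b - a) p"] by linarith
  qed
  have no_zero: "Re (\<Phi> b p) \<noteq> 0" if p: "p \<in> topspace X" and "1/4 \<le> Re (\<Phi> h p)" for p
  proof
    note ch = iso_C0_character[OF \<Phi> p]
    assume "Re (\<Phi> b p) = 0"
    then have "\<Phi> b p = 0" using character_self_adjoint[OF ch b(1)] by simp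
    then have "cstar_generated {b} \<subseteq> {g. \<Phi> g p = 0}"
      by (intro cstar_generated_subset cstar_subalgebra_kernel[OF ch]) auto
    then have "\<Phi> (h - g) p = \<Phi> h p" using g(1) by (auto simp: character_diff[OF ch])
    moreover have "cmod (\<Phi> (h - g) p) \<le> norm (h - g)" using ch by (simp add: character_def)
    ultimately show False using g(2) complex_Re_le_cmod[of "\<Phi> h p"] that by simp
  qed
  \<comment> \<open>An open and a closed description of one set. They could differ only where
    \<open>h = 1/4\<close> or \<open>b = 0\<close>. In the first case
    \<open>h / 2 - h\<^sup>2 = 1/16\<close>, so \<open>b > 1/32\<close>, contradicting
    \<open>Re (\<Phi> b p) \<le> 0\<close>; the second is excluded by
    \<open>no_zero\<close>.\<close>
  let ?U = "{p \<in> topspace X. \<Phi> h p \<in> {z. 1/4 < Re z}} \<inter> {p \<in> topspace X. \<Phi> b p \<in> {z. Re z < 0}}"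
  let ?V = "{p \<in> topspace X. \<Phi> h p \<in> {z. 1/4 \<le> Re z}} \<inter> {p \<in> topspace X. \<Phi> b p \<in> {z. Re z \<le> 0}}"
  have op: "openin X ?U"
    by (intro openin_Int openin_continuous_map_preimage[OF iso_C0_continuous(1)[OF \<Phi>]])
      (simp_all add: open_Collect_less continuous_intros flip: open_openin)
  have cl: "closedin X ?V"
    by (intro closedin_Int closedin_continuous_map_preimage[OF iso_C0_continuous(1)[OF \<Phi>]])
      (simp_all add: closed_Collect_le continuous_intros flip: closed_closedin)
  have eq: "?U = ?V"
  proof (intro equalityI subsetI)
    fix p assume p: "p \<in> ?V"
    have "Re (\<Phi> h p) \<noteq> 1/4"
    proof
      assume eq: "Re (\<Phi> h p) = 1/4"
      show False using ab[of p, unfolded eq] p by (simp add: abs_less_iff)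
    qed
    then show "p \<in> ?U" using p no_zero[of p] by force
  qed auto
  have "\<bar>Re (\<Phi> b x) + 1/2\<bar> < 1/32" using ab[OF x(1), unfolded x(2)] by simp
  then have "Re (\<Phi> b x) < 0" by linarith
  then have "x \<in> ?U" using x by simp
  moreover have "y \<notin> ?U" using y by simp
  ultimately show ?thesis using op cl[folded eq] by (intro exI conjI)
qed

text \<open>The interpolation polynomial \<open>z * (z - t) / (s * (s - t))\<close> in
  \<open>b\<close> has no constant term, so it makes sense without a unit; this is why
  \<open>\<phi> b\<close> must be nonzero.\<close>

lemma separating_self_adjoint:
  fixes b :: "'a::cstar_algebra"
  assumes \<phi>: "character \<phi>" "character \<psi>" and b: "self_adjoint b" "\<phi> b \<noteq> \<psi> b" "\<phi> b \<noteq> 0"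
  obtains h where "self_adjoint h" "\<phi> h = 1" "\<psi> h = 0"
proof -
  define s t where "s = Re (\<phi> b)" and "t = Re (\<psi> b)"
  have st: "\<phi> b = s" "\<psi> b = t"
    using \<phi> b(1) character_self_adjoint by (auto simp: s_def t_def)
  then have ne: "s \<noteq> t" "s \<noteq> 0" using b by auto
  define h where "h = (1 / (s * (s - t))) *\<^sub>R (b * b - t *\<^sub>R b)"
  have ev: "\<theta> h = of_real (1 / (s * (s - t))) * (\<theta> b * \<theta> b - t * \<theta> b)" if "character \<theta>" for \<theta> :: "'a \<Rightarrow> complex"
    using that unfolding h_def
    by (simp add: character_diff[OF that] character_scaleR[OF that]) (simp add: character_def)
  have "self_adjoint h" unfolding h_def by (intro self_adjoint_intros b) simp
  moreover have "\<phi> h = 1" unfolding ev[OF \<phi>(1)] st using ne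
    by (simp add: field_simps flip: of_real_mult of_real_diff)
  moreover have "\<psi> h = 0" unfolding ev[OF \<phi>(2)] st by simp
  ultimately show ?thesis by (rule that)
qed

lemma gr0_zero_imp_totally_disconnected:
  fixes \<Phi> :: "'a::cstar_algebra \<Rightarrow> 'x \<Rightarrow> complex"
  assumes gr: "gr0 TYPE('a) = 0" and X: "locally_compact_space X" "Hausdorff_space X" and \<Phi>: "iso_C0 \<Phi> X"
  shows "totally_disconnected_space X"
proof -
  have "x = y" if S: "connectedin X S" and xy: "x \<in> S" "y \<in> S" for S x y
  proof (rule ccontr)
    assume "x \<noteq> y"
    have top: "x \<in> topspace X" "y \<in> topspace X" using S xy connectedin_subset_topspace by blast+
    obtain f where "f \<in> C0 X" "f x \<noteq> f y" using C0_separates_points[OF X top \<open>x \<noteq> y\<close>] by blast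
    moreover obtain a where "f = \<Phi> a"
      using \<Phi> \<open>f \<in> C0 X\<close> unfolding iso_C0_def bij_betw_def by blast
    ultimately have "(\<lambda>a. \<Phi> a x) \<noteq> (\<lambda>a. \<Phi> a y)" by metis
    then obtain b where b: "self_adjoint b" "\<Phi> b x \<noteq> \<Phi> b y"
      using characters_separated[OF iso_C0_character[OF \<Phi> top(1)] iso_C0_character[OF \<Phi> top(2)]] by blast
    have *: False if uv: "u \<in> S" "v \<in> S" "\<Phi> b u \<noteq> \<Phi> b v" "\<Phi> b u \<noteq> 0" for u v
    proof -
      have top: "u \<in> topspace X" "v \<in> topspace X" using S uv connectedin_subset_topspace by blast+
      obtain h where "self_adjoint h" "\<Phi> h u = 1" "\<Phi> h v = 0"
        using separating_self_adjoint[OF iso_C0_character[OF \<Phi> top(1)] iso_C0_character[OF \<Phi> top(2)] b(1) uv(3,4)] .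
      then obtain U where "openin X U" "closedin X U" "u \<in> U" "v \<notin> U"
        using clopen_separation[OF gr \<Phi> _ top(1)] by blast
      then show False using connectedin_clopen_cases[OF S] uv by (metis disjnt_iff subsetD)
    qed
    \<comment> \<open>Of two distinct values at least one is nonzero, so one of the two orders meets
      the hypotheses.\<close>
    show False using *[of x y] *[of y x] b(2) xy by metis
  qed
  then show ?thesis
    unfolding totally_disconnected_space_def by (metis insertCI subsetI)
qed

section \<open>Projections\<close>

definition projections :: "'a::cstar_algebra set" where
  "projections = {p. self_adjoint p \<and> p * p = p}"

text \<open>The span is real, so all its elements are self-adjoint.\<close>

definition projections_dense :: "'a::cstar_algebra itself \<Rightarrow> bool" where
  "projections_dense A \<longleftrightarrow> (\<forall>a::'a. self_adjoint a \<longrightarrow> a \<in> closure (span projections))"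

lemma projections_mult:
  fixes p q :: "'a::cstar_algebra"
  shows "commutative TYPE('a) \<Longrightarrow> p \<in> projections \<Longrightarrow> q \<in> projections \<Longrightarrow> p * q \<in> projections"
  unfolding projections_def commutative_def mem_Collect_eq
  by (intro conjI self_adjoint_intros(6)) (metis mult.assoc)+

lemma span_projections_mult:
  fixes p u :: "'a::cstar_algebra"
  assumes comm: "commutative TYPE('a)" and p: "p \<in> projections" and u: "u \<in> span projections"
  shows "u * p \<in> span projections"
  using u
proof (induction rule: span_induct_alt)
  case (step c x y)
  have "c *\<^sub>R (x * p) + y * p \<in> span projections"
    using step projections_mult[OF comm _ p] by (intro span_add span_scale) (auto intro: span_base)
  then show ?case by (simp add: distrib_right)
qed (simp add: span_zero)

lemma clopen_projection:
  fixes \<Phi> :: "'a::cstar_algebra \<Rightarrow> 'x \<Rightarrow> complex"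
  assumes \<Phi>: "iso_C0 \<Phi> X" and U: "openin X U" "closedin X U" "compactin X U"
  obtains p where "p \<in> projections" "\<And>x. \<Phi> p x = of_bool (x \<in> U)"
proof -
  define f where "f x = (of_bool (x \<in> U) :: complex)" for x
  have sub: "U \<subseteq> topspace X" using U(1) openin_subset by blast
  have "continuous_map X euclidean f"
    unfolding continuous_map_def
  proof (intro conjI allI impI)
    fix W :: "complex set"
    have "{x \<in> topspace X. f x \<in> W} = (if 1 \<in> W then U else {}) \<union> (if 0 \<in> W then topspace X - U else {})"
      using sub by (auto simp: f_def split: if_splits)
    then show "openin X {x \<in> topspace X. f x \<in> W}" using U by (auto intro!: openin_Un openin_diff)
  qed simp
  moreover have "compactin X {x \<in> topspace X. \<epsilon> \<le> cmod (f x)}" if "\<epsilon> > 0" for \<epsilon>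
  proof -
    have "{x \<in> topspace X. \<epsilon> \<le> cmod (f x)} = (if \<epsilon> \<le> 1 then U else {})"
      using sub that by (auto simp: f_def)
    then show ?thesis using U by simp
  qed
  ultimately have "f \<in> C0 X" using sub by (auto simp: C0_def f_def)
  then have "f \<in> range \<Phi>" using \<Phi> by (simp add: iso_C0_def bij_betw_def)
  then obtain p where p: "\<Phi> p = f" by blast
  have "p * p = p" "star p = p"
    by (rule iso_C0_eqI[OF \<Phi>]; use \<Phi> in \<open>simp add: iso_C0_def p f_def\<close>)+
  then have "p \<in> projections" by (simp add: projections_def self_adjoint_def)
  then show ?thesis using that[of p] by (simp add: p f_def)
qed

text \<open>The component of \<open>x\<close> is the compact set \<open>{x}\<close>, and Wilder's
  theorem splits the space into two open parts, one of them between this component and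
  \<open>W\<close>. The compact set \<open>K\<close> makes that part compact.\<close>

lemma compact_clopen_neighbourhood:
  assumes X: "locally_compact_space X" "Hausdorff_space X" "totally_disconnected_space X"
    and W: "openin X W" "x \<in> W" and K: "compactin X K" "W \<subseteq> K"
  obtains U where "openin X U" "closedin X U" "compactin X U" "x \<in> U" "U \<subseteq> W"
proof -
  have x: "x \<in> topspace X" using W openin_subset by blast
  have "connected_component_of_set X x = {x}"
    using X(3) x connectedin_connected_component_of[of X x] connected_component_of_refl[of X x]
    unfolding totally_disconnected_space_def by (metis empty_iff mem_Collect_eq singletonD subset_singletonD)
  then have comp: "{x} \<in> connected_components_of X"
    using x by (metis connected_component_in_connected_components_of)
  obtain U V where UV: "openin X U" "openin X V" "disjnt U V" "U \<union> V = topspace X" "{x} \<subseteq> U" "U \<subseteq> W"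
    using wilder_locally_compact_component_thm[OF X(1,2) comp _ W(1)] W(2) x by auto
  then have "U = topspace X - V" unfolding disjnt_def by blast
  then have "closedin X U" using UV(2) by auto
  moreover have "compactin X U" using closed_compactin[OF K(1) _ \<open>closedin X U\<close>] UV(6) K(2) by blast
  ultimately show ?thesis using that UV by blast
qed

text \<open>Finitely many compact open sets on which \<open>a\<close> is nearly constant cover the
  compact set where \<open>a\<close> is at least \<open>\<epsilon>\<close> in modulus. Off the cover
  the approximant is 0 and \<open>a\<close> is small.\<close>

lemma totally_disconnected_imp_projections_dense:
  fixes \<Phi> :: "'a::cstar_algebra \<Rightarrow> 'x \<Rightarrow> complex"
  assumes comm: "commutative TYPE('a)"
    and X: "locally_compact_space X" "Hausdorff_space X" "totally_disconnected_space X"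
    and \<Phi>: "iso_C0 \<Phi> X"
  shows "projections_dense TYPE('a)"
  unfolding projections_dense_def closure_approachable
proof (intro allI impI)
  fix a :: 'a and e :: real assume a: "self_adjoint a" and "e > 0"
  define \<epsilon> where "\<epsilon> = e / 2"
  have \<epsilon>: "\<epsilon> > 0" using \<open>e > 0\<close> by (simp add: \<epsilon>_def)
  define \<U> where "\<U> = {U. openin X U \<and> closedin X U \<and> compactin X U \<and>
    (\<exists>t. \<forall>y\<in>U. cmod (\<Phi> a y - of_real t) < \<epsilon>)}"
  have real: "\<Phi> a x = of_real (Re (\<Phi> a x))" if "x \<in> topspace X" for x
    using character_self_adjoint[OF iso_C0_character[OF \<Phi> that] a] .
  have cover: "\<exists>U\<in>\<U>. x \<in> U" if x: "x \<in> topspace X" "\<epsilon> \<le> cmod (\<Phi> a x)" for x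
  proof -
    \<comment> \<open>The condition \<open>\<epsilon> / 2 < cmod z\<close> keeps \<open>W\<close>
      inside a compact set.\<close>
    define W where "W = {y \<in> topspace X. \<Phi> a y \<in> {z. cmod (z - \<Phi> a x) < \<epsilon> \<and> \<epsilon> / 2 < cmod z}}"
    have "open {z. cmod (z - \<Phi> a x) < \<epsilon> \<and> \<epsilon> / 2 < cmod z}"
      by (intro open_Collect_conj open_Collect_less continuous_intros)
    then have "openin X W"
      unfolding W_def by (intro openin_continuous_map_preimage[OF iso_C0_continuous(1)[OF \<Phi>]]) simp
    moreover have "x \<in> W" using x \<epsilon> by (simp add: W_def)
    moreover have "compactin X {y \<in> topspace X. \<epsilon> / 2 \<le> cmod (\<Phi> a y)}"
      by (rule iso_C0_continuous(2)[OF \<Phi>]) (use \<epsilon> in simp)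
    moreover have "W \<subseteq> {y \<in> topspace X. \<epsilon> / 2 \<le> cmod (\<Phi> a y)}" by (auto simp: W_def)
    ultimately obtain U where U: "openin X U" "closedin X U" "compactin X U" "x \<in> U" "U \<subseteq> W"
      by (rule compact_clopen_neighbourhood[OF X])
    have "\<forall>y\<in>U. cmod (\<Phi> a y - of_real (Re (\<Phi> a x))) < \<epsilon>"
      using U(5) real[OF x(1)] by (auto simp: W_def)
    then have "U \<in> \<U>" using U unfolding \<U>_def by blast
    then show ?thesis using U by blast
  qed
  have "compactin X {x \<in> topspace X. \<epsilon> \<le> cmod (\<Phi> a x)}" by (rule iso_C0_continuous(2)[OF \<Phi> \<epsilon>])
  moreover have "\<forall>U\<in>\<U>. openin X U" by (auto simp: \<U>_def)
  moreover have "{x \<in> topspace X. \<epsilon> \<le> cmod (\<Phi> a x)} \<subseteq> \<Union>\<U>" using cover by blast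
  ultimately obtain \<F> where \<F>: "finite \<F>" "\<F> \<subseteq> \<U>" "{x \<in> topspace X. \<epsilon> \<le> cmod (\<Phi> a x)} \<subseteq> \<Union>\<F>"
    unfolding compactin_def by meson
  \<comment> \<open>The cover is not made disjoint: in \<open>r = q - q * p + t *\<^sub>R p\<close>
    the newest set overwrites the values given earlier.\<close>
  have "\<exists>q\<in>span projections. \<forall>y\<in>topspace X.
      (y \<in> \<Union>\<F> \<longrightarrow> cmod (\<Phi> a y - \<Phi> q y) < \<epsilon>) \<and> (y \<notin> \<Union>\<F> \<longrightarrow> \<Phi> q y = 0)"
    using \<F>(1,2)
  proof (induction \<F>)
    case empty
    show ?case
      by (intro bexI[of _ 0]) (auto simp: span_zero character_zero_right[OF iso_C0_character[OF \<Phi>]])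
  next
    case (insert U \<F>)
    then obtain q where q: "q \<in> span projections"
      and q1: "\<And>y. y \<in> topspace X \<Longrightarrow> y \<in> \<Union>\<F> \<Longrightarrow> cmod (\<Phi> a y - \<Phi> q y) < \<epsilon>"
      and q0: "\<And>y. y \<in> topspace X \<Longrightarrow> y \<notin> \<Union>\<F> \<Longrightarrow> \<Phi> q y = 0"
      by (metis insert_subset)
    obtain t where U: "openin X U" "closedin X U" "compactin X U"
      and t: "\<And>y. y \<in> U \<Longrightarrow> cmod (\<Phi> a y - of_real t) < \<epsilon>"
      using insert.prems unfolding \<U>_def by blast
    obtain p where p: "p \<in> projections" "\<And>x. \<Phi> p x = of_bool (x \<in> U)"
      using clopen_projection[OF \<Phi> U] by blast
    define r where "r = q - q * p + t *\<^sub>R p"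
    have "r \<in> span projections"
      unfolding r_def using q p(1) span_projections_mult[OF comm p(1) q]
      by (intro span_add span_diff span_scale) (auto intro: span_base)
    moreover have "\<Phi> r y = (if y \<in> U then of_real t else \<Phi> q y)" if "y \<in> topspace X" for y
    proof -
      note ch = iso_C0_character[OF \<Phi> that]
      have "\<Phi> r y = \<Phi> q y - \<Phi> q y * \<Phi> p y + of_real t * \<Phi> p y"
        using ch character_diff[OF ch] character_scaleR[OF ch] by (simp add: r_def character_def)
      then show ?thesis by (simp add: p)
    qed
    ultimately show ?case using q0 q1 t by (intro bexI[of _ r]) auto
  qed
  then obtain q where q: "q \<in> span projections"
    and q1: "\<And>y. y \<in> topspace X \<Longrightarrow> y \<in> \<Union>\<F> \<Longrightarrow> cmod (\<Phi> a y - \<Phi> q y) < \<epsilon>"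
    and q0: "\<And>y. y \<in> topspace X \<Longrightarrow> y \<notin> \<Union>\<F> \<Longrightarrow> \<Phi> q y = 0"
    by metis
  have "norm (q - a) \<le> \<epsilon>"
  proof (rule iso_C0_norm_le[OF \<Phi>])
    fix y assume y: "y \<in> topspace X"
    have "cmod (\<Phi> a y - \<Phi> q y) \<le> \<epsilon>"
    proof (cases "y \<in> \<Union>\<F>")
      case True
      then show ?thesis using q1[OF y] by simp
    next
      case False
      then have "\<not> \<epsilon> \<le> cmod (\<Phi> a y)" using \<F>(3) y by blast
      then show ?thesis using q0[OF y False] by simp
    qed
    then show "cmod (\<Phi> (q - a) y) \<le> \<epsilon>"
      by (simp add: character_diff[OF iso_C0_character[OF \<Phi> y]] norm_minus_commute)
  qed (use \<epsilon> in simp)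
  then have "dist q a < e" using \<open>e > 0\<close> by (simp add: dist_norm \<epsilon>_def)
  then show "\<exists>y\<in>span projections. dist y a < e" using q by blast
qed

section \<open>Orthogonal families and single generators\<close>

definition orthogonal_projections :: "'a::cstar_algebra set \<Rightarrow> bool" where
  "orthogonal_projections E \<longleftrightarrow> finite E \<and> E \<subseteq> projections \<and> (\<forall>e\<in>E. \<forall>f\<in>E. e \<noteq> f \<longrightarrow> e * f = 0)"

lemma orthogonal_combination_mult:
  assumes "orthogonal_projections E"
  shows "(\<Sum>e\<in>E. r e *\<^sub>R e) * (\<Sum>e\<in>E. s e *\<^sub>R e) = (\<Sum>e\<in>E. (r e * s e) *\<^sub>R e)"
proof -
  have E: "finite E" "\<And>e. e \<in> E \<Longrightarrow> e * e = e" "\<And>e f. e \<in> E \<Longrightarrow> f \<in> E \<Longrightarrow> e \<noteq> f \<Longrightarrow> e * f = 0"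
    using assms by (auto simp: orthogonal_projections_def projections_def)
  have "(\<Sum>e\<in>E. r e *\<^sub>R e) * (\<Sum>e\<in>E. s e *\<^sub>R e) = (\<Sum>e\<in>E. \<Sum>f\<in>E. (r e * s f) *\<^sub>R (e * f))"
    by (simp add: sum_product mult.commute)
  also have "\<dots> = (\<Sum>e\<in>E. \<Sum>f\<in>E. if f = e then (r e * s e) *\<^sub>R e else 0)"
    by (intro sum.cong refl) (use E in auto)
  also have "\<dots> = (\<Sum>e\<in>E. (r e * s e) *\<^sub>R e)" using E(1) by simp
  finally show ?thesis .
qed

lemma orthogonal_refinement:
  fixes F :: "'a::cstar_algebra set"
  assumes comm: "commutative TYPE('a)" and "finite F" "F \<subseteq> projections"
  obtains E where "orthogonal_projections E" "F \<subseteq> span E"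
proof -
  have "\<exists>E. orthogonal_projections E \<and> F \<subseteq> span E"
    using assms(2,3)
  proof (induction F)
    case empty
    show ?case by (intro exI[of _ "{}"]) (simp add: orthogonal_projections_def)
  next
    case (insert p F)
    then obtain E where E: "orthogonal_projections E" "F \<subseteq> span E" by auto
    have fin: "finite E" and proj: "\<And>e. e \<in> E \<Longrightarrow> e * e = e" "\<And>e. e \<in> E \<Longrightarrow> self_adjoint e"
      and orth: "\<And>e f. e \<in> E \<Longrightarrow> f \<in> E \<Longrightarrow> e \<noteq> f \<Longrightarrow> e * f = 0"
      using E(1) by (auto simp: orthogonal_projections_def projections_def)
    have p: "p * p = p" "self_adjoint p" using insert.prems by (auto simp: projections_def)
    have c: "x * y = y * x" for x y :: 'a using comm by (simp add: commutative_def)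
    have lc: "x * (y * z) = y * (x * z)" for x y z :: 'a by (metis c mult.assoc)
    define s where "s = \<Sum>E"
    have es: "e * s = e" if "e \<in> E" for e
    proof -
      have "e * s = (\<Sum>f\<in>E. e * f)" by (simp add: s_def sum_distrib_left)
      also have "\<dots> = (\<Sum>f\<in>E. if f = e then e else 0)"
        by (intro sum.cong refl) (use that proj orth in auto)
      also have "\<dots> = e" using fin that by simp
      finally show ?thesis .
    qed
    have ss: "s * s = s" using es by (simp add: s_def sum_distrib_right)
    have sa: "self_adjoint s"
      unfolding s_def using fin proj(2)
      by (induction E rule: finite_induct) (auto intro: self_adjoint_intros)
    \<comment> \<open>Each \<open>e\<close> is cut by \<open>p\<close> into two pieces, and
      \<open>p - p * s\<close> is the part of \<open>p\<close> outside the family. Pieces may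
      vanish; 0 is an admissible member, so nothing has to be discarded.\<close>
    define E' where "E' = insert (p - p * s) ((\<lambda>e. e * p) ` E \<union> (\<lambda>e. e - e * p) ` E)"
    have sa': "self_adjoint (x * y)" if "self_adjoint x" "self_adjoint y" for x y :: 'a
      using that c by (intro self_adjoint_intros)
    note ac = mult.assoc c lc
    have "E' \<subseteq> projections"
    proof
      fix x assume "x \<in> E'"
      then consider "x = p - p * s" | e where "e \<in> E" "x = e * p" | e where "e \<in> E" "x = e - e * p"
        unfolding E'_def by blast
      then show "x \<in> projections"
      proof cases
        case 1
        have "x * x = p * p - p * p * s - p * p * s + p * p * (s * s)"
          by (simp add: 1 left_diff_distrib right_diff_distrib ac)
        then have "x * x = x" by (simp add: 1 p ss)
        then show ?thesis using 1 p sa sa' by (simp add: projections_def self_adjoint_intros)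
      next
        case 2
        have "x * x = (e * e) * (p * p)" by (simp add: 2 ac)
        then have "x * x = x" by (simp add: 2 p proj)
        then show ?thesis using 2 p proj sa' by (simp add: projections_def)
      next
        case 3
        have "x * x = e * e - e * e * p - e * e * p + (e * e) * (p * p)"
          by (simp add: 3 left_diff_distrib right_diff_distrib ac)
        then have "x * x = x" by (simp add: 3 p proj)
        then show ?thesis using 3 p proj sa' by (simp add: projections_def self_adjoint_intros)
      qed
    qed
    moreover have "x * y = 0" if xy: "x \<in> E'" "y \<in> E'" "x \<noteq> y" for x y
    proof -
      have r: "(e * p) * (p - p * s) = 0" "(e - e * p) * (p - p * s) = 0" if "e \<in> E" for e
      proof -
        have "(e * p) * (p - p * s) = e * (p * p) - (p * p) * (e * s)"
          "(e - e * p) * (p - p * s) = e * p - p * (e * s) - (e * (p * p) - (p * p) * (e * s))"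
          by (simp_all add: left_diff_distrib right_diff_distrib ac)
        then show "(e * p) * (p - p * s) = 0" "(e - e * p) * (p - p * s) = 0"
          using that by (simp_all add: p es c)
      qed
      have d: "(e * p) * (f - f * p) = 0" for e f
      proof -
        have "(e * p) * (f - f * p) = e * f * p - e * f * (p * p)"
          by (simp add: right_diff_distrib ac)
        then show ?thesis by (simp add: p)
      qed
      have o: "(e * p) * (f * p) = 0" "(e - e * p) * (f - f * p) = 0" if "e \<in> E" "f \<in> E" "e \<noteq> f" for e f
      proof -
        have "(e * p) * (f * p) = (e * f) * (p * p)"
          "(e - e * p) * (f - f * p) = e * f - (e * f) * p - (e * f) * p + (e * f) * (p * p)"
          by (simp_all add: left_diff_distrib right_diff_distrib ac)
        then show "(e * p) * (f * p) = 0" "(e - e * p) * (f - f * p) = 0"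
          by (simp_all add: orth[OF that])
      qed
      have r': "(p - p * s) * (e * p) = 0" "(p - p * s) * (e - e * p) = 0" if "e \<in> E" for e
        using r[OF that] c[of "p - p * s"] by simp_all
      have d': "(f - f * p) * (e * p) = 0" for e f
        using d[of e f] c[of "f - f * p" "e * p"] by simp
      have o': "e * p \<noteq> f * p \<Longrightarrow> (e * p) * (f * p) = 0"
        "e - e * p \<noteq> f - f * p \<Longrightarrow> (e - e * p) * (f - f * p) = 0" if "e \<in> E" "f \<in> E" for e f
        using o[OF that] by blast+
      have E': "z = p - p * s \<or> (\<exists>e\<in>E. z = e * p) \<or> (\<exists>e\<in>E. z = e - e * p)" if "z \<in> E'" for z
        using that unfolding E'_def by blast
      show ?thesis
        using E'[OF xy(1)] E'[OF xy(2)]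
      proof (elim disjE bexE)
        fix e f assume "x = e * p" "y = f * p" "e \<in> E" "f \<in> E"
        then show ?thesis using o'(1)[of e f] xy(3) by simp
      next
        fix e f assume "x = e - e * p" "y = f - f * p" "e \<in> E" "f \<in> E"
        then show ?thesis using o'(2)[of e f] xy(3) by simp
      qed (use xy(3) in \<open>simp_all only: r r' d d' simp_thms\<close>)
    qed
    moreover have "finite E'" using fin by (simp add: E'_def)
    ultimately have "orthogonal_projections E'" by (simp add: orthogonal_projections_def)
    moreover have "E \<subseteq> span E'"
    proof
      fix e assume "e \<in> E"
      then have "e * p + (e - e * p) \<in> span E'"
        by (intro span_add span_base) (auto simp: E'_def)
      then show "e \<in> span E'" by simp
    qed
    then have "span E \<subseteq> span E'" by (simp add: span_minimal)
    moreover have "p \<in> span E'"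
    proof -
      have "(p - p * s) + (\<Sum>e\<in>E. e * p) \<in> span E'"
        by (intro span_add span_base span_sum) (auto simp: E'_def)
      moreover have "(\<Sum>e\<in>E. e * p) = p * s" by (simp add: s_def sum_distrib_left c)
      ultimately show ?thesis by simp
    qed
    ultimately show ?case using E(2) by (intro exI[of _ E']) auto
  qed
  then show ?thesis using that by metis
qed

text \<open>Lagrange interpolation: a product of factors \<open>b - t f\<close> isolates a single projection, and the
  extra factor \<open>b\<close> replaces the missing unit.\<close>

lemma orthogonal_projections_generated:
  fixes E :: "'a::cstar_algebra set"
  assumes E: "orthogonal_projections E" and t: "inj_on t E" "\<And>e. e \<in> E \<Longrightarrow> t e \<noteq> 0"
  shows "E \<subseteq> cstar_generated {\<Sum>e\<in>E. t e *\<^sub>R e}"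
proof
  let ?b = "\<Sum>e\<in>E. t e *\<^sub>R e"
  let ?B = "cstar_generated {?b}"
  note B = cstar_subalgebraD[OF cstar_subalgebra_generated[of "{?b}"]]
  have fin: "finite E" using E by (simp add: orthogonal_projections_def)
  have b: "?b \<in> ?B" using subset_cstar_generated[of "{?b}"] by blast
  fix e assume e: "e \<in> E"
  have "(\<Sum>d\<in>E. (t d * (\<Prod>f\<in>F. t d - t f)) *\<^sub>R d) \<in> ?B" if "finite F" for F
    using that
  proof (induction F)
    case (insert g F)
    let ?r = "\<lambda>d. t d * (\<Prod>f\<in>F. t d - t f)"
    have "(\<Sum>d\<in>E. ?r d *\<^sub>R d) * ?b - t g *\<^sub>R (\<Sum>d\<in>E. ?r d *\<^sub>R d) \<in> ?B"
      by (intro B b insert.IH)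
    also have "(\<Sum>d\<in>E. ?r d *\<^sub>R d) * ?b - t g *\<^sub>R (\<Sum>d\<in>E. ?r d *\<^sub>R d)
        = (\<Sum>d\<in>E. (?r d * t d) *\<^sub>R d - t g *\<^sub>R ?r d *\<^sub>R d)"
      unfolding orthogonal_combination_mult[OF E] by (simp add: scaleR_sum_right sum_subtractf)
    also have "\<dots> = (\<Sum>d\<in>E. (t d * (\<Prod>f\<in>insert g F. t d - t f)) *\<^sub>R d)"
      using insert by (intro sum.cong refl) (simp add: algebra_simps flip: scaleR_diff_left)
    finally show ?case .
  qed (simp add: b)
  then have "(\<Sum>d\<in>E. (t d * (\<Prod>f\<in>E - {e}. t d - t f)) *\<^sub>R d) \<in> ?B" using fin by simp
  also have "(\<Sum>d\<in>E. (t d * (\<Prod>f\<in>E - {e}. t d - t f)) *\<^sub>R d)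
      = (\<Sum>d\<in>E. if d = e then (t e * (\<Prod>f\<in>E - {e}. t e - t f)) *\<^sub>R e else 0)"
    using fin by (intro sum.cong refl) (auto intro!: prod_zero)
  also have "\<dots> = (t e * (\<Prod>f\<in>E - {e}. t e - t f)) *\<^sub>R e" using fin e by simp
  finally have "(t e * (\<Prod>f\<in>E - {e}. t e - t f)) *\<^sub>R e \<in> ?B" .
  moreover have "t e * (\<Prod>f\<in>E - {e}. t e - t f) \<noteq> 0"
    using t e fin by (auto simp: inj_on_def)
  ultimately obtain k where "k *\<^sub>R e \<in> ?B" "k \<noteq> 0" by blast
  then show "e \<in> ?B" using B(5)[of "k *\<^sub>R e" "inverse k"] by simp
qed

text \<open>Coefficients are chosen one at a time: an interval is infinite, and only 0 and the
  finitely many earlier values are forbidden.\<close>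

lemma exists_injective_perturbation:
  fixes s :: "'b \<Rightarrow> real"
  assumes "finite E" "\<delta> > 0"
  shows "\<exists>t. inj_on t E \<and> (\<forall>e\<in>E. t e \<noteq> 0 \<and> \<bar>t e - s e\<bar> < \<delta>)"
  using assms(1)
proof (induction E)
  case (insert e E)
  then obtain t where t: "inj_on t E" "\<forall>e\<in>E. t e \<noteq> 0 \<and> \<bar>t e - s e\<bar> < \<delta>" by blast
  have "infinite ({s e - \<delta><..<s e + \<delta>} - insert 0 (t ` E))"
    using assms(2) insert by (intro Diff_infinite_finite) (auto simp: infinite_Ioo)
  then obtain r where r: "r \<in> {s e - \<delta><..<s e + \<delta>} - insert 0 (t ` E)"
    by (metis finite.emptyI ex_in_conv)
  have "inj_on (t(e := r)) (insert e E)"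
    using t(1) r insert(2) by (auto simp: inj_on_def image_iff)
  moreover have "\<forall>d\<in>insert e E. (t(e := r)) d \<noteq> 0 \<and> \<bar>(t(e := r)) d - s d\<bar> < \<delta>"
    using t(2) r by (auto simp: abs_less_iff)
  ultimately show ?case by blast
qed simp

lemma span_finite_subset:
  assumes "u \<in> span P"
  obtains F where "finite F" "F \<subseteq> P" "u \<in> span F"
proof -
  obtain F r where "finite F" "F \<subseteq> P" "u = (\<Sum>a\<in>F. r a *\<^sub>R a)"
    using assms unfolding span_explicit by blast
  then show ?thesis using that[of F] by (auto intro: span_sum span_scale span_base)
qed

text \<open>The approximants of \<open>a\<close> and of both parts of \<open>c\<close> are written
  over one orthogonal family. Only the coefficients for \<open>a\<close> are perturbed; the result
  generates the whole family and so contains the approximant of \<open>c\<close> exactly.\<close>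

lemma projections_dense_imp_gr0_zero:
  assumes comm: "commutative TYPE('a::cstar_algebra)" and dense: "projections_dense TYPE('a)"
  shows "gr0 TYPE('a) = 0"
  unfolding gr0_eq_0_iff
proof (intro allI impI)
  fix a c :: 'a and \<epsilon> :: real assume a: "self_adjoint a" and \<epsilon>: "\<epsilon> > 0"
  have approx: "\<exists>u\<in>span projections. norm (u - x) < \<epsilon> / 2" if "self_adjoint x" for x :: 'a
    using dense \<epsilon> that half_gt_zero[OF \<epsilon>] unfolding projections_dense_def closure_approachable dist_norm by blast
  obtain u where u: "u \<in> span projections" "norm (u - a) < \<epsilon> / 2" using approx[OF a] by blast
  obtain v where v: "v \<in> span projections" "norm (v - re_part c) < \<epsilon> / 2"
    using approx[OF self_adjoint_parts(1)] by blast
  obtain w where w: "w \<in> span projections" "norm (w - im_part c) < \<epsilon> / 2"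
    using approx[OF self_adjoint_parts(2)] by blast
  obtain F1 where F1: "finite F1" "F1 \<subseteq> projections" "u \<in> span F1" using span_finite_subset[OF u(1)] .
  obtain F2 where F2: "finite F2" "F2 \<subseteq> projections" "v \<in> span F2" using span_finite_subset[OF v(1)] .
  obtain F3 where F3: "finite F3" "F3 \<subseteq> projections" "w \<in> span F3" using span_finite_subset[OF w(1)] .
  have "finite (F1 \<union> F2 \<union> F3)" "F1 \<union> F2 \<union> F3 \<subseteq> projections" using F1 F2 F3 by auto
  then obtain E where E: "orthogonal_projections E" "F1 \<union> F2 \<union> F3 \<subseteq> span E"
    using orthogonal_refinement[OF comm] by metis
  then have "span F1 \<subseteq> span E" "span F2 \<subseteq> span E" "span F3 \<subseteq> span E"
    by (simp_all add: span_minimal)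
  then have uvw: "u \<in> span E" "v \<in> span E" "w \<in> span E" using F1 F2 F3 by auto
  have fin: "finite E" using E(1) by (simp add: orthogonal_projections_def)
  obtain s where s: "u = (\<Sum>e\<in>E. s e *\<^sub>R e)" using uvw(1) span_finite[OF fin] by auto
  \<comment> \<open>Chosen so that all coefficient changes together cost at most
    \<open>\<epsilon> / 2\<close>; the summand 1 avoids division by 0 for an empty or zero
    family.\<close>
  define \<delta> where "\<delta> = \<epsilon> / (2 * (1 + (\<Sum>e\<in>E. norm e)))"
  have N: "1 + (\<Sum>e\<in>E. norm e) > 0" by (intro add_pos_nonneg sum_nonneg) auto
  have \<delta>: "\<delta> > 0" using \<epsilon> N by (simp add: \<delta>_def)
  obtain t where t: "inj_on t E" "\<And>e. e \<in> E \<Longrightarrow> t e \<noteq> 0" "\<And>e. e \<in> E \<Longrightarrow> \<bar>t e - s e\<bar> < \<delta>"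
    using exists_injective_perturbation[OF fin \<delta>, of s] by blast
  define b where "b = (\<Sum>e\<in>E. t e *\<^sub>R e)"
  have bu: "b - u = (\<Sum>e\<in>E. (t e - s e) *\<^sub>R e)"
    by (simp add: b_def s scaleR_diff_left sum_subtractf)
  have "norm (b - u) \<le> (\<Sum>e\<in>E. norm ((t e - s e) *\<^sub>R e))" unfolding bu by (rule norm_sum)
  also have "\<dots> \<le> (\<Sum>e\<in>E. \<delta> * norm e)"
  proof (rule sum_mono)
    fix e assume "e \<in> E"
    then show "norm ((t e - s e) *\<^sub>R e) \<le> \<delta> * norm e"
      using mult_right_mono[OF less_imp_le[OF t(3)] norm_ge_zero] by simp
  qed
  also have "\<dots> = \<delta> * (\<Sum>e\<in>E. norm e)" by (simp add: sum_distrib_left)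
  also have "\<dots> \<le> \<delta> * (1 + (\<Sum>e\<in>E. norm e))" using \<delta> by (intro mult_left_mono) auto
  also have "\<dots> = \<epsilon> / 2" using N by (simp add: \<delta>_def field_simps)
  finally have "norm (b - u) \<le> \<epsilon> / 2" .
  then have ba: "norm (b - a) < \<epsilon>"
    using norm_triangle_ineq[of "b - u" "u - a"] u(2) by simp
  have sab: "self_adjoint b"
    unfolding b_def using E(1)
    by (auto simp: orthogonal_projections_def projections_def self_adjoint_def star_scaleR
        linear_sum[OF bounded_linear.linear[OF bounded_linear_star]] intro!: sum.cong)
  let ?B = "cstar_generated {b}"
  note B = cstar_subalgebraD[OF cstar_subalgebra_generated[of "{b}"]]
  have "subspace ?B" using B by (auto simp: subspace_def)
  moreover have "E \<subseteq> ?B" unfolding b_def by (rule orthogonal_projections_generated[OF E(1) t(1,2)])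
  ultimately have "span E \<subseteq> ?B" by (rule span_minimal[rotated])
  then have "v \<in> ?B" "w \<in> ?B" using uvw by auto
  then have "v + \<i> *\<^sub>C w \<in> ?B" by (intro B(2,4))
  moreover have "norm (c - (v + \<i> *\<^sub>C w)) < \<epsilon>"
  proof -
    have "(re_part c + \<i> *\<^sub>C im_part c) - (v + \<i> *\<^sub>C w) = (re_part c - v) + \<i> *\<^sub>C (im_part c - w)"
      by (simp add: scaleC_diff_right)
    then have "norm (c - (v + \<i> *\<^sub>C w)) \<le> norm (re_part c - v) + norm (\<i> *\<^sub>C (im_part c - w))"
      using norm_triangle_ineq parts_decomp[of c] by metis
    then show ?thesis using v(2) w(2) by (simp add: norm_scaleC norm_minus_commute)
  qed
  ultimately show "\<exists>b. self_adjoint b \<and> norm (b - a) < \<epsilon> \<and> (\<exists>g\<in>cstar_generated {b}. norm (c - g) < \<epsilon>)"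
    using sab ba by blast
qed

theorem gr0_zero_iff_spectrum:
  "gr0 TYPE('a::cstar_algebra) = 0 \<longleftrightarrow> commutative TYPE('a) \<and>
    (\<exists>X :: ('a \<Rightarrow> complex) topology. is_spectrum TYPE('a) X \<and> totally_disconnected_space X)"
    (is "_ \<longleftrightarrow> ?rhs")
proof
  assume gr: "gr0 TYPE('a) = 0"
  then have comm: "commutative TYPE('a)" by (rule gr0_zero_imp_commutative)
  then have "is_spectrum TYPE('a) (character_space :: ('a \<Rightarrow> complex) topology)"
    by (rule is_spectrum_character_space)
  moreover have "totally_disconnected_space (character_space :: ('a \<Rightarrow> complex) topology)"
    by (rule gr0_zero_imp_totally_disconnected[OF gr locally_compact_character_space
          Hausdorff_character_space iso_C0_gelfand[OF comm]])
  ultimately show ?rhs using comm by blast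
next
  assume ?rhs
  then obtain X :: "('a \<Rightarrow> complex) topology" and \<Phi> :: "'a \<Rightarrow> ('a \<Rightarrow> complex) \<Rightarrow> complex"
    where "commutative TYPE('a)" "locally_compact_space X" "Hausdorff_space X" "iso_C0 \<Phi> X"
      "totally_disconnected_space X"
    unfolding is_spectrum_def by blast
  then show "gr0 TYPE('a) = 0"
    using totally_disconnected_imp_projections_dense projections_dense_imp_gr0_zero by metis
qed

text \<open>A criterion without topology, which can be transferred to the unitization without
  determining the spectrum of the latter.\<close>

lemma gr0_zero_iff_projections_dense:
  "gr0 TYPE('a::cstar_algebra) = 0 \<longleftrightarrow> commutative TYPE('a) \<and> projections_dense TYPE('a)"
proof
  assume "gr0 TYPE('a) = 0"
  then obtain X :: "('a \<Rightarrow> complex) topology" and \<Phi> :: "'a \<Rightarrow> ('a \<Rightarrow> complex) \<Rightarrow> complex"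
    where "commutative TYPE('a)" "locally_compact_space X" "Hausdorff_space X" "iso_C0 \<Phi> X"
      "totally_disconnected_space X"
    unfolding gr0_zero_iff_spectrum is_spectrum_def by blast
  then show "commutative TYPE('a) \<and> projections_dense TYPE('a)"
    using totally_disconnected_imp_projections_dense by metis
qed (simp add: projections_dense_imp_gr0_zero)

section \<open>Passing to the unitization\<close>

lemma commutative_unitization_iff:
  "commutative TYPE('a unitization) \<longleftrightarrow> commutative TYPE('a::cstar_algebra)"
proof
  assume c: "commutative TYPE('a unitization)"
  have "a * b = b * a" for a b :: 'a
    using c[unfolded commutative_def, rule_format, of "Unitize a 0" "Unitize b 0"]
    by (simp add: times_unitization_def scaleC_zero_left)
  then show "commutative TYPE('a)" by (simp add: commutative_def)
next
  assume "commutative TYPE('a)"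
  then show "commutative TYPE('a unitization)"
    by (simp add: commutative_def times_unitization_def mult.commute add.commute add.left_commute)
qed

lemma projections_dense_unitization:
  assumes "projections_dense TYPE('a::cstar_algebra)"
  shows "projections_dense TYPE('a unitization)"
  unfolding projections_dense_def closure_approachable
proof (intro allI impI)
  fix x :: "'a unitization" and e :: real assume x: "self_adjoint x" and "e > 0"
  obtain a \<alpha> where a: "x = Unitize a \<alpha>" by (cases x)
  have sa: "self_adjoint a" and \<alpha>: "\<alpha> = of_real (Re \<alpha>)"
    using x by (auto simp: a self_adjoint_def star_unitization_def complex_eq_iff)
  obtain q where q: "q \<in> span projections" "dist q a < e"
    using assms sa \<open>e > 0\<close> unfolding projections_dense_def closure_approachable by blast
  have "Unitize q 0 \<in> span projections"
    using q(1)
  proof (induction rule: span_induct_alt)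
    case base
    show ?case by (simp add: span_zero flip: zero_unitization_def)
  next
    case (step c p y)
    have "Unitize p 0 \<in> projections"
      using step(1) by (simp add: projections_def self_adjoint_def star_unitization_def
          times_unitization_def scaleC_zero_left)
    then have "c *\<^sub>R Unitize p 0 + Unitize y 0 \<in> span projections"
      using step by (intro span_add span_scale) (simp_all add: span_base)
    then show ?case by (simp add: scaleR_unitization_def plus_unitization_def)
  qed
  moreover have "Unitize 0 1 \<in> projections"
    by (simp add: projections_def self_adjoint_def star_unitization_def star_zero
        times_unitization_def scaleC_zero_right)
  ultimately have "Unitize q 0 + Re \<alpha> *\<^sub>R Unitize 0 1 \<in> span projections"
    by (intro span_add span_scale) (auto intro: span_base)
  moreover have "Unitize q 0 + Re \<alpha> *\<^sub>R Unitize 0 1 = Unitize q \<alpha>"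
    using \<alpha> by (simp add: plus_unitization_def scaleR_unitization_def scaleR_conv_of_real)
  moreover have "dist (Unitize q \<alpha>) x < e"
    using q(2) by (simp add: a dist_norm minus_unitization_def norm_Unitize_zero)
  ultimately show "\<exists>y\<in>span projections. dist y x < e" by metis
qed

lemma alg_part_projection:
  assumes "p \<in> projections"
  shows "alg_part p \<in> span (projections :: 'a::cstar_algebra set)"
proof -
  obtain q \<alpha> where q: "p = Unitize q \<alpha>" by (cases p)
  have sa: "star q = q" and qq: "q * q + \<alpha> *\<^sub>C q + \<alpha> *\<^sub>C q = q" and "\<alpha> * \<alpha> = \<alpha>"
    using assms by (auto simp: q projections_def self_adjoint_def star_unitization_def times_unitization_def)
  then consider "\<alpha> = 0" | "\<alpha> = 1" by auto
  \<comment> \<open>For scalar part 1 the idempotent equation reads \<open>q * q = - q\<close>, so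
    \<open>- q\<close> is a projection.\<close>
  then show ?thesis
  proof cases
    case 1
    then have "q \<in> projections" using sa qq by (simp add: projections_def self_adjoint_def scaleC_zero_left)
    then show ?thesis by (simp add: q span_base)
  next
    case 2
    then have "- q \<in> projections"
      using sa qq by (simp add: projections_def self_adjoint_def star_minus scaleC_one add_eq_0_iff2)
    then have "- (- q) \<in> span projections" by (intro span_neg span_base)
    then show ?thesis by (simp add: q)
  qed
qed

lemma projections_dense_of_unitization:
  assumes "projections_dense TYPE('a::cstar_algebra unitization)"
  shows "projections_dense TYPE('a)"
  unfolding projections_dense_def closure_approachable
proof (intro allI impI)
  fix a :: 'a and e :: real assume "self_adjoint a" "e > 0"
  then have "self_adjoint (Unitize a 0)" by (simp add: self_adjoint_def star_unitization_def)
  \<comment> \<open>Half of \<open>e\<close> is requested because \<open>alg_part\<close> may double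
    the norm.\<close>
  then obtain u where u: "u \<in> span projections" "dist u (Unitize a 0) < e / 2"
    using assms half_gt_zero[OF \<open>e > 0\<close>] unfolding projections_dense_def closure_approachable by blast
  have "alg_part u \<in> span projections"
    using u(1)
  proof (induction rule: span_induct_alt)
    case (step c p y)
    then have "c *\<^sub>R alg_part p + alg_part y \<in> span projections"
      by (intro span_add span_scale) (simp_all add: alg_part_projection)
    then show ?case by (simp add: scaleR_unitization_def plus_unitization_def)
  qed (simp add: zero_unitization_def span_zero)
  moreover have "dist (alg_part u) a < e"
    using norm_alg_part_le[of "u - Unitize a 0"] u(2) by (simp add: dist_norm alg_part_diff)
  ultimately show "\<exists>y\<in>span projections. dist y a < e" by blast
qed

text \<open>This settles the nonunital case of \<open>gr\<close>; in the unital case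
  \<open>gr\<close> is \<open>gr0\<close> by definition.\<close>

lemma gr0_unitization_zero_iff:
  "gr0 TYPE('a unitization) = 0 \<longleftrightarrow> gr0 TYPE('a::cstar_algebra) = 0"
  unfolding gr0_zero_iff_projections_dense commutative_unitization_iff
  using projections_dense_unitization[where 'a = 'a] projections_dense_of_unitization[where 'a = 'a]
  by blast

theorem proposition5p7:
  shows "(gr TYPE('a::cstar_algebra) = 0 \<longleftrightarrow> gr0 TYPE('a) = 0) \<and>
    (gr0 TYPE('a) = 0 \<longleftrightarrow>
      commutative TYPE('a) \<and>
      (\<exists>X :: ('a \<Rightarrow> complex) topology.
        is_spectrum TYPE('a) X \<and> totally_disconnected_space X))"
  by (simp add: gr_def gr0_unitization_zero_iff) (rule gr0_zero_iff_spectrum)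

end
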